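(* Assume that $n \alpha_n \to \alpha \in (0, \infty]$ and $n \alpha_n + \beta_n \to \infty$ as $n\to\infty$. Then, in each of the following cases, with the centering $d_n$ and scaling $c_n$ indicated, $$\frac{(n \alpha_n + \beta_n) \widetilde M_n - d_n}{c_n}$$ converges in distribution as $n\to\infty$, to $G$ in cases (1)--(5) and to $F_\alpha$ in case (6): (1) if $\log n = o(\alpha_n)$: $d_n=\alpha_n + b_n \sqrt{\alpha_n}$ and $c_n=\sqrt{\frac{\alpha_n}{2\log n}}$; (2) if $\frac{\alpha_n}{\log n}$ is bounded away from both $0$ and $\infty$: $d_n=\zeta_n - \left( 1 - \frac{\alpha_n}{\zeta_n} \right)^{-1} \log \left( 1 - \frac{\alpha_n}{\zeta_n} \right)$ and $c_n=\left( 1 - \frac{\alpha_n}{\zeta_n} \right)^{-1}$; (3) if $\frac{\alpha_n}{\log n} \to 0$ and $\alpha_n\to \infty$: $d_n=\log n + (\alpha_n - 1) \log \log n - \log \Gamma (\alpha_n) + \xi_n$ and $c_n=1$; (4) if $\log \alpha_n = o(\log n)$ and $\alpha_n$ is bounded: $d_n=\log n + (\alpha_n - 1) \log \log n - \log \Gamma (\alpha_n)$ and $c_n=1$; (5) if $\alpha_n$ is bounded, $n \alpha_n \to \infty$ and $\frac{\log \alpha_n}{\log n}$ is bounded away from $0$: $d_n=\log (n \alpha_n) + (\alpha_n - 1) \log \log (n \alpha_n)$ and $c_n=1$; (6) if $n \alpha_n \to \alpha \in (0, \infty)$ and $\beta_n\to \infty$: $d_n=0$ and $c_n=\frac{\beta_n}{n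 \alpha_n + \beta_n}$. In case (6) the statement simplifies to: $\beta_n \widetilde M_n$ converges in distribution to $F_\alpha$.
   Context: Let $(\alpha_n)_{n\ge1}$ and $(\beta_n)_{n\ge1}$ be sequences of positive real numbers. For each $n$, let $\boldsymbol{X}_n=(X_{1n},\ldots,X_{nn})$ have the $n$-dimensional Dirichlet distribution with parameters $\alpha_n,\ldots,\alpha_n,\beta_n$ ($\alpha_n$ repeated $n$ times), i.e. with density $$\frac{\Gamma(n\alpha_n+\beta_n)}{\Gamma(\alpha_n)^n\,\Gamma(\beta_n)}\Bigl(\prod_{i=1}^n x_i\Bigr)^{\alpha_n-1}\Bigl(1-\sum_{i=1}^n x_i\Bigr)^{\beta_n-1}$$ on $\{\boldsymbol x: x_i\ge 0,\ 0\le\sum_{i=1}^n x_i\le 1\}$. Let $\widetilde M_n=\max\{X_{1n},\ldots,X_{nn}\}$. $G$ denotes the Gumbel distribution, $G(x)=\exp(-e^{-x})$, $x\in\mathbb R$. For $\alpha\in(0,\infty)$, $F_\alpha$ is the distribution on $(0,\infty)$ with distribution function $F_\alpha(x)=\exp\left(-\alpha\int_x^\infty \frac{e^{-u}}{u}\,du\right)$, $x>0$. The quantities $b_n,\zeta_n,\xi_n$ are defined (for all sufficiently large $n$, in the respective cases in which they are used) as follows. In case (1), $b_n$ is the unique solution, in the region $b_n\sim\sqrt{2\log n}$ (meaning $b_n/\sqrt{2\log n}\to1$), of $\log z + \frac{1}{2} \log (2 \pi) + z \sqrt{\alpha_n} - \alpha_n \log \left(1 + \frac{z}{\sqrt{\alpha_n}}\right)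 = \log n$. In case (2), $\zeta_n/\alpha_n$ is the unique solution bigger than $1$ of $z = 1 + \frac{\log n}{\alpha_n} - \frac{\log \sqrt{2 \pi} + \frac12 \log \alpha_n}{\alpha_n} + \left(1 - \frac1{\alpha_n}\right) \log z$. In case (3), $\xi_n/\log n$ is the unique positive solution of $z = \frac{\alpha_n - 1}{\log n} \log \left[ 1 - \frac{\alpha_n}{\log n} \log \frac{\alpha_n}{\log n} + \frac{\alpha_n - \log \log n}{\log n} + \frac{1}{2} \frac{\log \alpha_n}{\log n} + z \right]$. *)

theory Defs
  imports "HOL-Probability.Probability" "HOL-Library.Landau_Symbols"
begin

text \<open>
  Points of \<open>R^n\<close> are functions on the index set \<open>{1..n}\<close>, and Lebesgue measure on \<open>R^n\<close>
  is the product measure of \<open>n\<close> copies of \<^const>\<open>lborel\<close>.  The convention \<open>0 powr c = 0\<close>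
  changes the density only on a null set.
\<close>

definition dirichlet_density :: "nat \<Rightarrow> real \<Rightarrow> real \<Rightarrow> (nat \<Rightarrow> real) \<Rightarrow> real" where
  "dirichlet_density n a b x =
     (if (\<forall>i\<in>{1..n}. 0 \<le> x i) \<and> (\<Sum>i=1..n. x i) \<le> 1
      then Gamma (real n * a + b) / (Gamma a ^ n * Gamma b)
             * (\<Prod>i=1..n. x i) powr (a - 1) * (1 - (\<Sum>i=1..n. x i)) powr (b - 1)
      else 0)"

definition has_dirichlet ::
    "'a measure \<Rightarrow> nat \<Rightarrow> (nat \<Rightarrow> 'a \<Rightarrow> real) \<Rightarrow> real \<Rightarrow> real \<Rightarrow> bool" where
  "has_dirichlet M n X a b \<longleftrightarrow>
     distributed M (\<Pi>\<^sub>M i\<in>{1..n}. lborel) (\<lambda>\<omega>. \<lambda>i\<in>{1..n}. X i \<omega>)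
       (\<lambda>x. ennreal (dirichlet_density n a b x))"

text \<open>The coordinate \<open>X_{in}\<close> is written \<open>X n i\<close>.\<close>

definition Mtilde :: "(nat \<Rightarrow> nat \<Rightarrow> 'a \<Rightarrow> real) \<Rightarrow> nat \<Rightarrow> 'a \<Rightarrow> real" where
  "Mtilde X n \<omega> = Max ((\<lambda>i. X n i \<omega>) ` {1..n})"

text \<open>The variables \<open>Y n\<close> may live on different probability spaces \<open>M n\<close>; the limit law is
  given by its distribution function \<open>F\<close>.\<close>

definition conv_in_distr ::
    "(nat \<Rightarrow> 'a measure) \<Rightarrow> (nat \<Rightarrow> 'a \<Rightarrow> real) \<Rightarrow> (real \<Rightarrow> real) \<Rightarrow> bool" where
  "conv_in_distr M Y F \<longleftrightarrow> weak_conv (\<lambda>n. cdf (distr (M n) borel (Y n))) F"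

definition gumbel_cdf :: "real \<Rightarrow> real" where
  "gumbel_cdf x = exp (- exp (- x))"

definition F_cdf :: "real \<Rightarrow> real \<Rightarrow> real" where
  "F_cdf a x = (if 0 < x then exp (- a * (LINT u:{x..}|lborel. exp (- u) / u)) else 0)"

text \<open>
  The condition \<open>b_n \<sim> sqrt (2 log n)\<close> concerns the whole sequence, and the equation is only
  required for all sufficiently large \<open>n\<close>.  This determines \<open>b_n\<close> up to finitely many terms,
  so the sequence is selected with \<open>SOME\<close> rather than \<open>THE\<close>.
\<close>

definition b_seq :: "(nat \<Rightarrow> real) \<Rightarrow> nat \<Rightarrow> real" where
  "b_seq \<alpha> = (SOME b.
     (\<forall>\<^sub>F n in sequentially.
        ln (b n) + 1/2 * ln (2 * pi) + b n * sqrt (\<alpha> n)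
          - \<alpha> n * ln (1 + b n / sqrt (\<alpha> n)) = ln (real n)) \<and>
     (\<lambda>n. b n / sqrt (2 * ln (real n))) \<longlonglongrightarrow> 1)"

definition zeta_seq :: "(nat \<Rightarrow> real) \<Rightarrow> nat \<Rightarrow> real" where
  "zeta_seq \<alpha> n = \<alpha> n * (THE z. z > 1 \<and>
     z = 1 + ln (real n) / \<alpha> n - (ln (sqrt (2 * pi)) + 1/2 * ln (\<alpha> n)) / \<alpha> n
           + (1 - 1 / \<alpha> n) * ln z)"

definition xi_seq :: "(nat \<Rightarrow> real) \<Rightarrow> nat \<Rightarrow> real" where
  "xi_seq \<alpha> n = ln (real n) * (THE z. z > 0 \<and>
     z = (\<alpha> n - 1) / ln (real n)
           * ln (1 - \<alpha> n / ln (real n) * ln (\<alpha> n / ln (real n))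
                   + (\<alpha> n - ln (ln (real n))) / ln (real n)
                   + 1/2 * (ln (\<alpha> n) / ln (real n)) + z))"

text \<open>The sequence \<open>((n \<alpha>_n + \<beta>_n) M_n - d_n) / c_n\<close>.\<close>

definition normalized_max ::
    "(nat \<Rightarrow> real) \<Rightarrow> (nat \<Rightarrow> real) \<Rightarrow> (nat \<Rightarrow> nat \<Rightarrow> 'a \<Rightarrow> real) \<Rightarrow>
     (nat \<Rightarrow> real) \<Rightarrow> (nat \<Rightarrow> real) \<Rightarrow> nat \<Rightarrow> 'a \<Rightarrow> real" where
  "normalized_max \<alpha> \<beta> X d c n \<omega> =
     ((real n * \<alpha> n + \<beta> n) * Mtilde X n \<omega> - d n) / c n"

end

theory Submission
  imports Defs "HOL-Real_Asymp.Real_Asymp"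
begin

text \<open>
  If \<open>S\<close> is Gamma distributed with parameter \<open>T = n * \<alpha> n + \<beta> n\<close> and independent of \<open>X n\<close>,
  then the coordinates of \<open>S * X n\<close> are independent Gamma variables with parameter \<open>\<alpha> n\<close>, so
  \<open>S * Mtilde X n\<close> has distribution function \<open>F ^ n\<close> with \<open>F\<close> the Gamma distribution function.
  By Chebyshev's inequality \<open>S / T\<close> differs from \<open>1\<close> by \<open>O(1 / sqrt T)\<close>, which is negligible on
  the scale \<open>c n\<close>. It remains to show \<open>n * (1 - F (d n + c n * x)) \<longlonglongrightarrow> exp (- x)\<close>. The tail
  \<open>1 - F y\<close> is asymptotic to the density at \<open>y\<close> divided by \<open>1 - (\<alpha> n - 1) / y\<close>, uniformly in
  the parameter as long as \<open>(\<alpha> n - 1) / (y - \<alpha> n + 1)\<^sup>2\<close> is small, and with Stirling's formula the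
  equations for \<open>b\<close>, \<open>\<zeta>\<close> and \<open>\<xi>\<close> turn into the required limit. When \<open>n * \<alpha> n\<close>
  converges, the tail multiplied by \<open>n\<close> converges by dominated convergence.
\<close>

section \<open>Stirling's formula for the Gamma function\<close>

text \<open>The shape may tend to 0, stay bounded or outgrow \<open>ln n\<close>, so tail
  asymptotics for a fixed shape do not suffice; what matters is whether the shape is negligible
  against the centering. If \<open>\<alpha> n / d n\<close> tends to 0, the factor
  \<open>1 - (\<alpha> n - 1) / y\<close> disappears, the scale is 1, and the centering only has to
  be an approximate fixed point of
  \<open>y = ln n + (\<alpha> n - 1) * ln y - ln (Gamma (\<alpha> n))\<close>. Otherwise the factor
  survives and sets the scale, and the exponent is expanded around a point
  \<open>\<alpha> n + w n\<close> by Stirling's formula.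

  In these terms, \<open>b\<close> makes n times the approximate tail at
  \<open>\<alpha> n + b * sqrt (\<alpha> n)\<close> equal to 1; \<open>\<zeta>\<close> makes n times
  the approximate density equal to 1, so a further shift has to absorb the factor; and
  \<open>\<xi>\<close> comes from the fixed point equation with Gamma replaced by Stirling's formula
  without its constant.

  The parameter \<open>\<beta> n\<close> enters only through \<open>T\<close>. In the Gumbel cases
  \<open>T \<ge> n * \<alpha> n\<close> alone gives enough concentration of the multiplier; when
  \<open>n * \<alpha> n\<close> stays bounded, concentration comes from \<open>T\<close> tending to
  infinity.\<close>

lemma not_nonpos_Ints_real_pos: "x > 0 \<Longrightarrow> (x :: real) \<notin> \<int>\<^sub>\<le>\<^sub>0"
  by (auto elim!: nonpos_Ints_cases)

lemma Gamma_real_plus1: "x > 0 \<Longrightarrow> Gamma (x + 1 :: real) = x * Gamma x"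
  by (rule Gamma_plus1[OF not_nonpos_Ints_real_pos])

lemma ln_Gamma_plus1: "x > 0 \<Longrightarrow> ln (Gamma (x + 1 :: real)) = ln x + ln (Gamma x)"
  using Gamma_real_pos[of x, THEN less_imp_neq] by (subst Gamma_real_plus1, simp, subst ln_mult) auto

text \<open>The remainder is 1-periodic up to a telescoping error, so it converges along every shifted
  sequence of integers; Euler's limit formula for \<^term>\<open>Gamma\<close> shows that the limit does not
  depend on the shift, and Legendre's duplication formula identifies it.\<close>

definition stirling_rem :: "real \<Rightarrow> real" where
  "stirling_rem x = ln (Gamma x) - (x - 1/2) * ln x + x"

text \<open>The difference is \<open>(x + 1/2) * ln (1 + 1 / x) - 1\<close>. Midpoint and
  trapezoidal bounds for the integral of \<open>1 / t\<close> over \<open>[x, x + 1]\<close> give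
  the two estimates, the upper one in a form that telescopes.\<close>

lemma stirling_rem_step:
  assumes "x > 0"
  shows "0 \<le> stirling_rem x - stirling_rem (x + 1)"
    and "stirling_rem x - stirling_rem (x + 1) \<le> 1 / (4 * x) - 1 / (4 * (x + 1))"
proof -
  have G: "ln (Gamma (x + 1)) = ln x + ln (Gamma x)"
    using assms by (rule ln_Gamma_plus1)
  have eq: "stirling_rem x - stirling_rem (x + 1) = (x + 1/2) * (ln (x + 1) - ln x) - 1"
    unfolding stirling_rem_def G by (simp add: algebra_simps)
  have "2 * (x + 1 - x) / (x + (x + 1)) \<le> ln (x + 1) - ln x"
    using ln_inverse_approx_ge[of x "x + 1"] assms by simp
  hence "(x + 1/2) * (2 / (2 * x + 1)) \<le> (x + 1/2) * (ln (x + 1) - ln x)"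
    using assms by (intro mult_left_mono) (auto simp: algebra_simps)
  also have "(x + 1/2) * (2 / (2 * x + 1)) = 1"
    using assms by (simp add: field_simps)
  finally show "0 \<le> stirling_rem x - stirling_rem (x + 1)" using eq by simp
  have "ln (x + 1) - ln x \<le> 1 * (inverse x + inverse (x + 1)) / 2"
    using ln_inverse_approx_le[of x 1] assms by simp
  hence "(x + 1/2) * (ln (x + 1) - ln x) \<le> (x + 1/2) * ((inverse x + inverse (x + 1)) / 2)"
    using assms by (intro mult_left_mono) auto
  moreover have "(x + 1/2) * ((inverse x + inverse (x + 1)) / 2) - 1 = 1 / (4 * x) - 1 / (4 * (x + 1))"
    using assms by (simp add: divide_simps) (simp add: algebra_simps)
  ultimately show "stirling_rem x - stirling_rem (x + 1) \<le> 1 / (4 * x) - 1 / (4 * (x + 1))"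
    using eq by simp
qed

lemma stirling_rem_shift:
  assumes "x > 0"
  shows "stirling_rem (x + real n) \<le> stirling_rem x"
    and "stirling_rem x - stirling_rem (x + real n) \<le> 1 / (4 * x) - 1 / (4 * (x + real n))"
proof (induction n)
  case (Suc n)
  { case 1 thus ?case using Suc stirling_rem_step(1)[of "x + real n"] assms by (simp add: add_ac) }
  { case 2 thus ?case using Suc stirling_rem_step(2)[of "x + real n"] assms by (simp add: add_ac) }
qed auto

text \<open>This is the logarithm of Euler's limit formula: writing the Pochhammer symbol as a
  quotient of Gamma values, \<open>ln (Gamma x)\<close> minus the logarithm of the n-th Euler
  approximant is exactly the displayed expression.\<close>

lemma Gamma_shift_ratio_tendsto:
  fixes x :: real assumes "x > 0"
  shows "(\<lambda>n. ln (Gamma (x + real n + 1)) - ln (Gamma (real n + 1)) - x * ln (real n)) \<longlonglongrightarrow> 0"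
proof -
  note np = not_nonpos_Ints_real_pos[OF assms]
  have Gx: "Gamma x > 0" using assms by (rule Gamma_real_pos)
  have "(\<lambda>n. ln (Gamma x) - ln (Gamma_series x n)) \<longlonglongrightarrow> ln (Gamma x) - ln (Gamma x)"
    using Gx by (intro tendsto_intros Gamma_series_LIMSEQ) auto
  moreover have "\<forall>\<^sub>F n in sequentially. ln (Gamma x) - ln (Gamma_series x n) =
      ln (Gamma (x + real n + 1)) - ln (Gamma (real n + 1)) - x * ln (real n)"
    using eventually_gt_at_top[of 0]
  proof eventually_elim
    case (elim n)
    have p: "pochhammer x (n + 1) = Gamma (x + real n + 1) / Gamma x"
      using pochhammer_Gamma[OF np, of "n + 1"] by (simp add: add_ac)
    have g: "Gamma (x + real n + 1) > 0" using assms by (intro Gamma_real_pos) auto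
    have f: "fact n = Gamma (real n + 1)" using Gamma_fact[of n, where 'a = real] by (simp add: add_ac)
    show ?case
      unfolding Gamma_series_def p using Gx g elim
      by (simp add: ln_mult ln_div f[symmetric])
  qed
  ultimately show ?thesis by (simp add: tendsto_cong)
qed

lemma stirling_rem_shift_diff:
  fixes x :: real assumes "x > 0"
  shows "(\<lambda>n. stirling_rem (x + real n + 1) - stirling_rem (real n + 1)) \<longlonglongrightarrow> 0"
proof -
  have 1: "(\<lambda>n. (x + real n + 1/2) * ln (x + real n + 1) - (real n + 1/2) * ln (real n + 1)
      - x - x * ln (real n)) \<longlonglongrightarrow> 0"
    using assms by real_asymp
  show ?thesis
    using tendsto_diff[OF Gamma_shift_ratio_tendsto[OF assms] 1]
    by (simp add: stirling_rem_def algebra_simps)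
qed

lemma stirling_rem_tendsto_const: "\<exists>c. (stirling_rem \<longlongrightarrow> c) at_top"
proof -
  have "decseq (\<lambda>n. stirling_rem (1 + real n))"
    using stirling_rem_step(1)[of "1 + real n" for n] by (intro decseq_SucI) (simp add: add_ac)
  moreover have "stirling_rem 1 - 1 \<le> stirling_rem (1 + real n)" for n
  proof -
    have "0 \<le> 1 / (4 * (1 + real n))" by simp
    thus ?thesis using stirling_rem_shift(2)[of 1 n] by linarith
  qed
  ultimately obtain c where c: "(\<lambda>n. stirling_rem (1 + real n)) \<longlonglongrightarrow> c"
    using decseq_convergent[of "\<lambda>n. stirling_rem (1 + real n)" "stirling_rem 1 - 1"] by blast
  \<comment> \<open>Shifting \<open>x\<close> by every natural number squeezes \<open>c\<close>
    between \<open>stirling_rem x - 1 / (4 * x)\<close> and \<open>stirling_rem x\<close>. This rate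
    turns convergence along integers into convergence along the reals.\<close>
  have b: "\<bar>stirling_rem x - c\<bar> \<le> 1 / (4 * x)" if "x > 0" for x
  proof -
    have "(\<lambda>n. stirling_rem (x + real n + 1) - stirling_rem (real n + 1) + stirling_rem (1 + real n)) \<longlonglongrightarrow> 0 + c"
      by (intro tendsto_add stirling_rem_shift_diff that c)
    hence "(\<lambda>n. stirling_rem (x + real (Suc n))) \<longlonglongrightarrow> c" by (simp add: add_ac)
    hence l: "(\<lambda>n. stirling_rem (x + real n)) \<longlonglongrightarrow> c" by (rule LIMSEQ_imp_Suc)
    have "c \<le> stirling_rem x"
      using stirling_rem_shift(1)[OF that] by (intro LIMSEQ_le_const2[OF l]) auto
    moreover have "stirling_rem x - 1 / (4 * x) \<le> c"
    proof (intro LIMSEQ_le_const[OF l] exI allI impI)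
      fix n have "0 \<le> 1 / (4 * (x + real n))" using that by simp
      thus "stirling_rem x - 1 / (4 * x) \<le> stirling_rem (x + real n)"
        using stirling_rem_shift(2)[OF that, of n] by linarith
    qed
    ultimately show ?thesis by simp
  qed
  have "((\<lambda>x. stirling_rem x - c) \<longlongrightarrow> 0) at_top"
  proof (rule Lim_null_comparison)
    show "\<forall>\<^sub>F x in at_top. norm (stirling_rem x - c) \<le> 1 / (4 * x)"
      using eventually_gt_at_top[of 0] by eventually_elim (use b in auto)
    show "((\<lambda>x::real. 1 / (4 * x)) \<longlongrightarrow> 0) at_top" by real_asymp
  qed
  thus ?thesis by (intro exI[of _ c]) (simp add: LIM_zero_iff)
qed

lemma Gamma_legendre_duplication_real:
  fixes x :: real assumes "x > 0"
  shows "Gamma x * Gamma (x + 1/2) = exp ((1 - 2 * x) * ln 2) * sqrt pi * Gamma (2 * x)"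
proof -
  have np: "complex_of_real y \<notin> \<int>\<^sub>\<le>\<^sub>0" if "y > 0" for y
    using that by (auto simp: of_real_in_nonpos_Ints_iff elim!: nonpos_Ints_cases)
  have "Gamma (complex_of_real x) * Gamma (complex_of_real (x + 1/2)) =
      complex_of_real (exp ((1 - 2 * x) * ln 2) * sqrt pi) * Gamma (complex_of_real (2 * x))"
    using Gamma_legendre_duplication[of "complex_of_real x"] np[of x] np[of "x + 1/2"] assms
    by (simp flip: exp_of_real)
  thus ?thesis unfolding Gamma_complex_of_real by (simp flip: of_real_mult)
qed

text \<open>By duplication the combination at \<open>x\<close>, \<open>x + 1/2\<close> and
  \<open>2 * x\<close> contains no Gamma value and equals the elementary function \<open>h\<close>.
  It also tends to \<open>c + c - c\<close>, so \<open>c\<close> is read off from the limit of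
  \<open>h\<close>.\<close>

lemma stirling_rem_tendsto: "(stirling_rem \<longlongrightarrow> ln (2 * pi) / 2) at_top"
proof -
  obtain c where c: "(stirling_rem \<longlongrightarrow> c) at_top" using stirling_rem_tendsto_const by blast
  define h where "h x = (1 - 2 * x) * ln 2 + ln pi / 2 + (2 * x - 1/2) * ln (2 * x)
     - (x - 1/2) * ln x - x * ln (x + 1/2) + 1/2" for x :: real
  have ev: "\<forall>\<^sub>F x in at_top. stirling_rem x + stirling_rem (x + 1/2) - stirling_rem (2 * x) = h x"
    using eventually_gt_at_top[of 0]
  proof eventually_elim
    case (elim x)
    have g: "Gamma x > 0" "Gamma (x + 1/2) > 0" "Gamma (2 * x) > 0" using elim by (auto intro!: Gamma_real_pos)
    have "Gamma x * Gamma (x + 1/2) = exp ((1 - 2 * x) * ln 2) * sqrt pi * Gamma (2 * x)"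
      using elim by (rule Gamma_legendre_duplication_real)
    hence "ln (Gamma x * Gamma (x + 1/2)) = ln (exp ((1 - 2 * x) * ln 2) * sqrt pi * Gamma (2 * x))"
      by simp
    hence "ln (Gamma x) + ln (Gamma (x + 1/2)) = (1 - 2 * x) * ln 2 + ln pi / 2 + ln (Gamma (2 * x))"
      using g by (simp add: ln_mult ln_sqrt)
    thus ?case unfolding stirling_rem_def h_def by (simp add: algebra_simps)
  qed
  have "(h \<longlongrightarrow> ln (2 * pi) / 2) at_top"
  proof -
    have "((\<lambda>x. h x - (ln 2 + ln pi) / 2) \<longlongrightarrow> 0) at_top"
      unfolding h_def by real_asymp
    thus ?thesis by (simp add: LIM_zero_iff ln_mult)
  qed
  moreover have "((\<lambda>x. stirling_rem x + stirling_rem (x + 1/2) - stirling_rem (2 * x)) \<longlongrightarrow> c + c - c) at_top"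
    by (intro tendsto_add tendsto_diff c filterlim_compose[OF c]) real_asymp+
  ultimately have "c = ln (2 * pi) / 2"
    using tendsto_unique[of at_top h] tendsto_cong[OF ev] by (metis add_diff_cancel_right' trivial_limit_at_top_linorder)
  with c show ?thesis by metis
qed

section \<open>Gamma distributions and their tails\<close>

definition gamma_density :: "real \<Rightarrow> real \<Rightarrow> real" where
  "gamma_density a x = indicator {0..} x * x powr (a - 1) * exp (- x) / Gamma a"

definition gamma_law :: "real \<Rightarrow> real measure" where
  "gamma_law a = density lborel (\<lambda>x. ennreal (gamma_density a x))"

lemma gamma_density_measurable [measurable]: "gamma_density a \<in> borel_measurable borel"
  unfolding gamma_density_def[abs_def] by measurable

lemma gamma_density_nonneg: "a > 0 \<Longrightarrow> 0 \<le> gamma_density a x"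
  by (simp add: gamma_density_def)

lemma nn_integral_powr_exp:
  assumes "a > 0"
  shows "(\<integral>\<^sup>+x. ennreal (indicator {0..} x * x powr (a - 1) * exp (- x)) \<partial>lborel) = ennreal (Gamma a)"
  using Gamma_conv_nn_integral_real[OF assms] by (simp add: exp_minus divide_inverse)

lemma nn_integral_gamma_density:
  assumes "a > 0"
  shows "(\<integral>\<^sup>+x. ennreal (gamma_density a x) \<partial>lborel) = 1"
proof -
  have G: "Gamma a > 0" using assms by simp
  have "(\<integral>\<^sup>+x. ennreal (gamma_density a x) \<partial>lborel) =
      (\<integral>\<^sup>+x. ennreal (1 / Gamma a) * ennreal (indicator {0..} x * x powr (a - 1) * exp (- x)) \<partial>lborel)"
    using G by (intro nn_integral_cong) (simp add: gamma_density_def flip: ennreal_mult)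
  also have "\<dots> = ennreal (1 / Gamma a) * ennreal (Gamma a)"
    by (subst nn_integral_cmult) (simp_all only: nn_integral_powr_exp[OF assms], measurable)
  also have "\<dots> = 1" using G by (simp flip: ennreal_mult)
  finally show ?thesis .
qed

lemma sets_gamma_law [simp, measurable_cong]: "sets (gamma_law a) = sets borel"
  by (simp add: gamma_law_def)

lemma space_gamma_law [simp]: "space (gamma_law a) = UNIV"
  by (simp add: gamma_law_def)

lemma prob_space_gamma_law: "a > 0 \<Longrightarrow> prob_space (gamma_law a)"
  by (rule prob_spaceI) (simp add: gamma_law_def emeasure_density nn_integral_gamma_density)

definition gamma_tail :: "real \<Rightarrow> real \<Rightarrow> real" where
  "gamma_tail a y = measure (gamma_law a) {y<..}"

lemma gamma_tail_nonneg: "0 \<le> gamma_tail a y"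
  by (simp add: gamma_tail_def)

lemma nn_integral_gamma_tail:
  assumes "a > 0" "y > 0"
  shows "(\<integral>\<^sup>+x. ennreal (x powr (a - 1) * exp (- x)) * indicator {y..} x \<partial>lborel) =
      ennreal (Gamma a * gamma_tail a y)"
proof -
  interpret prob_space "gamma_law a" by (rule prob_space_gamma_law) fact
  have G: "Gamma a \<noteq> 0" "Gamma a \<ge> 0" using Gamma_real_pos[OF assms(1)] by linarith+
  \<comment> \<open>The tail is the measure of the open ray, the integral runs over the closed one;
    they differ by a null set.\<close>
  have "AE x in lborel. x \<noteq> y" by (rule AE_lborel_singleton)
  hence "(\<integral>\<^sup>+x. ennreal (x powr (a - 1) * exp (- x)) * indicator {y..} x \<partial>lborel) =
      (\<integral>\<^sup>+x. ennreal (Gamma a) * (ennreal (gamma_density a x) * indicator {y<..} x) \<partial>lborel)"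
    using G assms by (intro nn_integral_cong_AE)
      (auto simp: gamma_density_def indicator_def elim!: eventually_mono simp flip: ennreal_mult)
  also have "\<dots> = ennreal (Gamma a) * emeasure (gamma_law a) {y<..}"
    by (subst nn_integral_cmult) (auto simp: gamma_law_def emeasure_density)
  also have "\<dots> = ennreal (Gamma a * gamma_tail a y)"
    using G by (simp add: gamma_tail_def emeasure_eq_measure ennreal_mult)
  finally show ?thesis .
qed

text \<open>With \<open>g t = t powr c * exp (- t)\<close>, the function \<open>g t * t / (t - c)\<close> is an antiderivative of
  \<open>- g t * (1 + c / (t - c)\<^sup>2)\<close>, and the last factor is close to \<open>1\<close>.\<close>

lemma gamma_tail_estimate:
  assumes a: "a > 0" and y: "y \<ge> 1" "y > a - 1"
  defines "I \<equiv> Gamma a * gamma_tail a y"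
    and "\<psi> \<equiv> y powr (a - 1) * exp (- y) * (y / (y - (a - 1)))"
    and "K \<equiv> \<bar>a - 1\<bar> / (y - (a - 1))\<^sup>2"
  shows "\<bar>\<psi> - I\<bar> \<le> K * I"
proof -
  define c where "c = a - 1"
  define g where "g t = t powr c * exp (- t)" for t :: real
  define f where "f t = g t * (1 + c / (t - c)\<^sup>2)" for t
  define F where "F t = - (exp (c * ln t - t) * (t / (t - c)))" for t
  have c: "c > -1" "y > c" using a y by (auto simp: c_def)
  have g: "g t = exp (c * ln t - t)" if "t > 0" for t
    using that by (simp add: g_def powr_def exp_diff exp_minus field_simps)
  have g0: "0 \<le> g t" for t by (simp add: g_def)
  have K: "\<bar>c / (t - c)\<^sup>2\<bar> \<le> K" if "t \<ge> y" for t
  proof -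
    have "\<bar>c\<bar> / (t - c)\<^sup>2 \<le> \<bar>c\<bar> / (y - c)\<^sup>2"
      using that c by (intro divide_left_mono mult_pos_pos power_mono) auto
    thus ?thesis by (simp add: K_def c_def)
  qed
  \<comment> \<open>Nonnegativity is needed to integrate \<open>f\<close> by its antiderivative. For
    negative \<open>c\<close> it rests on \<open>c > -1\<close> and on \<open>t - c \<ge> 1\<close>,
    which comes from \<open>y \<ge> 1\<close>.\<close>
  have f0: "0 \<le> f t" if "t \<ge> y" for t
  proof (cases "c \<ge> 0")
    case False
    have "1 \<le> (t - c)\<^sup>2" using that y False by (intro one_le_power) auto
    hence "-1 \<le> c / (t - c)\<^sup>2" using c by (subst le_divide_eq) auto
    thus ?thesis unfolding f_def using g0 by (intro mult_nonneg_nonneg) auto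
  qed (auto simp: f_def intro!: mult_nonneg_nonneg g0)
  have I: "(\<integral>\<^sup>+x. ennreal (g x) * indicator {y..} x \<partial>lborel) = ennreal I"
    using nn_integral_gamma_tail[of a y] a y by (simp add: I_def g_def c_def)
  have I0: "0 \<le> I" using a by (simp add: I_def gamma_tail_nonneg)
  have [measurable]: "g \<in> borel_measurable borel" "f \<in> borel_measurable borel"
    unfolding f_def g_def by measurable
  have Fy: "- F y = \<psi>"
    using y g[of y] by (simp add: F_def \<psi>_def g_def c_def)
  have psi: "(\<integral>\<^sup>+x. ennreal (f x) * indicator {y..} x \<partial>lborel) = ennreal \<psi>"
  proof -
    have "(\<integral>\<^sup>+x. ennreal (f x) * indicator {y..} x \<partial>lborel) = 0 - F y"
    proof (rule nn_integral_FTC_atLeast)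
      fix x assume x: "y \<le> x"
      show "(F has_real_derivative f x) (at x)"
        unfolding F_def f_def g[of x, OF less_le_trans[OF _ x], OF less_le_trans[OF _ y(1)], OF zero_less_one]
        using x y c
        by (auto intro!: derivative_eq_intros simp: divide_simps) (simp add: algebra_simps power2_eq_square)
    next
      show "(F \<longlongrightarrow> 0) at_top" unfolding F_def by real_asymp
    qed (use f0 in auto)
    thus ?thesis using Fy by simp
  qed
  have K0: "K \<ge> 0" by (simp add: K_def)
  have psi0: "0 \<le> \<psi>" using y by (simp add: \<psi>_def)
  have gf: "\<bar>f t - g t\<bar> \<le> K * g t" if "t \<ge> y" for t
  proof -
    have "f t - g t = (c / (t - c)\<^sup>2) * g t" by (simp add: f_def algebra_simps)
    thus ?thesis using mult_right_mono[OF K[OF that] g0[of t]] g0[of t] by (simp add: abs_mult)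
  qed
  have "ennreal \<psi> \<le> (\<integral>\<^sup>+x. ennreal (1 + K) * (ennreal (g x) * indicator {y..} x) \<partial>lborel)"
    unfolding psi[symmetric]
  proof (intro nn_integral_mono)
    fix x
    have "ennreal (f x) \<le> ennreal (1 + K) * ennreal (g x)" if "y \<le> x"
    proof -
      have "f x \<le> (1 + K) * g x" using gf[OF that] by (simp add: distrib_right)
      hence "ennreal (f x) \<le> ennreal ((1 + K) * g x)" by (rule ennreal_leI)
      also have "\<dots> = ennreal (1 + K) * ennreal (g x)" using K0 g0 by (intro ennreal_mult) auto
      finally show ?thesis .
    qed
    thus "ennreal (f x) * indicator {y..} x \<le> ennreal (1 + K) * (ennreal (g x) * indicator {y..} x)"
      by (auto simp: indicator_def)
  qed
  also have "\<dots> = ennreal ((1 + K) * I)"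
    using K0 I0 by (subst nn_integral_cmult) (auto simp: I ennreal_mult)
  finally have 1: "\<psi> \<le> (1 + K) * I" using K0 I0 by (subst (asm) ennreal_le_iff) auto
  \<comment> \<open>Subtraction is avoided in the extended reals: the other half of
    \<open>\<bar>f - g\<bar> \<le> K * g\<close> is integrated as
    \<open>g \<le> f + K * g\<close>.\<close>
  have "ennreal I \<le> (\<integral>\<^sup>+x. ennreal (f x) * indicator {y..} x + ennreal K * (ennreal (g x) * indicator {y..} x) \<partial>lborel)"
    unfolding I[symmetric]
  proof (intro nn_integral_mono)
    fix x
    show "ennreal (g x) * indicator {y..} x \<le> ennreal (f x) * indicator {y..} x + ennreal K * (ennreal (g x) * indicator {y..} x)"
      using gf[of x] K0 g0[of x] f0[of x]
      by (auto simp: indicator_def algebra_simps simp flip: ennreal_mult ennreal_plus intro!: ennreal_leI)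
  qed
  also have "\<dots> = ennreal (\<psi> + K * I)"
    using K0 I0 psi0 by (subst nn_integral_add) (auto simp: I psi nn_integral_cmult ennreal_mult)
  finally have 2: "I \<le> \<psi> + K * I" using K0 I0 psi0 by (subst (asm) ennreal_le_iff) auto
  show ?thesis using 1 2 by (simp add: abs_le_iff algebra_simps)
qed

text \<open>\<open>En\<close> is n times the approximate tail, and its exponent is the sequence in
  the last hypothesis. The error in \<open>gamma_tail_estimate\<close> is relative to the tail
  itself, so the scaled tail lies between \<open>En n / (1 + Kn n)\<close> and
  \<open>En n / (1 - Kn n)\<close> without any prior bound on it.\<close>

lemma gamma_tail_limit:
  fixes al y :: "nat \<Rightarrow> real"
  assumes ev: "\<forall>\<^sub>F n in sequentially. al n > 0 \<and> y n \<ge> 1 \<and> y n > al n - 1"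
    and K: "(\<lambda>n. (al n - 1) / (y n - (al n - 1))\<^sup>2) \<longlonglongrightarrow> 0"
    and E: "(\<lambda>n. ln (real n) + (al n - 1) * ln (y n) - y n - ln (Gamma (al n))
              - ln (1 - (al n - 1) / y n)) \<longlonglongrightarrow> - x"
  shows "(\<lambda>n. real n * gamma_tail (al n) (y n)) \<longlonglongrightarrow> exp (- x)"
proof -
  define Kn where "Kn n = \<bar>al n - 1\<bar> / (y n - (al n - 1))\<^sup>2" for n
  define En where "En n = exp (ln (real n) + (al n - 1) * ln (y n) - y n - ln (Gamma (al n))
              - ln (1 - (al n - 1) / y n))" for n
  have K0: "Kn \<longlonglongrightarrow> 0"
    using tendsto_rabs_zero[OF K] by (simp add: Kn_def[abs_def] abs_divide)
  have E0: "En \<longlonglongrightarrow> exp (- x)"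
    unfolding En_def by (intro tendsto_exp E)
  have evK: "\<forall>\<^sub>F n in sequentially. Kn n < 1"
    using order_tendstoD(2)[OF K0, of 1] by simp
  have key: "\<forall>\<^sub>F n in sequentially. \<bar>En n - real n * gamma_tail (al n) (y n)\<bar> \<le> Kn n * (real n * gamma_tail (al n) (y n))"
    using ev eventually_gt_at_top[of 0]
  proof eventually_elim
    case (elim n)
    define a yy where "a = al n" and "yy = y n"
    have a: "a > 0" "yy \<ge> 1" "yy > a - 1" and n: "n > 0" using elim by (auto simp: a_def yy_def)
    have G: "Gamma a > 0" using a by simp
    have "1 - (a - 1) / yy > 0" using a by (simp add: field_simps)
    hence "En n = real n / Gamma a * (yy powr (a - 1) * exp (- yy) * (1 / (1 - (a - 1) / yy)))"
      using a G n unfolding En_def a_def[symmetric] yy_def[symmetric]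
      by (simp add: exp_diff exp_add powr_def exp_minus divide_inverse)
    also have "1 / (1 - (a - 1) / yy) = yy / (yy - (a - 1))"
      using a by (simp add: field_simps)
    finally have En: "En n = real n / Gamma a * (yy powr (a - 1) * exp (- yy) * (yy / (yy - (a - 1))))" .
    have "real n / Gamma a * \<bar>yy powr (a - 1) * exp (- yy) * (yy / (yy - (a - 1))) - Gamma a * gamma_tail a yy\<bar>
        \<le> real n / Gamma a * (Kn n * (Gamma a * gamma_tail a yy))"
      using gamma_tail_estimate[OF a] G unfolding Kn_def a_def[symmetric] yy_def[symmetric]
      by (intro mult_left_mono) auto
    also have "real n / Gamma a * (Kn n * (Gamma a * gamma_tail a yy)) = Kn n * (real n * gamma_tail a yy)"
      using G by simp
    also have "real n / Gamma a * \<bar>yy powr (a - 1) * exp (- yy) * (yy / (yy - (a - 1))) - Gamma a * gamma_tail a yy\<bar>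
      = \<bar>real n / Gamma a * (yy powr (a - 1) * exp (- yy) * (yy / (yy - (a - 1))) - Gamma a * gamma_tail a yy)\<bar>"
      using G by (simp add: abs_mult)
    also have "real n / Gamma a * (yy powr (a - 1) * exp (- yy) * (yy / (yy - (a - 1))) - Gamma a * gamma_tail a yy)
       = En n - real n * gamma_tail a yy"
      unfolding En using G by (simp add: right_diff_distrib)
    finally show ?case by (simp add: a_def yy_def)
  qed
  show ?thesis
  proof (rule tendsto_sandwich)
    show "\<forall>\<^sub>F n in sequentially. En n / (1 + Kn n) \<le> real n * gamma_tail (al n) (y n)"
      using key
    proof eventually_elim
      case (elim n)
      have "Kn n \<ge> 0" by (simp add: Kn_def)
      thus ?case using elim by (simp add: divide_le_eq algebra_simps)
    qed
    show "\<forall>\<^sub>F n in sequentially. real n * gamma_tail (al n) (y n) \<le> En n / (1 - Kn n)"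
      using key evK by eventually_elim (simp add: le_divide_eq algebra_simps)
    show "(\<lambda>n. En n / (1 + Kn n)) \<longlonglongrightarrow> exp (- x)"
      using tendsto_divide[OF E0 tendsto_add[OF tendsto_const[of 1] K0]] by simp
    show "(\<lambda>n. En n / (1 - Kn n)) \<longlonglongrightarrow> exp (- x)"
      using tendsto_divide[OF E0 tendsto_diff[OF tendsto_const[of 1] K0]] by simp
  qed
qed

section \<open>Concentration of the Gamma multiplier\<close>

text \<open>Expanding the square gives the Gamma integrals at \<open>T + 2\<close>,
  \<open>T + 1\<close> and \<open>T\<close>, and
  \<open>(T + 1) * T - 2 * T * T + T * T = T\<close>.\<close>

lemma gamma_law_variance:
  assumes "T > 0"
  shows "(\<integral>\<^sup>+s. ennreal ((s - T)\<^sup>2) \<partial>gamma_law T) = ennreal T"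
proof -
  have G: "Gamma T > 0" using assms by simp
  have 1: "Gamma (T + 1) = T * Gamma T" "Gamma (T + 2) = (T + 1) * T * Gamma T"
    using Gamma_real_plus1[of T] Gamma_real_plus1[of "T + 1"] assms by (simp_all add: add_ac)
  have "((\<lambda>t. t powr (T + 2 - 1) / exp t - 2 * T * (t powr (T + 1 - 1) / exp t) + T\<^sup>2 * (t powr (T - 1) / exp t))
      has_integral Gamma (T + 2) - 2 * T * Gamma (T + 1) + T\<^sup>2 * Gamma T) {0..}"
    using assms by (intro has_integral_add has_integral_diff has_integral_mult_right Gamma_integral_real) auto
  also have "Gamma (T + 2) - 2 * T * Gamma (T + 1) + T\<^sup>2 * Gamma T = T * Gamma T"
    unfolding 1 by (simp add: algebra_simps power2_eq_square)
  finally have I: "((\<lambda>t. t powr (T + 2 - 1) / exp t - 2 * T * (t powr (T + 1 - 1) / exp t) + T\<^sup>2 * (t powr (T - 1) / exp t))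
      has_integral T * Gamma T) {0..}" .
  have "((\<lambda>t. (t - T)\<^sup>2 * (t powr (T - 1) / exp t)) has_integral T * Gamma T) {0..}"
  proof (rule has_integral_eq[OF _ I])
    fix t :: real assume "t \<in> {0..}"
    hence t: "t powr (T + 1 - 1) = t * t powr (T - 1)" "t powr (T + 2 - 1) = t\<^sup>2 * t powr (T - 1)"
      using assms by (cases "t = 0"; simp add: powr_add powr_diff power2_eq_square field_simps)+
    show "t powr (T + 2 - 1) / exp t - 2 * T * (t powr (T + 1 - 1) / exp t) + T\<^sup>2 * (t powr (T - 1) / exp t)
      = (t - T)\<^sup>2 * (t powr (T - 1) / exp t)"
      unfolding t by (simp add: field_simps power2_eq_square)
  qed
  from has_integral_mult_right[OF this, of "1 / Gamma T"]
  have "((\<lambda>t. 1 / Gamma T * ((t - T)\<^sup>2 * (t powr (T - 1) / exp t))) has_integral T) {0..}"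
    using G by simp
  from nn_integral_has_integral_lebesgue[OF _ this]
  have *: "(\<integral>\<^sup>+t. ennreal (indicator {0..} t * (1 / Gamma T * ((t - T)\<^sup>2 * (t powr (T - 1) / exp t)))) \<partial>lborel) = ennreal T"
    using G by simp
  have "(\<integral>\<^sup>+s. ennreal ((s - T)\<^sup>2) \<partial>gamma_law T) =
    (\<integral>\<^sup>+s. ennreal (gamma_density T s) * ennreal ((s - T)\<^sup>2) \<partial>lborel)"
    unfolding gamma_law_def by (subst nn_integral_density) auto
  also have "\<dots> = (\<integral>\<^sup>+t. ennreal (indicator {0..} t * (1 / Gamma T * ((t - T)\<^sup>2 * (t powr (T - 1) / exp t)))) \<partial>lborel)"
    using assms by (intro nn_integral_cong)
      (simp add: gamma_density_def exp_minus divide_inverse mult_ac flip: ennreal_mult)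
  finally show ?thesis using * by simp
qed

lemma gamma_law_deviation:
  assumes "T > 0" "d > 0"
  shows "measure (gamma_law T) {s. d \<le> \<bar>s - T\<bar>} \<le> T / d\<^sup>2"
proof -
  interpret prob_space "gamma_law T" by (rule prob_space_gamma_law) fact
  have [measurable]: "{s. d \<le> \<bar>s - T\<bar>} \<in> sets borel" by measurable
  have "ennreal (d\<^sup>2) * emeasure (gamma_law T) {s. d \<le> \<bar>s - T\<bar>} =
      (\<integral>\<^sup>+s. ennreal (d\<^sup>2) * indicator {s. d \<le> \<bar>s - T\<bar>} s \<partial>gamma_law T)"
    by (subst nn_integral_cmult_indicator) auto
  also have "\<dots> \<le> (\<integral>\<^sup>+s. ennreal ((s - T)\<^sup>2) \<partial>gamma_law T)"
    using assms
    by (intro nn_integral_mono) (auto simp: indicator_def simp flip: abs_le_square_iff intro!: ennreal_leI)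
  finally have "ennreal (d\<^sup>2 * measure (gamma_law T) {s. d \<le> \<bar>s - T\<bar>}) \<le> ennreal T"
    by (simp add: gamma_law_variance assms emeasure_eq_measure ennreal_mult)
  thus ?thesis using assms by (simp add: ennreal_le_iff le_divide_eq mult.commute)
qed

section \<open>Dirichlet vectors and independent Gamma variables\<close>

text \<open>A product measure is determined by its values on boxes, and on a box the claim factors
  into one-dimensional scaling, with one factor \<open>c\<close> per coordinate.\<close>

lemma lborel_PiM_scale:
  fixes c :: real
  assumes "c > 0" "finite I"
  shows "PiM I (\<lambda>_. lborel) = density (distr (PiM I (\<lambda>_. lborel)) (PiM I (\<lambda>_. lborel))
      (\<lambda>x. \<lambda>i\<in>I. c * x i)) (\<lambda>_. ennreal (c ^ card I))"
proof -
  interpret product_sigma_finite "\<lambda>_::'a. lborel :: real measure" ..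
  let ?P = "PiM I (\<lambda>_. lborel :: real measure)" and ?h = "\<lambda>x. \<lambda>i\<in>I. c * x i :: real"
  have h [measurable]: "?h \<in> measurable ?P ?P" by measurable
  have "density (distr ?P ?P ?h) (\<lambda>_. ennreal (c ^ card I)) = ?P"
  proof (rule PiM_eqI)
    fix A :: "'a \<Rightarrow> real set" assume A: "\<And>i. i \<in> I \<Longrightarrow> A i \<in> sets lborel"
    have PA: "Pi\<^sub>E I A \<in> sets ?P" using A assms by (intro sets_PiM_I_finite) auto
    have A': "(\<lambda>x. c * x) -` A i \<in> sets lborel" if "i \<in> I" for i
      using measurable_sets[of "\<lambda>x. c * x" borel borel "A i"] A[OF that] by simp
    have vi: "?h -` Pi\<^sub>E I A \<inter> space ?P = Pi\<^sub>E I (\<lambda>i. (\<lambda>x. c * x) -` A i)"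
      by (auto simp: space_PiM PiE_def Pi_def)
    have one: "ennreal c * emeasure lborel ((\<lambda>x. c * x) -` A i) = emeasure lborel (A i)" if "i \<in> I" for i
    proof -
      have "emeasure lborel (A i) = emeasure (density (distr lborel borel (\<lambda>x. 0 + c * x)) (\<lambda>_. ennreal \<bar>c\<bar>)) (A i)"
        using lborel_real_affine[of c 0] assms by simp
      also have "\<dots> = ennreal c * emeasure lborel ((\<lambda>x. c * x) -` A i)"
        using A[OF that] assms by (simp add: emeasure_density nn_integral_cmult_indicator emeasure_distr)
      finally show ?thesis ..
    qed
    have "emeasure (density (distr ?P ?P ?h) (\<lambda>_. ennreal (c ^ card I))) (Pi\<^sub>E I A) =
        ennreal (c ^ card I) * emeasure ?P (?h -` Pi\<^sub>E I A \<inter> space ?P)"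
      using PA by (simp add: emeasure_density nn_integral_cmult_indicator emeasure_distr)
    also have "\<dots> = (\<Prod>i\<in>I. ennreal c) * (\<Prod>i\<in>I. emeasure lborel ((\<lambda>x. c * x) -` A i))"
      unfolding vi using A' assms by (subst emeasure_PiM) (auto simp: ennreal_power)
    also have "\<dots> = (\<Prod>i\<in>I. emeasure lborel (A i))"
      unfolding prod.distrib[symmetric] using one by (intro prod.cong) auto
    finally show "emeasure (density (distr ?P ?P ?h) (\<lambda>_. ennreal (c ^ card I))) (Pi\<^sub>E I A) =
       (\<Prod>i\<in>I. emeasure lborel (A i))" .
  qed (use assms in auto)
  thus ?thesis ..
qed

lemma nn_integral_PiM_scale:
  fixes c :: real
  assumes "c > 0" "finite I" and [measurable]: "f \<in> borel_measurable (PiM I (\<lambda>_. lborel))"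
  shows "(\<integral>\<^sup>+x. f x \<partial>PiM I (\<lambda>_. lborel)) =
    ennreal (c ^ card I) * (\<integral>\<^sup>+x. f (\<lambda>i\<in>I. c * x i) \<partial>PiM I (\<lambda>_. lborel))"
proof -
  have [measurable]: "(\<lambda>x. \<lambda>i\<in>I. c * x i) \<in> measurable (PiM I (\<lambda>_. lborel)) (PiM I (\<lambda>_. lborel))" by measurable
  show ?thesis
    by (subst lborel_PiM_scale[OF assms(1,2)])
       (simp add: nn_integral_density nn_integral_distr nn_integral_cmult)
qed

lemma dirichlet_density_measurable [measurable]:
  "dirichlet_density n a b \<in> borel_measurable (PiM {1..n} (\<lambda>_. lborel))"
  unfolding dirichlet_density_def[abs_def] by measurable

text \<open>Translation by \<open>\<sigma>\<close> gives the Gamma integral. With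
  \<open>\<sigma>\<close> the sum of the coordinates, the factor \<open>exp (- \<sigma>)\<close>
  later splits into the exponentials of the independent Gamma densities.\<close>

lemma nn_integral_shifted_gamma:
  assumes "b > 0" "\<sigma> \<ge> 0"
  shows "(\<integral>\<^sup>+s. ennreal (indicator {\<sigma>..} s * exp (- s) * (s - \<sigma>) powr (b - 1)) \<partial>lborel) = ennreal (exp (- \<sigma>) * Gamma b)"
proof -
  have "(\<integral>\<^sup>+s. ennreal (indicator {\<sigma>..} s * exp (- s) * (s - \<sigma>) powr (b - 1)) \<partial>lborel) =
     (\<integral>\<^sup>+s. ennreal (indicator {\<sigma>..} (\<sigma> + 1 * s) * exp (- (\<sigma> + 1 * s)) * ((\<sigma> + 1 * s) - \<sigma>) powr (b - 1)) \<partial>lborel)"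
    by (subst nn_integral_real_affine[where c = 1 and t = \<sigma>]) auto
  also have "\<dots> = (\<integral>\<^sup>+s. ennreal (exp (- \<sigma>)) * ennreal (indicator {0..} s * s powr (b - 1) * exp (- s)) \<partial>lborel)"
    by (intro nn_integral_cong) (auto simp: indicator_def exp_add exp_diff exp_minus field_simps simp flip: ennreal_mult)
  also have "\<dots> = ennreal (exp (- \<sigma>)) * ennreal (Gamma b)"
    by (subst nn_integral_cmult) (simp_all only: nn_integral_powr_exp[OF assms(1)], measurable)
  finally show ?thesis using assms by (simp add: ennreal_mult)
qed

text \<open>The left side is the joint density of the multiplier \<open>s\<close> and the vector
  \<open>y = s * x\<close>, with Jacobian \<open>(1 / s) ^ n\<close>. The powers of \<open>s\<close>
  cancel because \<open>T - 1 - n - n * (a - 1) - (b - 1) = 0\<close> for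
  \<open>T = n * a + b\<close>; only \<open>exp (- s)\<close> and the power of
  \<open>s - \<sigma> y\<close> still involve \<open>s\<close>.\<close>

lemma dirichlet_gamma_pointwise:
  assumes "a > 0" "b > 0" "n > 0"
  defines "\<sigma> y \<equiv> \<Sum>i=1..n. y i"
  shows "gamma_density (real n * a + b) s * (1 / s) ^ n * dirichlet_density n a b (\<lambda>i\<in>{1..n}. 1 / s * y i) =
    (if \<forall>i\<in>{1..n}. 0 \<le> y i
     then (\<Prod>i=1..n. y i) powr (a - 1) / (Gamma a ^ n * Gamma b) *
        (indicator {\<sigma> y..} s * exp (- s) * (s - \<sigma> y) powr (b - 1))
     else 0)" (is "?L = ?R")
proof (cases "s > 0")
  case False
  \<comment> \<open>For \<open>s \<le> 0\<close> both sides vanish. At \<open>s = 0\<close> this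
    uses \<open>0 powr c = 0\<close>: on the left in the Gamma density, on the right when
    \<open>\<sigma> y = 0\<close>.\<close>
  have "\<sigma> y \<ge> 0" if "\<forall>i\<in>{1..n}. 0 \<le> y i" using that by (auto simp: \<sigma>_def intro!: sum_nonneg)
  with False show ?thesis by (auto simp: gamma_density_def indicator_def)
next
  case s: True
  define T where "T = real n * a + b"
  have T: "T > 0" using assms by (simp add: T_def add_nonneg_pos)
  have GT: "Gamma T \<noteq> 0" using T Gamma_real_pos[of T] by linarith
  show ?thesis
  proof (cases "\<forall>i\<in>{1..n}. 0 \<le> y i")
    case False
    then obtain i where "i \<in> {1..n}" "y i < 0" by auto
    hence "\<not> (0 \<le> (1 / s) * y i)" using s by (simp add: field_simps)
    with \<open>i \<in> {1..n}\<close> have "\<not> (\<forall>i\<in>{1..n}. 0 \<le> (\<lambda>i\<in>{1..n}. 1 / s * y i) i)" by auto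
    hence "dirichlet_density n a b (\<lambda>i\<in>{1..n}. 1 / s * y i) = 0"
      unfolding dirichlet_density_def by (simp only: simp_thms if_False)
    thus ?thesis using False by (simp only: if_False mult_zero_right)
  next
    case y: True
    have sum: "(\<Sum>i=1..n. (\<lambda>i\<in>{1..n}. 1 / s * y i) i) = \<sigma> y / s"
      by (simp add: \<sigma>_def sum_divide_distrib)
    have nn: "\<forall>i\<in>{1..n}. 0 \<le> (\<lambda>i\<in>{1..n}. 1 / s * y i) i" using y s by simp
    have prod: "(\<Prod>i=1..n. (\<lambda>i\<in>{1..n}. 1 / s * y i) i) = (1 / s) ^ n * (\<Prod>i=1..n. y i)"
      by (simp add: prod_dividef power_one_over)
    show ?thesis
    proof (cases "\<sigma> y \<le> s")
      case False
      hence "\<not> \<sigma> y / s \<le> 1" using s by simp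
      hence "dirichlet_density n a b (\<lambda>i\<in>{1..n}. 1 / s * y i) = 0"
        unfolding dirichlet_density_def sum by (simp only: simp_thms if_False)
      thus ?thesis using False by (simp add: indicator_def)
    next
      case True
      have p0: "(\<Prod>i=1..n. y i) \<ge> 0" using y by (intro prod_nonneg) auto
      have "1 - \<sigma> y / s = (s - \<sigma> y) / s" using s by (simp add: field_simps)
      hence D: "dirichlet_density n a b (\<lambda>i\<in>{1..n}. 1 / s * y i) =
          Gamma T / (Gamma a ^ n * Gamma b) * ((1 / s) ^ n * (\<Prod>i=1..n. y i)) powr (a - 1) *
            ((s - \<sigma> y) / s) powr (b - 1)"
        unfolding dirichlet_density_def sum prod T_def using nn True s by simp
      have e3: "(1 / s) ^ n = s powr (- real n)"
        using s by (simp add: powr_minus powr_realpow divide_inverse power_inverse)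
      have e1: "((1 / s) ^ n * (\<Prod>i=1..n. y i)) powr (a - 1) =
          s powr (- (real n * (a - 1))) * (\<Prod>i=1..n. y i) powr (a - 1)"
        unfolding e3 using s p0 by (subst powr_mult) (auto simp: powr_powr)
      have e2: "((s - \<sigma> y) / s) powr (b - 1) = (s - \<sigma> y) powr (b - 1) * s powr (- (b - 1))"
        unfolding powr_minus using s True by (subst powr_divide) (auto simp: divide_inverse)
      have "s powr (T - 1) * s powr (- real n) * s powr (- (real n * (a - 1))) * s powr (- (b - 1)) =
         s powr (T - 1 - real n - real n * (a - 1) - (b - 1))"
        by (simp add: powr_add[symmetric])
      also have "T - 1 - real n - real n * (a - 1) - (b - 1) = 0" by (simp add: T_def algebra_simps)
      finally have e4: "s powr (T - 1) * s powr (- real n) * s powr (- (real n * (a - 1))) * s powr (- (b - 1)) = 1"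
        using s by simp
      have "?L = s powr (T - 1) * s powr (- real n) * s powr (- (real n * (a - 1))) * s powr (- (b - 1)) *
          ((\<Prod>i=1..n. y i) powr (a - 1) / (Gamma a ^ n * Gamma b) * (exp (- s) * (s - \<sigma> y) powr (b - 1)))"
        unfolding D e1[unfolded e3] e2 e3 T_def[symmetric] gamma_density_def using s GT by simp
      also have "\<dots> = ?R" unfolding e4 using y True by simp
      finally show ?thesis .
    qed
  qed
qed

text \<open>Integrating out the multiplier cancels \<open>Gamma b\<close> and leaves
  \<open>exp (- \<sigma>)\<close>, the last factor that couples the coordinates; as
  \<open>\<sigma>\<close> is their sum, it splits too. This is the independence of the scaled
  coordinates.\<close>

lemma dirichlet_gamma_integral:
  assumes "a > 0" "b > 0" "n > 0"
  shows "(\<integral>\<^sup>+s. ennreal (gamma_density (real n * a + b) s * (1 / s) ^ n *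
        dirichlet_density n a b (\<lambda>i\<in>{1..n}. 1 / s * y i)) \<partial>lborel) = (\<Prod>i=1..n. ennreal (gamma_density a (y i)))"
proof (cases "\<forall>i\<in>{1..n}. 0 \<le> y i")
  case False
  then obtain i where i: "i \<in> {1..n}" "y i < 0" by auto
  hence "ennreal (gamma_density a (y i)) = 0" by (simp add: gamma_density_def)
  hence "(\<Prod>i=1..n. ennreal (gamma_density a (y i))) = 0" using i by (intro prod_zero) auto
  thus ?thesis unfolding dirichlet_gamma_pointwise[OF assms] if_not_P[OF False] by simp
next
  case True
  define \<sigma> where "\<sigma> = (\<Sum>i=1..n. y i)"
  define C where "C = (\<Prod>i=1..n. y i) powr (a - 1) / (Gamma a ^ n * Gamma b)"
  have G: "Gamma b \<noteq> 0" using assms Gamma_real_pos[of b] by linarith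
  have s0: "\<sigma> \<ge> 0" using True by (auto simp: \<sigma>_def intro!: sum_nonneg)
  have C0: "C \<ge> 0" using assms by (simp add: C_def)
  have m: "(\<lambda>s. ennreal (indicator {\<sigma>..} s * exp (- s) * (s - \<sigma>) powr (b - 1))) \<in> borel_measurable lborel"
    by measurable
  have "(\<integral>\<^sup>+s. ennreal (gamma_density (real n * a + b) s * (1 / s) ^ n *
        dirichlet_density n a b (\<lambda>i\<in>{1..n}. 1 / s * y i)) \<partial>lborel) =
     (\<integral>\<^sup>+s. ennreal C * ennreal (indicator {\<sigma>..} s * exp (- s) * (s - \<sigma>) powr (b - 1)) \<partial>lborel)"
    unfolding dirichlet_gamma_pointwise[OF assms] if_P[OF True] C_def[symmetric] \<sigma>_def[symmetric]
    using C0 by (simp only: ennreal_mult')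
  also have "\<dots> = ennreal C * ennreal (exp (- \<sigma>) * Gamma b)"
    by (simp only: nn_integral_cmult[OF m] nn_integral_shifted_gamma[OF assms(2) s0])
  also have "\<dots> = ennreal ((\<Prod>i=1..n. y i) powr (a - 1) * exp (- \<sigma>) / Gamma a ^ n)"
    using C0 assms G by (simp add: C_def flip: ennreal_mult)
  also have "(\<Prod>i=1..n. y i) powr (a - 1) * exp (- \<sigma>) / Gamma a ^ n = (\<Prod>i=1..n. gamma_density a (y i))"
  proof -
    have "(\<Prod>i=1..n. gamma_density a (y i)) = (\<Prod>i=1..n. y i powr (a - 1) * exp (- y i) / Gamma a)"
      using True by (intro prod.cong) (auto simp: gamma_density_def)
    also have "\<dots> = (\<Prod>i=1..n. y i powr (a - 1)) * exp (- \<sigma>) / Gamma a ^ n"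
      by (simp add: prod_dividef prod.distrib \<sigma>_def exp_sum sum_negf[symmetric])
    also have "(\<Prod>i=1..n. y i powr (a - 1)) = (\<Prod>i=1..n. y i) powr (a - 1)"
      using True by (simp add: prod_powr_distrib)
    finally show ?thesis ..
  qed
  also have "ennreal (\<Prod>i=1..n. gamma_density a (y i)) = (\<Prod>i=1..n. ennreal (gamma_density a (y i)))"
    using assms by (intro prod_ennreal[symmetric]) (auto simp: gamma_density_nonneg)
  finally show ?thesis .
qed

text \<open>A Dirichlet vector multiplied by an independent Gamma variable with parameter
  \<open>n * a + b\<close> has independent Gamma coordinates with parameter \<open>a\<close>; averaging over the
  multiplier replaces the product space.\<close>

lemma dirichlet_gamma_mixture:
  fixes X :: "nat \<Rightarrow> 'a \<Rightarrow> real"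
  assumes "a > 0" "b > 0" "n > 0" and X: "has_dirichlet M n X a b"
  shows "(\<integral>\<^sup>+s. emeasure M {\<omega>\<in>space M. \<forall>i\<in>{1..n}. s * X i \<omega> \<le> t} \<partial>gamma_law (real n * a + b)) =
    emeasure (gamma_law a) {..t} ^ n"
proof -
  let ?P = "PiM {1..n} (\<lambda>_. lborel :: real measure)"
  interpret product_sigma_finite "\<lambda>_::nat. lborel :: real measure" ..
  interpret P: finite_product_sigma_finite "\<lambda>_. lborel" "{1..n}" by standard simp
  interpret PL: pair_sigma_finite lborel ?P ..
  define T where "T = real n * a + b"
  define D where "D = dirichlet_density n a b"
  define ind :: "(nat \<Rightarrow> real) \<Rightarrow> ennreal" where "ind x = indicator {x. \<forall>i\<in>{1..n}. x i \<le> t} x" for x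
  have [measurable]: "D \<in> borel_measurable ?P" unfolding D_def by measurable
  have ind_prod: "ind x = (\<Prod>i=1..n. indicator {..t} (x i))" for x
    by (auto simp: ind_def indicator_def prod_zero_iff)
  have T: "T > 0" using assms by (simp add: T_def add_nonneg_pos)
  have ind_scale: "ind (\<lambda>i\<in>{1..n}. s * x i) = (\<Prod>i=1..n. indicator {..t} (s * x i))" for s x
    by (simp add: ind_prod)
  have D0: "D x \<ge> 0" for x
    using assms Gamma_real_pos[OF T] unfolding D_def dirichlet_density_def T_def by simp
  have em: "emeasure M {\<omega>\<in>space M. \<forall>i\<in>{1..n}. s * X i \<omega> \<le> t} =
      (\<integral>\<^sup>+x. ennreal (D x) * ind (\<lambda>i\<in>{1..n}. s * x i) \<partial>?P)" for s
  proof -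
    let ?A = "{x \<in> space ?P. \<forall>i\<in>{1..n}. s * x i \<le> t}"
    have A: "?A \<in> sets ?P" by measurable
    have "{\<omega>\<in>space M. \<forall>i\<in>{1..n}. s * X i \<omega> \<le> t} = (\<lambda>\<omega>. \<lambda>i\<in>{1..n}. X i \<omega>) -` ?A \<inter> space M"
      by (auto simp: space_PiM)
    also have "emeasure M \<dots> = (\<integral>\<^sup>+x. ennreal (D x) * indicator ?A x \<partial>?P)"
      unfolding D_def by (rule distributed_emeasure[OF X[unfolded has_dirichlet_def] A])
    also have "\<dots> = (\<integral>\<^sup>+x. ennreal (D x) * ind (\<lambda>i\<in>{1..n}. s * x i) \<partial>?P)"
      by (intro nn_integral_cong) (auto simp: ind_def indicator_def)
    finally show ?thesis .
  qed
  have [measurable]: "(\<lambda>(s, x). ind (\<lambda>i\<in>{1..n}. s * x i)) \<in> borel_measurable (lborel \<Otimes>\<^sub>M ?P)"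
    unfolding ind_scale split_beta by measurable
  have Dm [measurable]: "(\<lambda>(s, y). D (\<lambda>i\<in>{1..n}. 1 / s * y i)) \<in> borel_measurable (lborel \<Otimes>\<^sub>M ?P)"
  proof -
    have [measurable]: "(\<lambda>(s, y). \<lambda>i\<in>{1..n}. 1 / s * y i) \<in> measurable (lborel \<Otimes>\<^sub>M ?P) ?P"
      unfolding split_beta by measurable
    have "D \<circ> (\<lambda>(s, y). \<lambda>i\<in>{1..n}. 1 / s * y i) \<in> borel_measurable (lborel \<Otimes>\<^sub>M ?P)" by measurable
    thus ?thesis by (simp add: o_def split_beta)
  qed
  have [measurable]: "ind \<in> borel_measurable ?P" unfolding ind_prod[abs_def] by measurable
  \<comment> \<open>For fixed \<open>s\<close>, substituting \<open>y = s * x\<close> moves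
    \<open>s\<close> out of the event into the density, so that the event no longer depends on the
    multiplier.\<close>
  have scale: "ennreal (gamma_density T s) * (\<integral>\<^sup>+x. ennreal (D x) * ind (\<lambda>i\<in>{1..n}. s * x i) \<partial>?P) =
      (\<integral>\<^sup>+y. ennreal (gamma_density T s * (1 / s) ^ n * D (\<lambda>i\<in>{1..n}. 1 / s * y i)) * ind y \<partial>?P)" for s
  proof (cases "s > 0")
    case False
    hence "gamma_density T s = 0" by (auto simp: gamma_density_def indicator_def)
    thus ?thesis by simp
  next
    case True
    have [measurable]: "(\<lambda>x. ind (\<lambda>i\<in>{1..n}. s * x i)) \<in> borel_measurable ?P"
      unfolding ind_scale by measurable
    have [measurable]: "(\<lambda>y. D (\<lambda>i\<in>{1..n}. 1 / s * y i)) \<in> borel_measurable ?P"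
      using measurable_compose[OF measurable_Pair1' Dm, of s] by simp
    have "(\<integral>\<^sup>+x. ennreal (D x) * ind (\<lambda>i\<in>{1..n}. s * x i) \<partial>?P) =
        ennreal ((1 / s) ^ card {1..n}) * (\<integral>\<^sup>+x. ennreal (D (\<lambda>i\<in>{1..n}. 1 / s * x i)) *
           ind (\<lambda>i\<in>{1..n}. s * (\<lambda>i\<in>{1..n}. 1 / s * x i) i) \<partial>?P)"
    proof (rule nn_integral_PiM_scale)
      show "(\<lambda>x. ennreal (D x) * ind (\<lambda>i\<in>{1..n}. s * x i)) \<in> borel_measurable ?P" by measurable
    qed (use True in auto)
    also have "\<dots> = ennreal ((1 / s) ^ n) * (\<integral>\<^sup>+x. ennreal (D (\<lambda>i\<in>{1..n}. 1 / s * x i)) * ind x \<partial>?P)"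
      using True by (intro arg_cong2[where f = "(*)"] nn_integral_cong) (auto simp: ind_prod)
    finally have "ennreal (gamma_density T s) * (\<integral>\<^sup>+x. ennreal (D x) * ind (\<lambda>i\<in>{1..n}. s * x i) \<partial>?P) =
      ennreal (gamma_density T s) * ennreal ((1 / s) ^ n) * (\<integral>\<^sup>+x. ennreal (D (\<lambda>i\<in>{1..n}. 1 / s * x i)) * ind x \<partial>?P)"
      by (simp add: mult.assoc)
    also have "\<dots> = (\<integral>\<^sup>+x. ennreal (gamma_density T s) * ennreal ((1 / s) ^ n) *
         (ennreal (D (\<lambda>i\<in>{1..n}. 1 / s * x i)) * ind x) \<partial>?P)"
      by (rule nn_integral_cmult[symmetric]) measurable
    also have "\<dots> = (\<integral>\<^sup>+y. ennreal (gamma_density T s * (1 / s) ^ n * D (\<lambda>i\<in>{1..n}. 1 / s * y i)) * ind y \<partial>?P)"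
      using True D0 gamma_density_nonneg[OF T, of s]
      by (intro nn_integral_cong) (simp add: ennreal_mult mult.assoc)
    finally show ?thesis .
  qed
  have "(\<integral>\<^sup>+s. emeasure M {\<omega>\<in>space M. \<forall>i\<in>{1..n}. s * X i \<omega> \<le> t} \<partial>gamma_law T) =
    (\<integral>\<^sup>+s. ennreal (gamma_density T s) * (\<integral>\<^sup>+x. ennreal (D x) * ind (\<lambda>i\<in>{1..n}. s * x i) \<partial>?P) \<partial>lborel)"
    unfolding em gamma_law_def
  proof (rule nn_integral_density)
    have "(\<lambda>(s, x). ennreal (D x) * ind (\<lambda>i\<in>{1..n}. s * x i)) \<in> borel_measurable (lborel \<Otimes>\<^sub>M ?P)"
      by measurable
    thus "(\<lambda>s. \<integral>\<^sup>+x. ennreal (D x) * ind (\<lambda>i\<in>{1..n}. s * x i) \<partial>?P) \<in> borel_measurable lborel"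
      by (rule P.borel_measurable_nn_integral)
  qed measurable
  also have "\<dots> = (\<integral>\<^sup>+s. \<integral>\<^sup>+y. ennreal (gamma_density T s * (1 / s) ^ n * D (\<lambda>i\<in>{1..n}. 1 / s * y i)) * ind y \<partial>?P \<partial>lborel)"
    unfolding scale ..
  \<comment> \<open>With \<open>y\<close> on the outside, \<open>ind y\<close> is a constant for the
    inner integral, which \<open>dirichlet_gamma_integral\<close> evaluates.\<close>
  also have "\<dots> = (\<integral>\<^sup>+y. \<integral>\<^sup>+s. ennreal (gamma_density T s * (1 / s) ^ n * D (\<lambda>i\<in>{1..n}. 1 / s * y i)) * ind y \<partial>lborel \<partial>?P)"
    by (rule PL.Fubini'[symmetric]) measurable
  also have "\<dots> = (\<integral>\<^sup>+y. (\<Prod>i=1..n. ennreal (gamma_density a (y i)) * indicator {..t} (y i)) \<partial>?P)"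
  proof (intro nn_integral_cong)
    fix y assume y: "y \<in> space ?P"
    have [measurable]: "(\<lambda>s. D (\<lambda>i\<in>{1..n}. 1 / s * y i)) \<in> borel_measurable lborel"
      using measurable_compose[OF measurable_Pair2' Dm, OF y] by simp
    have "(\<integral>\<^sup>+s. ennreal (gamma_density T s * (1 / s) ^ n * D (\<lambda>i\<in>{1..n}. 1 / s * y i)) * ind y \<partial>lborel) =
       (\<integral>\<^sup>+s. ennreal (gamma_density T s * (1 / s) ^ n * D (\<lambda>i\<in>{1..n}. 1 / s * y i)) \<partial>lborel) * ind y"
      by (rule nn_integral_multc) measurable
    also have "\<dots> = (\<Prod>i=1..n. ennreal (gamma_density a (y i))) * (\<Prod>i=1..n. indicator {..t} (y i))"
      unfolding D_def T_def dirichlet_gamma_integral[OF assms(1-3)] ind_prod ..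
    also have "\<dots> = (\<Prod>i=1..n. ennreal (gamma_density a (y i)) * indicator {..t} (y i))"
      by (simp add: prod.distrib)
    finally show "(\<integral>\<^sup>+s. ennreal (gamma_density T s * (1 / s) ^ n * D (\<lambda>i\<in>{1..n}. 1 / s * y i)) * ind y \<partial>lborel) =
        (\<Prod>i=1..n. ennreal (gamma_density a (y i)) * indicator {..t} (y i))" .
  qed
  also have "\<dots> = (\<Prod>i=1..n. \<integral>\<^sup>+x. ennreal (gamma_density a x) * indicator {..t} x \<partial>lborel)"
    by (intro product_nn_integral_prod) auto
  also have "(\<integral>\<^sup>+x. ennreal (gamma_density a x) * indicator {..t} x \<partial>lborel) = emeasure (gamma_law a) {..t}"
    by (simp add: gamma_law_def emeasure_density)
  finally show ?thesis by (simp add: T_def)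
qed

section \<open>Reduction to Gamma tails\<close>

lemma measurable_Mtilde:
  assumes "n \<ge> 1" "has_dirichlet M n (X n) a b"
  shows "Mtilde X n \<in> borel_measurable M" and "\<And>i. i \<in> {1..n} \<Longrightarrow> X n i \<in> borel_measurable M"
proof -
  have *: "(\<lambda>\<omega>. \<lambda>i\<in>{1..n}. X n i \<omega>) \<in> measurable M (PiM {1..n} (\<lambda>_. lborel))"
    using assms(2) by (simp add: has_dirichlet_def distributed_def)
  show X: "X n i \<in> borel_measurable M" if "i \<in> {1..n}" for i
    using measurable_compose[OF * measurable_component_singleton[OF that]] that by simp
  show "Mtilde X n \<in> borel_measurable M"
  proof (subst borel_measurable_iff_le, intro allI)
    fix a
    have "{w \<in> space M. Mtilde X n w \<le> a} = {w\<in>space M. \<forall>i\<in>{1..n}. X n i w \<le> a}"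
      unfolding Mtilde_def using assms(1) by (subst Max_le_iff) auto
    also have "\<dots> \<in> sets M" using X by measurable
    finally show "{w \<in> space M. Mtilde X n w \<le> a} \<in> sets M" .
  qed
qed

text \<open>Off an event of probability \<open>z\<^sup>2 / (T * d\<^sup>2)\<close> the Gamma multiplier lies within
  relative distance \<open>d / z\<close> of its mean \<open>T\<close>, which moves the threshold \<open>z\<close> by at most \<open>d\<close>.\<close>

lemma cdf_Mtilde_bounds:
  assumes n: "n \<ge> 1" and a: "a > 0" and b: "b > 0" and "prob_space M"
    and D: "has_dirichlet M n (X n) a b"
    and z: "z > 0" and d: "0 < d" "d < z"
  defines "T \<equiv> real n * a + b"
  defines "p \<equiv> measure M {\<omega>\<in>space M. T * Mtilde X n \<omega> \<le> z}"
  shows "measure (gamma_law a) {..z - d} ^ n - z\<^sup>2 / (T * d\<^sup>2) \<le> p"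
    and "p - z\<^sup>2 / (T * d\<^sup>2) \<le> measure (gamma_law a) {..z + d} ^ n"
proof -
  interpret M: prob_space M by fact
  interpret a: prob_space "gamma_law a" by (rule prob_space_gamma_law) fact
  have T: "T > 0" using n a b by (simp add: T_def add_nonneg_pos)
  interpret T: prob_space "gamma_law T" by (rule prob_space_gamma_law) fact
  define S where "S = {s. d / z * T \<le> \<bar>s - T\<bar>}"
  have [measurable]: "S \<in> sets borel" unfolding S_def by measurable
  have dz: "d / z > 0" "d / z < 1" using d z by auto
  have "measure (gamma_law T) S \<le> T / (d / z * T)\<^sup>2"
    unfolding S_def by (intro gamma_law_deviation T mult_pos_pos dz)
  also have "\<dots> = z\<^sup>2 / (T * d\<^sup>2)" using T d by (simp add: field_simps power2_eq_square)
  finally have S: "measure (gamma_law T) S \<le> z\<^sup>2 / (T * d\<^sup>2)" .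
  have ne: "{1..n} \<noteq> {}" using n by simp
  have Mx: "Mtilde X n \<omega> \<le> c \<longleftrightarrow> (\<forall>i\<in>{1..n}. X n i \<omega> \<le> c)" for \<omega> c
    unfolding Mtilde_def using ne by (subst Max_le_iff) auto
  have ev: "{\<omega>\<in>space M. \<forall>i\<in>{1..n}. s * X n i \<omega> \<le> t} = {\<omega>\<in>space M. s * Mtilde X n \<omega> \<le> t}"
    if "s > 0" for s t
    using that Mx[of _ "t / s"] by (auto simp: le_divide_eq mult.commute)
  have [measurable]: "Mtilde X n \<in> borel_measurable M" using measurable_Mtilde[of n M X] n D by blast
  have Xm [measurable]: "X n i \<in> borel_measurable M" if "i \<in> {1..n}" for i
    using measurable_Mtilde(2)[of n M X] n D that by blast
  define A where "A s t = {\<omega>\<in>space M. \<forall>i\<in>{1..n}. s * X n i \<omega> \<le> t}" for s t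
  have Am [measurable]: "A s t \<in> sets M" for s t unfolding A_def by measurable
  define B where "B = {\<omega>\<in>space M. T * Mtilde X n \<omega> \<le> z}"
  have Bm [measurable]: "B \<in> sets M" unfolding B_def by measurable
  have p: "emeasure M B = ennreal p" unfolding p_def B_def by (rule M.emeasure_eq_measure)
  have p01: "0 \<le> p" "p \<le> 1" unfolding p_def by auto
  have mix: "(\<integral>\<^sup>+s. emeasure M (A s t) \<partial>gamma_law T) = ennreal (measure (gamma_law a) {..t} ^ n)" for t
    using dirichlet_gamma_mixture[OF a b _ D, of t] n
    by (simp add: A_def T_def a.emeasure_eq_measure ennreal_power)
  \<comment> \<open>Outside \<open>S\<close>, \<open>s \<ge> T * (1 - d / z)\<close>; since
    \<open>z - d = z * (1 - d / z)\<close>, the common factor cancels. Inside \<open>S\<close> the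
    indicator alone dominates any probability.\<close>
  have lo: "emeasure M (A s (z - d)) \<le> indicator S s + emeasure M B" for s
  proof (cases "s \<in> S")
    case True
    have "emeasure M (A s (z - d)) \<le> 1" by (rule M.emeasure_le_1)
    also have "\<dots> \<le> 1 + emeasure M B" by simp
    finally show ?thesis using True by simp
  next
    case False
    hence s: "\<bar>s - T\<bar> < d / z * T" by (simp add: S_def)
    have "d / z * T < T" using mult_strict_right_mono[OF dz(2) T] by simp
    hence s0: "s > 0" "s \<ge> T * (1 - d / z)" using s by (auto simp: algebra_simps)
    have "A s (z - d) \<subseteq> B"
      unfolding A_def ev[OF s0(1)] B_def
    proof safe
      fix \<omega> assume *: "s * Mtilde X n \<omega> \<le> z - d"
      show "T * Mtilde X n \<omega> \<le> z"
      \<comment> \<open>The maximum is nonnegative only almost surely, so the set inclusion treats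
        negative values separately.\<close>
      proof (cases "Mtilde X n \<omega> \<ge> 0")
        case True
        have "(T * Mtilde X n \<omega>) * (1 - d / z) = T * (1 - d / z) * Mtilde X n \<omega>" by simp
        also have "\<dots> \<le> s * Mtilde X n \<omega>" using s0 True by (intro mult_right_mono)
        also have "\<dots> \<le> z - d" by fact
        also have "\<dots> = z * (1 - d / z)" using z by (simp add: field_simps)
        finally show ?thesis using dz by (subst (asm) mult_le_cancel_right) auto
      next
        case False
        hence "T * Mtilde X n \<omega> < 0" using T by (simp add: mult_pos_neg)
        thus ?thesis using z by simp
      qed
    qed
    hence "emeasure M (A s (z - d)) \<le> emeasure M B" by (intro emeasure_mono) auto
    thus ?thesis using False by simp
  qed
  have "ennreal (measure (gamma_law a) {..z - d} ^ n) \<le> (\<integral>\<^sup>+s. indicator S s + emeasure M B \<partial>gamma_law T)"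
    unfolding mix[symmetric] by (intro nn_integral_mono lo)
  also have "\<dots> = emeasure (gamma_law T) S + emeasure M B"
    using T.emeasure_space_1 by (subst nn_integral_add) auto
  also have "\<dots> = ennreal (measure (gamma_law T) S + p)"
    using p01 by (simp add: p T.emeasure_eq_measure)
  finally have "measure (gamma_law a) {..z - d} ^ n \<le> measure (gamma_law T) S + p"
    using p01 by (subst (asm) ennreal_le_iff) auto
  thus "measure (gamma_law a) {..z - d} ^ n - z\<^sup>2 / (T * d\<^sup>2) \<le> p" using S by simp
  have hi: "emeasure M B \<le> indicator S s + emeasure M (A s (z + d))" for s
  proof (cases "s \<in> S")
    case True
    have "emeasure M B \<le> 1" by (rule M.emeasure_le_1)
    also have "\<dots> \<le> 1 + emeasure M (A s (z + d))" by simp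
    finally show ?thesis using True by simp
  next
    case False
    hence s: "\<bar>s - T\<bar> < d / z * T" by (simp add: S_def)
    have "d / z * T < T" using mult_strict_right_mono[OF dz(2) T] by simp
    hence s0: "s > 0" "s \<le> T * (1 + d / z)" using s by (auto simp: algebra_simps)
    have "B \<subseteq> A s (z + d)"
      unfolding A_def ev[OF s0(1)] B_def
    proof safe
      fix \<omega> assume *: "T * Mtilde X n \<omega> \<le> z"
      show "s * Mtilde X n \<omega> \<le> z + d"
      proof (cases "Mtilde X n \<omega> \<ge> 0")
        case True
        have "s * Mtilde X n \<omega> \<le> T * (1 + d / z) * Mtilde X n \<omega>" using s0 True by (intro mult_right_mono)
        also have "\<dots> = (1 + d / z) * (T * Mtilde X n \<omega>)" by simp
        also have "\<dots> \<le> (1 + d / z) * z" using * dz by (intro mult_left_mono) auto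
        also have "\<dots> = z + d" using z by (simp add: field_simps)
        finally show ?thesis .
      next
        case False
        hence "s * Mtilde X n \<omega> < 0" using s0 by (simp add: mult_pos_neg)
        thus ?thesis using z d by simp
      qed
    qed
    hence "emeasure M B \<le> emeasure M (A s (z + d))" by (intro emeasure_mono) auto
    thus ?thesis using False by simp
  qed
  \<comment> \<open>In the lower bound the term added to the indicator did not depend on
    \<open>s\<close>; here it does, and splitting the integral of the sum requires its
    measurability.\<close>
  have Ame [measurable]: "(\<lambda>s. emeasure M (A s (z + d))) \<in> borel_measurable borel"
  proof -
    have "{x \<in> space (borel \<Otimes>\<^sub>M M). \<forall>i\<in>{1..n}. fst x * X n i (snd x) \<le> z + d} \<in> sets (borel \<Otimes>\<^sub>M M)"
      by measurable
    from M.measurable_emeasure_Pair[OF this] show ?thesis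
      by (simp add: A_def space_pair_measure vimage_def)
  qed
  have "ennreal p = (\<integral>\<^sup>+s. emeasure M B \<partial>gamma_law T)"
    using T.emeasure_space_1 by (simp add: p)
  also have "\<dots> \<le> (\<integral>\<^sup>+s. indicator S s + emeasure M (A s (z + d)) \<partial>gamma_law T)"
    by (intro nn_integral_mono hi)
  also have "\<dots> = emeasure (gamma_law T) S + ennreal (measure (gamma_law a) {..z + d} ^ n)"
    by (subst nn_integral_add) (auto simp: mix)
  also have "\<dots> = ennreal (measure (gamma_law T) S + measure (gamma_law a) {..z + d} ^ n)"
    by (simp add: T.emeasure_eq_measure)
  finally have "p \<le> measure (gamma_law T) S + measure (gamma_law a) {..z + d} ^ n"
    by (subst (asm) ennreal_le_iff) auto
  thus "p - z\<^sup>2 / (T * d\<^sup>2) \<le> measure (gamma_law a) {..z + d} ^ n" using S by simp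
qed

lemma measure_gamma_law_atMost: "a > 0 \<Longrightarrow> measure (gamma_law a) {..y} = 1 - gamma_tail a y"
proof -
  assume "a > 0"
  then interpret prob_space "gamma_law a" by (rule prob_space_gamma_law)
  have "{..y} = space (gamma_law a) - {y<..}" by auto
  thus ?thesis unfolding gamma_tail_def using prob_compl[of "{y<..}"] by simp
qed

lemma abs_ln_one_plus_minus_le:
  fixes v :: real assumes "\<bar>v\<bar> \<le> 1/2"
  shows "\<bar>ln (1 + v) - v\<bar> \<le> 2 * v\<^sup>2"
  using abs_ln_one_plus_x_minus_x_bound[OF assms] by simp

text \<open>The factor \<open>k\<close> may be unbounded (it will be the shape), which is why
  smallness of \<open>v\<close> alone is not enough: the quadratic Taylor remainder is controlled by
  \<open>k * v^2\<close>.\<close>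

lemma mult_ln_one_plus_minus_tendsto_0:
  fixes k v :: "nat \<Rightarrow> real"
  assumes v: "v \<longlonglongrightarrow> 0" and kv: "(\<lambda>n. k n * (v n)\<^sup>2) \<longlonglongrightarrow> 0"
  shows "(\<lambda>n. k n * (ln (1 + v n) - v n)) \<longlonglongrightarrow> 0"
proof (rule Lim_null_comparison)
  have "\<forall>\<^sub>F n in sequentially. \<bar>v n\<bar> < 1/2"
    using tendsto_rabs_zero[OF v] by (rule order_tendstoD) simp
  thus "\<forall>\<^sub>F n in sequentially. norm (k n * (ln (1 + v n) - v n)) \<le> 2 * \<bar>k n * (v n)\<^sup>2\<bar>"
  proof eventually_elim
    case (elim n)
    hence "\<bar>k n\<bar> * \<bar>ln (1 + v n) - v n\<bar> \<le> \<bar>k n\<bar> * (2 * (v n)\<^sup>2)"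
      by (intro mult_left_mono abs_ln_one_plus_minus_le) auto
    thus ?case by (simp add: abs_mult)
  qed
  show "(\<lambda>n. 2 * \<bar>k n * (v n)\<^sup>2\<bar>) \<longlonglongrightarrow> 0"
    using tendsto_mult[OF tendsto_const[of 2] tendsto_rabs_zero[OF kv]] by simp
qed

lemma mult_ln_one_plus_tendsto:
  fixes k v :: "nat \<Rightarrow> real"
  assumes v: "v \<longlonglongrightarrow> 0" and kv: "(\<lambda>n. k n * v n) \<longlonglongrightarrow> l"
  shows "(\<lambda>n. k n * ln (1 + v n)) \<longlonglongrightarrow> l"
proof -
  have "(\<lambda>n. (k n * v n) * v n) \<longlonglongrightarrow> l * 0" by (intro tendsto_mult v kv)
  hence "(\<lambda>n. k n * (v n)\<^sup>2) \<longlonglongrightarrow> 0" by (simp add: power2_eq_square mult_ac)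
  from tendsto_add[OF mult_ln_one_plus_minus_tendsto_0[OF v this] kv] show ?thesis
    by (simp add: algebra_simps)
qed

lemma power_one_minus_tendsto:
  fixes q :: "nat \<Rightarrow> real"
  assumes q: "(\<lambda>n. real n * q n) \<longlonglongrightarrow> l"
  shows "(\<lambda>n. (1 - q n) ^ n) \<longlonglongrightarrow> exp (- l)"
proof -
  have q0: "q \<longlonglongrightarrow> 0"
  proof -
    have "(\<lambda>n. (real n * q n) * (1 / real n)) \<longlonglongrightarrow> l * 0"
      by (intro tendsto_mult q lim_1_over_n)
    moreover have "\<forall>\<^sub>F n in sequentially. (real n * q n) * (1 / real n) = q n"
      using eventually_gt_at_top[of 0] by eventually_elim auto
    ultimately show ?thesis by (simp add: tendsto_cong)
  qed
  have "(\<lambda>n. exp (real n * ln (1 + - q n))) \<longlonglongrightarrow> exp (- l)"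
    using tendsto_minus[OF q] tendsto_minus[OF q0]
    by (intro tendsto_exp mult_ln_one_plus_tendsto) auto
  moreover have "\<forall>\<^sub>F n in sequentially. exp (real n * ln (1 + - q n)) = (1 - q n) ^ n"
    using order_tendstoD(2)[OF q0 zero_less_one] by eventually_elim (simp add: exp_of_nat_mult)
  ultimately show ?thesis by (simp add: tendsto_cong)
qed

text \<open>For fixed \<open>\<eta> > 0\<close>, \<open>cdf_Mtilde_bounds\<close> with
  \<open>d = c n * \<eta>\<close> compares the distribution function at \<open>x\<close> with the
  n-th powers of the Gamma distribution function at the thresholds for \<open>x - \<eta>\<close> and
  \<open>x + \<eta>\<close>. By \<open>conc\<close> the error vanishes for each
  \<open>\<eta>\<close>, and the powers tend to \<open>F (x - \<eta>)\<close> and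
  \<open>F (x + \<eta>)\<close>; continuity then absorbs \<open>\<eta>\<close>. The open set
  \<open>S\<close> is the region where the tail limit is available: all reals for the Gumbel law,
  the positive reals for \<open>F_cdf\<close>.\<close>

lemma cdf_normalized_max_tendsto:
  fixes M :: "nat \<Rightarrow> 'a measure" and x :: real
  assumes pos: "\<And>n. n \<ge> 1 \<Longrightarrow> \<alpha> n > 0" "\<And>n. n \<ge> 1 \<Longrightarrow> \<beta> n > 0"
    and prob: "\<And>n. n \<ge> 1 \<Longrightarrow> prob_space (M n)"
    and dir: "\<And>n. n \<ge> 1 \<Longrightarrow> has_dirichlet (M n) n (X n) (\<alpha> n) (\<beta> n)"
    and S: "open S" "x \<in> S"
    and F: "isCont F x" "\<And>u. u \<in> S \<Longrightarrow> F u = exp (- lam u)"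
    and c: "\<forall>\<^sub>F n in sequentially. c n > 0"
    and z: "\<And>u. u \<in> S \<Longrightarrow> \<forall>\<^sub>F n in sequentially. d n + c n * u > 0"
    and tail: "\<And>u. u \<in> S \<Longrightarrow> (\<lambda>n. real n * gamma_tail (\<alpha> n) (d n + c n * u)) \<longlonglongrightarrow> lam u"
    and conc: "(\<lambda>n. (d n + c n * x) / (c n * sqrt (real n * \<alpha> n + \<beta> n))) \<longlonglongrightarrow> 0"
  shows "(\<lambda>n. cdf (distr (M n) borel (normalized_max \<alpha> \<beta> X d c n)) x) \<longlonglongrightarrow> F x"
proof -
  define T where "T n = real n * \<alpha> n + \<beta> n" for n
  define z where "z n = d n + c n * x" for n
  define p where "p n = measure (M n) {\<omega>\<in>space (M n). T n * Mtilde X n \<omega> \<le> z n}" for n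
  have cdf: "\<forall>\<^sub>F n in sequentially. cdf (distr (M n) borel (normalized_max \<alpha> \<beta> X d c n)) x = p n"
    using c eventually_ge_at_top[of 1]
  proof eventually_elim
    case (elim n)
    have [measurable]: "Mtilde X n \<in> borel_measurable (M n)"
      by (rule measurable_Mtilde(1)[where X = X, OF elim(2) dir[OF elim(2)]])
    have [measurable]: "normalized_max \<alpha> \<beta> X d c n \<in> borel_measurable (M n)"
      unfolding normalized_max_def[abs_def] by measurable
    have "normalized_max \<alpha> \<beta> X d c n -` {..x} \<inter> space (M n) = {\<omega>\<in>space (M n). T n * Mtilde X n \<omega> \<le> z n}"
      using elim by (auto simp: normalized_max_def T_def z_def divide_le_eq algebra_simps)
    thus ?case by (simp add: cdf_def measure_distr p_def)
  qed
  define err where "err \<eta> n = (z n)\<^sup>2 / (T n * (c n * \<eta>)\<^sup>2)" for \<eta> n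
  have err: "err \<eta> \<longlonglongrightarrow> 0" if "\<eta> > 0" for \<eta>
  proof -
    have "(\<lambda>n. (z n / (c n * sqrt (T n)))\<^sup>2 * (1 / \<eta>\<^sup>2)) \<longlonglongrightarrow> 0\<^sup>2 * (1 / \<eta>\<^sup>2)"
      unfolding z_def T_def by (intro tendsto_mult tendsto_power conc tendsto_const)
    moreover have "\<forall>\<^sub>F n in sequentially. (z n / (c n * sqrt (T n)))\<^sup>2 * (1 / \<eta>\<^sup>2) = err \<eta> n"
      using eventually_ge_at_top[of 1]
    proof eventually_elim
      case (elim n)
      have "T n \<ge> 0" using pos[OF elim] unfolding T_def by simp
      thus ?case by (simp add: err_def power_divide power_mult_distrib mult_ac)
    qed
    ultimately show ?thesis by (simp add: tendsto_cong)
  qed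
  have pow: "(\<lambda>n. measure (gamma_law (\<alpha> n)) {..d n + c n * u} ^ n) \<longlonglongrightarrow> F u" if "u \<in> S" for u
  proof -
    have "\<forall>\<^sub>F n in sequentially. (1 - gamma_tail (\<alpha> n) (d n + c n * u)) ^ n = measure (gamma_law (\<alpha> n)) {..d n + c n * u} ^ n"
      using eventually_ge_at_top[of 1] by eventually_elim (simp add: measure_gamma_law_atMost pos)
    with power_one_minus_tendsto[OF tail[OF that]] show ?thesis
      unfolding F(2)[OF that] by (simp add: tendsto_cong)
  qed
  have "p \<longlonglongrightarrow> F x"
  proof (rule order_tendstoI)
    fix a assume a: "a < F x"
    have "\<forall>\<^sub>F y in at x. a < F y \<and> y \<in> S"
      using F(1) a S unfolding isCont_def
      by (intro eventually_conj order_tendstoD(1)[of F "F x"] eventually_at_topological[THEN iffD2]) auto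
    then obtain \<delta> where \<delta>: "\<delta> > 0" "\<And>y. y \<noteq> x \<Longrightarrow> dist y x < \<delta> \<Longrightarrow> a < F y \<and> y \<in> S"
      unfolding eventually_at by auto
    define \<eta> where "\<eta> = \<delta> / 2"
    have \<eta>: "\<eta> > 0" "a < F (x - \<eta>)" "x - \<eta> \<in> S"
      using \<delta>(1) \<delta>(2)[of "x - \<eta>"] by (auto simp: \<eta>_def dist_real_def)
    have "(\<lambda>n. measure (gamma_law (\<alpha> n)) {..d n + c n * (x - \<eta>)} ^ n - err \<eta> n) \<longlonglongrightarrow> F (x - \<eta>) - 0"
      by (intro tendsto_diff pow err \<eta>)
    hence "\<forall>\<^sub>F n in sequentially. a < measure (gamma_law (\<alpha> n)) {..d n + c n * (x - \<eta>)} ^ n - err \<eta> n"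
      by (rule order_tendstoD) (use \<eta> in simp)
    thus "\<forall>\<^sub>F n in sequentially. a < p n"
      using c z[OF S(2)] z[OF \<eta>(3)] eventually_ge_at_top[of 1]
    proof eventually_elim
      case (elim n)
      have "measure (gamma_law (\<alpha> n)) {..z n - c n * \<eta>} ^ n - err \<eta> n \<le> p n"
        unfolding err_def p_def T_def using elim \<eta>
        by (intro cdf_Mtilde_bounds pos prob dir) (auto simp: z_def algebra_simps)
      thus ?case using elim by (simp add: z_def algebra_simps)
    qed
  next
    fix a assume a: "F x < a"
    have "\<forall>\<^sub>F y in at x. F y < a \<and> y \<in> S"
      using F(1) a S unfolding isCont_def
      by (intro eventually_conj order_tendstoD(2)[of F "F x"] eventually_at_topological[THEN iffD2]) auto
    then obtain \<delta> where \<delta>: "\<delta> > 0" "\<And>y. y \<noteq> x \<Longrightarrow> dist y x < \<delta> \<Longrightarrow> F y < a \<and> y \<in> S"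
      unfolding eventually_at by auto
    define \<eta> where "\<eta> = \<delta> / 2"
    \<comment> \<open>Although the comparison is made at \<open>x + \<eta>\<close>, the point
      \<open>x - \<eta>\<close> must lie in \<open>S\<close> as well: positivity of its threshold is
      the condition \<open>c n * \<eta> < z n\<close> of \<open>cdf_Mtilde_bounds\<close>.\<close>
    have \<eta>: "\<eta> > 0" "F (x + \<eta>) < a" "x + \<eta> \<in> S" "x - \<eta> \<in> S"
      using \<delta>(1) \<delta>(2)[of "x + \<eta>"] \<delta>(2)[of "x - \<eta>"] by (auto simp: \<eta>_def dist_real_def)
    have "(\<lambda>n. measure (gamma_law (\<alpha> n)) {..d n + c n * (x + \<eta>)} ^ n + err \<eta> n) \<longlonglongrightarrow> F (x + \<eta>) + 0"
      by (intro tendsto_add pow err \<eta>)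
    hence "\<forall>\<^sub>F n in sequentially. measure (gamma_law (\<alpha> n)) {..d n + c n * (x + \<eta>)} ^ n + err \<eta> n < a"
      by (rule order_tendstoD) (use \<eta> in simp)
    thus "\<forall>\<^sub>F n in sequentially. p n < a"
      using c z[OF S(2)] z[OF \<eta>(4)] eventually_ge_at_top[of 1]
    proof eventually_elim
      case (elim n)
      have "p n - err \<eta> n \<le> measure (gamma_law (\<alpha> n)) {..z n + c n * \<eta>} ^ n"
        unfolding err_def p_def T_def using elim \<eta>
        by (intro cdf_Mtilde_bounds pos prob dir) (auto simp: z_def algebra_simps)
      thus ?case using elim by (simp add: z_def algebra_simps)
    qed
  qed
  thus ?thesis using tendsto_cong[OF cdf] by simp
qed

lemma isCont_gumbel_cdf: "isCont gumbel_cdf x"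
  unfolding gumbel_cdf_def[abs_def] by (intro continuous_intros)

text \<open>Since \<open>n * \<alpha> n + \<beta> n \<ge> n * \<alpha> n\<close>, the concentration
  condition can be stated with \<open>n * \<alpha> n\<close> and then holds for every choice of
  \<open>\<beta>\<close>.\<close>

lemma conv_in_distr_gumbelI:
  fixes M :: "nat \<Rightarrow> 'a measure"
  assumes pos: "\<And>n. n \<ge> 1 \<Longrightarrow> \<alpha> n > 0" "\<And>n. n \<ge> 1 \<Longrightarrow> \<beta> n > 0"
    and prob: "\<And>n. n \<ge> 1 \<Longrightarrow> prob_space (M n)"
    and dir: "\<And>n. n \<ge> 1 \<Longrightarrow> has_dirichlet (M n) n (X n) (\<alpha> n) (\<beta> n)"
    and c: "\<forall>\<^sub>F n in sequentially. c n > 0"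
    and z: "\<And>x. \<forall>\<^sub>F n in sequentially. d n + c n * x > 0"
    and tail: "\<And>x. (\<lambda>n. real n * gamma_tail (\<alpha> n) (d n + c n * x)) \<longlonglongrightarrow> exp (- x)"
    and conc: "\<And>x. (\<lambda>n. (d n + c n * x) / (c n * sqrt (real n * \<alpha> n))) \<longlonglongrightarrow> 0"
  shows "conv_in_distr M (normalized_max \<alpha> \<beta> X d c) gumbel_cdf"
  unfolding conv_in_distr_def weak_conv_def
proof (intro allI impI cdf_normalized_max_tendsto[where S = UNIV and lam = "\<lambda>x. exp (- x)"] pos prob dir c z tail)
  fix x
  show "(\<lambda>n. (d n + c n * x) / (c n * sqrt (real n * \<alpha> n + \<beta> n))) \<longlonglongrightarrow> 0"
  proof (rule tendsto_sandwich[OF _ _ tendsto_const conc[of x]])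
    show "\<forall>\<^sub>F n in sequentially. 0 \<le> (d n + c n * x) / (c n * sqrt (real n * \<alpha> n + \<beta> n))"
      using z[of x] c eventually_ge_at_top[of 1]
    proof eventually_elim
      case (elim n)
      thus ?case using pos[OF elim(3)] by (intro divide_nonneg_nonneg mult_nonneg_nonneg) auto
    qed
    show "\<forall>\<^sub>F n in sequentially. (d n + c n * x) / (c n * sqrt (real n * \<alpha> n + \<beta> n))
        \<le> (d n + c n * x) / (c n * sqrt (real n * \<alpha> n))"
      using z[of x] c eventually_ge_at_top[of 1]
    proof eventually_elim
      case (elim n)
      have a: "real n * \<alpha> n > 0" "\<beta> n > 0" using pos[OF elim(3)] elim(3) by auto
      show ?case
        using elim a by (intro divide_left_mono mult_left_mono mult_pos_pos) (auto simp: add_pos_pos)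
    qed
  qed
qed (auto simp: gumbel_cdf_def isCont_gumbel_cdf)

section \<open>Gumbel limits when the shape is negligible against the centering\<close>

text \<open>As \<open>(\<alpha> n - 1) / y n\<close> tends to 0, the logarithm of
  \<open>1 - (\<alpha> n - 1) / y n\<close> drops out of the exponent. The relative error is that
  quotient times \<open>1 / y n\<close>, up to a factor tending to 1.\<close>

lemma gamma_tail_limit_small_shape:
  fixes \<alpha> y :: "nat \<Rightarrow> real"
  assumes pos: "\<And>n. n \<ge> 1 \<Longrightarrow> \<alpha> n > 0"
    and y: "filterlim y at_top sequentially"
    and r: "(\<lambda>n. \<alpha> n / y n) \<longlonglongrightarrow> 0"
    and E: "(\<lambda>n. ln (real n) + (\<alpha> n - 1) * ln (y n) - y n - ln (Gamma (\<alpha> n))) \<longlonglongrightarrow> - x"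
  shows "(\<lambda>n. real n * gamma_tail (\<alpha> n) (y n)) \<longlonglongrightarrow> exp (- x)"
proof -
  have iy: "(\<lambda>n. 1 / y n) \<longlonglongrightarrow> 0"
    using tendsto_inverse_0_at_top[OF y] by (simp add: divide_inverse)
  have q: "(\<lambda>n. (\<alpha> n - 1) / y n) \<longlonglongrightarrow> 0"
    using tendsto_diff[OF r iy] by (simp add: diff_divide_distrib)
  have evy: "\<forall>\<^sub>F n in sequentially. y n \<ge> 1" using y by (simp add: filterlim_at_top)
  have evq: "\<forall>\<^sub>F n in sequentially. (\<alpha> n - 1) / y n < 1" using q by (rule order_tendstoD) simp
  show ?thesis
  proof (rule gamma_tail_limit)
    show "\<forall>\<^sub>F n in sequentially. \<alpha> n > 0 \<and> y n \<ge> 1 \<and> y n > \<alpha> n - 1"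
      using evy evq eventually_ge_at_top[of 1] by eventually_elim (use pos in \<open>auto simp: field_simps\<close>)
    have "(\<lambda>n. ((\<alpha> n - 1) / y n) * (1 / y n) / (1 - (\<alpha> n - 1) / y n)\<^sup>2) \<longlonglongrightarrow> 0"
      using tendsto_divide[OF tendsto_mult[OF q iy] tendsto_power[OF tendsto_diff[OF tendsto_const[of 1] q], of 2]]
      by simp
    moreover have "\<forall>\<^sub>F n in sequentially. ((\<alpha> n - 1) / y n) * (1 / y n) / (1 - (\<alpha> n - 1) / y n)\<^sup>2 =
        (\<alpha> n - 1) / (y n - (\<alpha> n - 1))\<^sup>2"
      using evy
    proof eventually_elim
      case (elim n)
      hence "y n - (\<alpha> n - 1) = y n * (1 - (\<alpha> n - 1) / y n)" by (simp add: field_simps)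
      thus ?case by (simp add: power_mult_distrib power2_eq_square)
    qed
    ultimately show "(\<lambda>n. (\<alpha> n - 1) / (y n - (\<alpha> n - 1))\<^sup>2) \<longlonglongrightarrow> 0"
      by (rule Lim_transform_eventually)
    have "(\<lambda>n. ln (1 - (\<alpha> n - 1) / y n)) \<longlonglongrightarrow> ln (1 - 0)"
      by (intro tendsto_intros q) auto
    from tendsto_diff[OF E this]
    show "(\<lambda>n. ln (real n) + (\<alpha> n - 1) * ln (y n) - y n - ln (Gamma (\<alpha> n)) - ln (1 - (\<alpha> n - 1) / y n)) \<longlonglongrightarrow> - x"
      by simp
  qed
qed

text \<open>At \<open>d n + x\<close> the exponent of the scaled tail is the sequence in
  \<open>E\<close> minus \<open>x\<close>. Thus \<open>E\<close> asks that \<open>d\<close> be an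
  approximate fixed point of
  \<open>y = ln n + (\<alpha> n - 1) * ln y - ln (Gamma (\<alpha> n))\<close>, robustly under shifts
  inside the logarithm.\<close>

lemma conv_in_distr_gumbel_small_shape:
  fixes M :: "nat \<Rightarrow> 'a measure"
  assumes pos: "\<And>n. n \<ge> 1 \<Longrightarrow> \<alpha> n > 0" "\<And>n. n \<ge> 1 \<Longrightarrow> \<beta> n > 0"
    and prob: "\<And>n. n \<ge> 1 \<Longrightarrow> prob_space (M n)"
    and dir: "\<And>n. n \<ge> 1 \<Longrightarrow> has_dirichlet (M n) n (X n) (\<alpha> n) (\<beta> n)"
    and d: "filterlim d at_top sequentially"
    and r: "(\<lambda>n. \<alpha> n / d n) \<longlonglongrightarrow> 0"
    and E: "\<And>x. (\<lambda>n. ln (real n) + (\<alpha> n - 1) * ln (d n + x) - d n - ln (Gamma (\<alpha> n))) \<longlonglongrightarrow> 0"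
    and conc: "(\<lambda>n. d n / sqrt (real n * \<alpha> n)) \<longlonglongrightarrow> 0"
  shows "conv_in_distr M (normalized_max \<alpha> \<beta> X d (\<lambda>n. 1)) gumbel_cdf"
proof (rule conv_in_distr_gumbelI[OF pos prob dir])
  fix x :: real
  have y: "filterlim (\<lambda>n. d n + 1 * x) at_top sequentially"
    using filterlim_tendsto_add_at_top[OF tendsto_const[of x] d] by (simp add: add.commute)
  thus "\<forall>\<^sub>F n in sequentially. d n + 1 * x > 0" by (simp add: filterlim_at_top_dense)
  have id: "(\<lambda>n. 1 / d n) \<longlonglongrightarrow> 0"
    using tendsto_inverse_0_at_top[OF d] by (simp add: divide_inverse)
  have ratio: "(\<lambda>n. 1 + x * (1 / d n)) \<longlonglongrightarrow> 1 + x * 0" by (intro tendsto_intros id)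
  have ev: "\<forall>\<^sub>F n in sequentially. d n > 0" using d by (simp add: filterlim_at_top_dense)
  show "(\<lambda>n. real n * gamma_tail (\<alpha> n) (d n + 1 * x)) \<longlonglongrightarrow> exp (- x)"
  proof (rule gamma_tail_limit_small_shape[OF pos(1) y])
    have "(\<lambda>n. \<alpha> n / d n / (1 + x * (1 / d n))) \<longlonglongrightarrow> 0"
      using tendsto_divide[OF r ratio] by simp
    moreover have "\<forall>\<^sub>F n in sequentially. \<alpha> n / d n / (1 + x * (1 / d n)) = \<alpha> n / (d n + 1 * x)"
      using ev
    proof eventually_elim
      case (elim n)
      hence "d n + x = d n * (1 + x * (1 / d n))" by (simp add: field_simps)
      thus ?case by simp
    qed
    ultimately show "(\<lambda>n. \<alpha> n / (d n + 1 * x)) \<longlonglongrightarrow> 0" by (rule Lim_transform_eventually)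
    show "(\<lambda>n. ln (real n) + (\<alpha> n - 1) * ln (d n + 1 * x) - (d n + 1 * x) - ln (Gamma (\<alpha> n))) \<longlonglongrightarrow> - x"
      using tendsto_diff[OF E[of x] tendsto_const[of x]] by (simp add: algebra_simps)
  qed
  have "(\<lambda>n. (d n / sqrt (real n * \<alpha> n)) * (1 + x * (1 / d n))) \<longlonglongrightarrow> 0"
    using tendsto_mult[OF conc ratio] by simp
  moreover have "\<forall>\<^sub>F n in sequentially. (d n / sqrt (real n * \<alpha> n)) * (1 + x * (1 / d n)) =
      (d n + 1 * x) / (1 * sqrt (real n * \<alpha> n))"
    using ev
  proof eventually_elim
    case (elim n)
    hence "d n * (1 + x * (1 / d n)) = d n + 1 * x" by (simp add: field_simps)
    thus ?case by (simp only: times_divide_eq_left mult_1)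
  qed
  ultimately show "(\<lambda>n. (d n + 1 * x) / (1 * sqrt (real n * \<alpha> n))) \<longlonglongrightarrow> 0" by (rule Lim_transform_eventually)
qed auto

text \<open>\<open>\<Lambda>\<close> is the leading term of the centering and \<open>e\<close> a
  correction of smaller order. As \<open>(d n + x) / \<Lambda> n\<close> tends to 1 and the shape is
  bounded, replacing \<open>ln (d n + x)\<close> by \<open>ln (\<Lambda> n)\<close> in the fixed
  point equation costs only o(1). The lemma is used with \<open>\<Lambda> n = ln n\<close>,
  \<open>e n = ln (Gamma (\<alpha> n))\<close>, and with
  \<open>\<Lambda> n = ln (n * \<alpha> n)\<close>, \<open>e n = 0\<close>.\<close>

lemma conv_in_distr_gumbel_bounded_shape:
  fixes M :: "nat \<Rightarrow> 'a measure" and \<Lambda> e :: "nat \<Rightarrow> real"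
  assumes pos: "\<And>n. n \<ge> 1 \<Longrightarrow> \<alpha> n > 0" "\<And>n. n \<ge> 1 \<Longrightarrow> \<beta> n > 0"
    and prob: "\<And>n. n \<ge> 1 \<Longrightarrow> prob_space (M n)"
    and dir: "\<And>n. n \<ge> 1 \<Longrightarrow> has_dirichlet (M n) n (X n) (\<alpha> n) (\<beta> n)"
    and bdd: "Bseq \<alpha>"
    and \<Lambda>: "filterlim \<Lambda> at_top sequentially"
    and e: "(\<lambda>n. e n / \<Lambda> n) \<longlonglongrightarrow> 0"
    and E: "(\<lambda>n. ln (real n) - \<Lambda> n + e n - ln (Gamma (\<alpha> n))) \<longlonglongrightarrow> 0"
    and conc: "(\<lambda>n. \<Lambda> n / sqrt (real n * \<alpha> n)) \<longlonglongrightarrow> 0"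
    and d: "d = (\<lambda>n. \<Lambda> n + (\<alpha> n - 1) * ln (\<Lambda> n) - e n)"
  shows "conv_in_distr M (normalized_max \<alpha> \<beta> X d (\<lambda>n. 1)) gumbel_cdf"
proof (rule conv_in_distr_gumbel_small_shape[OF pos prob dir])
  have bz: "(\<lambda>n. (\<alpha> n - 1) * f n) \<longlonglongrightarrow> 0" if "f \<longlonglongrightarrow> 0" for f
  proof -
    obtain K where "\<And>n. norm (\<alpha> n) \<le> K" using bdd by (auto simp: Bseq_def)
    hence "norm (\<alpha> n - 1) \<le> K + 1" for n by (smt (verit) real_norm_def)
    thus ?thesis using that by (intro lim_null_mult_left_bounded[of _ "K + 1"] always_eventually allI)
  qed
  have i\<Lambda>: "(\<lambda>n. 1 / \<Lambda> n) \<longlonglongrightarrow> 0"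
    using tendsto_inverse_0_at_top[OF \<Lambda>] by (simp add: divide_inverse)
  have ln\<Lambda>: "(\<lambda>n. ln (\<Lambda> n) / \<Lambda> n) \<longlonglongrightarrow> 0"
  proof (rule filterlim_compose[OF _ \<Lambda>])
    show "((\<lambda>x::real. ln x / x) \<longlongrightarrow> 0) at_top" by real_asymp
  qed
  have ev: "\<forall>\<^sub>F n in sequentially. \<Lambda> n > 0" using \<Lambda> by (simp add: filterlim_at_top_dense)
  have rat: "(\<lambda>n. (d n + x) / \<Lambda> n) \<longlonglongrightarrow> 1" for x
  proof -
    have "(\<lambda>n. 1 + (\<alpha> n - 1) * (ln (\<Lambda> n) / \<Lambda> n) - e n / \<Lambda> n + x * (1 / \<Lambda> n)) \<longlonglongrightarrow> 1 + 0 - 0 + x * 0"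
      by (intro tendsto_add tendsto_diff tendsto_mult tendsto_const bz ln\<Lambda> e i\<Lambda>)
    moreover have "\<forall>\<^sub>F n in sequentially. 1 + (\<alpha> n - 1) * (ln (\<Lambda> n) / \<Lambda> n) - e n / \<Lambda> n + x * (1 / \<Lambda> n) = (d n + x) / \<Lambda> n"
      using ev by eventually_elim (simp add: d field_simps)
    ultimately show ?thesis by (simp add: tendsto_cong)
  qed
  have rat0: "(\<lambda>n. d n / \<Lambda> n) \<longlonglongrightarrow> 1" using rat[of 0] by simp
  have "filterlim (\<lambda>n. d n / \<Lambda> n * \<Lambda> n) at_top sequentially"
    by (rule filterlim_tendsto_pos_mult_at_top[OF rat0 _ \<Lambda>]) simp
  thus dtop: "filterlim d at_top sequentially"
    by (rule filterlim_mono_eventually[OF _ order_refl order_refl]) (use ev in eventually_elim, simp)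
  have "(\<lambda>n. 1 / d n) \<longlonglongrightarrow> 0"
    using tendsto_inverse_0_at_top[OF dtop] by (simp add: divide_inverse)
  from bz[OF this] this have "(\<lambda>n. (\<alpha> n - 1) * (1 / d n) + 1 / d n) \<longlonglongrightarrow> 0 + 0" by (rule tendsto_add)
  thus "(\<lambda>n. \<alpha> n / d n) \<longlonglongrightarrow> 0" by (simp add: diff_divide_distrib)
  show "(\<lambda>n. d n / sqrt (real n * \<alpha> n)) \<longlonglongrightarrow> 0"
  proof -
    have "(\<lambda>n. d n / \<Lambda> n * (\<Lambda> n / sqrt (real n * \<alpha> n))) \<longlonglongrightarrow> 0"
      using tendsto_mult[OF rat0 conc] by simp
    moreover have "\<forall>\<^sub>F n in sequentially. d n / \<Lambda> n * (\<Lambda> n / sqrt (real n * \<alpha> n)) = d n / sqrt (real n * \<alpha> n)"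
      using ev by eventually_elim simp
    ultimately show ?thesis by (rule Lim_transform_eventually)
  qed
  fix x
  have "(\<lambda>n. ln ((d n + x) / \<Lambda> n)) \<longlonglongrightarrow> ln 1" by (intro tendsto_ln rat) simp
  hence "(\<lambda>n. (\<alpha> n - 1) * ln ((d n + x) / \<Lambda> n)) \<longlonglongrightarrow> 0" by (intro bz) simp
  from tendsto_add[OF this E]
  have "(\<lambda>n. (\<alpha> n - 1) * ln ((d n + x) / \<Lambda> n) + (ln (real n) - \<Lambda> n + e n - ln (Gamma (\<alpha> n)))) \<longlonglongrightarrow> 0" by simp
  moreover have "\<forall>\<^sub>F n in sequentially. (\<alpha> n - 1) * ln ((d n + x) / \<Lambda> n) + (ln (real n) - \<Lambda> n + e n - ln (Gamma (\<alpha> n))) =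
      ln (real n) + (\<alpha> n - 1) * ln (d n + x) - d n - ln (Gamma (\<alpha> n))"
    using ev order_tendstoD(1)[OF rat[of x] zero_less_one]
  proof eventually_elim
    case (elim n)
    hence "d n + x > 0" by (simp add: zero_less_divide_iff)
    thus ?case using elim by (simp add: ln_div d algebra_simps)
  qed
  ultimately show "(\<lambda>n. ln (real n) + (\<alpha> n - 1) * ln (d n + x) - d n - ln (Gamma (\<alpha> n))) \<longlonglongrightarrow> 0"
    by (simp add: tendsto_cong)
qed auto

text \<open>Here \<open>\<alpha> n + w n\<close> is the point whose Gamma density determines the centering, and \<open>s n\<close> is a
  shift away from it over which the density decays exponentially with rate \<open>w n / (\<alpha> n + w n)\<close>.\<close>

lemma gamma_tail_limit_large_shape:
  fixes \<alpha> w s :: "nat \<Rightarrow> real"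
  assumes \<alpha>: "filterlim \<alpha> at_top sequentially"
    and w: "\<forall>\<^sub>F n in sequentially. w n > 0"
    and aw: "(\<lambda>n. \<alpha> n / (w n)\<^sup>2) \<longlonglongrightarrow> 0"
    and sw: "(\<lambda>n. s n / w n) \<longlonglongrightarrow> 0"
    and sa: "(\<lambda>n. (s n)\<^sup>2 / \<alpha> n) \<longlonglongrightarrow> 0"
    and H: "(\<lambda>n. ln (real n) + ln (\<alpha> n) / 2 + \<alpha> n * ln (1 + w n / \<alpha> n) - w n - ln (w n)
              - w n / (\<alpha> n + w n) * s n) \<longlonglongrightarrow> ln (2 * pi) / 2 - x"
  shows "(\<lambda>n. real n * gamma_tail (\<alpha> n) (\<alpha> n + w n + s n)) \<longlonglongrightarrow> exp (- x)"
    and "(\<lambda>n. s n / (\<alpha> n + w n)) \<longlonglongrightarrow> 0"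
    and "\<forall>\<^sub>F n in sequentially. \<alpha> n + w n + s n > 0"
proof -
  \<comment> \<open>For \<open>y = \<alpha> n + w n + s n\<close>, \<open>q\<close> is the relative
    error of \<open>y - (\<alpha> n - 1)\<close> against \<open>w n\<close>, and \<open>v\<close>
    that of \<open>y\<close> against \<open>\<alpha> n + w n\<close>.\<close>
  define q where "q n = s n / w n + 1 / w n" for n
  define v where "v n = s n / (\<alpha> n + w n)" for n
  have a2: "\<forall>\<^sub>F n in sequentially. \<alpha> n \<ge> 2" using \<alpha> by (simp add: filterlim_at_top)
  have iw: "(\<lambda>n. 1 / w n) \<longlonglongrightarrow> 0"
  proof -
    have "(\<lambda>n. 1 / sqrt (\<alpha> n)) \<longlonglongrightarrow> 0"
      using tendsto_inverse_0_at_top[OF filterlim_compose[OF sqrt_at_top \<alpha>]] by (simp add: divide_inverse)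
    from tendsto_mult[OF tendsto_real_sqrt[OF aw] this]
    have "(\<lambda>n. sqrt (\<alpha> n / (w n)\<^sup>2) * (1 / sqrt (\<alpha> n))) \<longlonglongrightarrow> 0" by simp
    moreover have "\<forall>\<^sub>F n in sequentially. sqrt (\<alpha> n / (w n)\<^sup>2) * (1 / sqrt (\<alpha> n)) = 1 / w n"
      using w a2 by eventually_elim (simp add: real_sqrt_divide)
    ultimately show ?thesis by (rule Lim_transform_eventually)
  qed
  have q: "q \<longlonglongrightarrow> 0" unfolding q_def using tendsto_add[OF sw iw] by simp
  have v: "v \<longlonglongrightarrow> 0"
  proof (rule Lim_null_comparison[OF _ tendsto_rabs_zero[OF sw]])
    show "\<forall>\<^sub>F n in sequentially. norm (v n) \<le> \<bar>s n / w n\<bar>"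
      using w a2 by eventually_elim (auto simp: v_def intro!: divide_left_mono mult_pos_pos)
  qed
  thus "(\<lambda>n. s n / (\<alpha> n + w n)) \<longlonglongrightarrow> 0" by (simp add: v_def[abs_def])
  have av: "(\<lambda>n. \<alpha> n * (v n)\<^sup>2) \<longlonglongrightarrow> 0"
  proof (rule Lim_null_comparison[OF _ sa])
    show "\<forall>\<^sub>F n in sequentially. norm (\<alpha> n * (v n)\<^sup>2) \<le> (s n)\<^sup>2 / \<alpha> n"
      using w a2
    proof eventually_elim
      case (elim n)
      have "(s n)\<^sup>2 / (\<alpha> n + w n)\<^sup>2 \<le> (s n)\<^sup>2 / (\<alpha> n)\<^sup>2"
        using elim by (intro divide_left_mono power_mono mult_pos_pos) auto
      hence "\<alpha> n * ((s n)\<^sup>2 / (\<alpha> n + w n)\<^sup>2) \<le> \<alpha> n * ((s n)\<^sup>2 / (\<alpha> n)\<^sup>2)"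
        using elim by (intro mult_left_mono) auto
      also have "\<dots> = (s n)\<^sup>2 / \<alpha> n" using elim by (simp add: power2_eq_square)
      finally show ?case using elim by (simp add: v_def power_divide)
    qed
  qed
  have evq: "\<forall>\<^sub>F n in sequentially. q n > -1" using q by (rule order_tendstoD) simp
  have evv: "\<forall>\<^sub>F n in sequentially. v n > -1" using v by (rule order_tendstoD) simp
  have yq: "\<forall>\<^sub>F n in sequentially. \<alpha> n + w n + s n - (\<alpha> n - 1) = w n * (1 + q n)"
    using w by eventually_elim (simp add: q_def field_simps)
  have yv: "\<forall>\<^sub>F n in sequentially. \<alpha> n + w n + s n = (\<alpha> n + w n) * (1 + v n)"
    using w a2 by eventually_elim (simp add: v_def field_simps)
  have ygt: "\<forall>\<^sub>F n in sequentially. \<alpha> n + w n + s n > \<alpha> n - 1"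
    using yq evq w
  proof eventually_elim
    case (elim n)
    have "w n * (1 + q n) > 0" using elim by simp
    thus ?case using elim by linarith
  qed
  show "\<forall>\<^sub>F n in sequentially. \<alpha> n + w n + s n > 0"
    using ygt a2 by eventually_elim linarith
  show "(\<lambda>n. real n * gamma_tail (\<alpha> n) (\<alpha> n + w n + s n)) \<longlonglongrightarrow> exp (- x)"
  proof (rule gamma_tail_limit)
    show "\<forall>\<^sub>F n in sequentially. \<alpha> n > 0 \<and> \<alpha> n + w n + s n \<ge> 1 \<and> \<alpha> n + w n + s n > \<alpha> n - 1"
      using ygt a2 by eventually_elim linarith
    have "(\<lambda>n. (\<alpha> n / (w n)\<^sup>2 - (1 / w n)\<^sup>2) / (1 + q n)\<^sup>2) \<longlonglongrightarrow> 0"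
      using tendsto_divide[OF tendsto_diff[OF aw tendsto_power[OF iw, of 2]]
          tendsto_power[OF tendsto_add[OF tendsto_const[of 1] q], of 2]]
      by simp
    moreover have "\<forall>\<^sub>F n in sequentially. (\<alpha> n / (w n)\<^sup>2 - (1 / w n)\<^sup>2) / (1 + q n)\<^sup>2 =
       (\<alpha> n - 1) / (\<alpha> n + w n + s n - (\<alpha> n - 1))\<^sup>2"
      using yq w
    proof eventually_elim
      case (elim n)
      show ?case unfolding elim(1) using elim(2)
        by (simp add: power_mult_distrib power_divide flip: diff_divide_distrib)
    qed
    ultimately show "(\<lambda>n. (\<alpha> n - 1) / (\<alpha> n + w n + s n - (\<alpha> n - 1))\<^sup>2) \<longlonglongrightarrow> 0"
      by (rule Lim_transform_eventually)
    \<comment> \<open>The exponent is split into the part fixed by \<open>H\<close>, the Stirling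
      remainder, the second-order error in \<open>ln (1 + v)\<close>, and the factor
      \<open>1 + q\<close>. The exponent \<open>\<alpha> n - 1\<close> becomes
      \<open>\<alpha> n\<close> because \<open>- ln (1 - (\<alpha> n - 1) / y)\<close> contributes
      another \<open>ln y\<close>.\<close>
    have "(\<lambda>n. (ln (real n) + ln (\<alpha> n) / 2 + \<alpha> n * ln (1 + w n / \<alpha> n) - w n - ln (w n) - w n / (\<alpha> n + w n) * s n)
        - stirling_rem (\<alpha> n) + \<alpha> n * (ln (1 + v n) - v n) - ln (1 + q n)) \<longlonglongrightarrow>
        (ln (2 * pi) / 2 - x) - ln (2 * pi) / 2 + 0 - ln (1 + 0)"
      by (intro tendsto_diff tendsto_add tendsto_ln H filterlim_compose[OF stirling_rem_tendsto \<alpha>]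
          mult_ln_one_plus_minus_tendsto_0 v av q tendsto_const) simp
    also have "(ln (2 * pi) / 2 - x) - ln (2 * pi) / 2 + 0 - ln (1 + 0) = - x" by simp
    finally have "(\<lambda>n. (ln (real n) + ln (\<alpha> n) / 2 + \<alpha> n * ln (1 + w n / \<alpha> n) - w n - ln (w n) - w n / (\<alpha> n + w n) * s n)
        - stirling_rem (\<alpha> n) + \<alpha> n * (ln (1 + v n) - v n) - ln (1 + q n)) \<longlonglongrightarrow> - x" .
    moreover have "\<forall>\<^sub>F n in sequentially. (ln (real n) + ln (\<alpha> n) / 2 + \<alpha> n * ln (1 + w n / \<alpha> n) - w n - ln (w n) - w n / (\<alpha> n + w n) * s n)
        - stirling_rem (\<alpha> n) + \<alpha> n * (ln (1 + v n) - v n) - ln (1 + q n) =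
        ln (real n) + (\<alpha> n - 1) * ln (\<alpha> n + w n + s n) - (\<alpha> n + w n + s n) - ln (Gamma (\<alpha> n))
          - ln (1 - (\<alpha> n - 1) / (\<alpha> n + w n + s n))"
      using yq yv evq evv w a2
    proof eventually_elim
      case (elim n)
      define A where "A = \<alpha> n + w n"
      have A: "A > 0" "\<alpha> n > 0" using elim by (auto simp: A_def)
      have "A = \<alpha> n * (1 + w n / \<alpha> n)" using A by (simp add: A_def field_simps)
      also have "ln \<dots> = ln (\<alpha> n) + ln (1 + w n / \<alpha> n)"
        using A elim add_pos_pos[of 1 "w n / \<alpha> n"] by (subst ln_mult) auto
      finally have lA: "ln A = ln (\<alpha> n) + ln (1 + w n / \<alpha> n)" .
      have y: "\<alpha> n + w n + s n = A * (1 + v n)" using elim by (simp add: A_def)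
      have ly: "ln (\<alpha> n + w n + s n) = ln A + ln (1 + v n)"
        unfolding y using A elim by (subst ln_mult) auto
      have y0: "\<alpha> n + w n + s n > 0" unfolding y using A elim by simp
      have "1 - (\<alpha> n - 1) / (\<alpha> n + w n + s n) = (\<alpha> n + w n + s n - (\<alpha> n - 1)) / (\<alpha> n + w n + s n)"
        using y0 by (simp add: field_simps)
      also have "\<dots> = w n * (1 + q n) / (\<alpha> n + w n + s n)" unfolding elim(1) ..
      also have "ln \<dots> = ln (w n) + ln (1 + q n) - ln (\<alpha> n + w n + s n)"
        using elim y0 by (subst ln_div, simp, simp, subst ln_mult) auto
      finally have l1: "ln (1 - (\<alpha> n - 1) / (\<alpha> n + w n + s n)) = ln (w n) + ln (1 + q n) - ln (\<alpha> n + w n + s n)" .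
      \<comment> \<open>The first-order terms in \<open>s n\<close> are
        \<open>\<alpha> n * v n\<close> from the power and \<open>- s n\<close> from the
        exponential; together they give the decay rate
        \<open>w n / (\<alpha> n + w n)\<close>.\<close>
      have avs: "\<alpha> n * v n = s n - w n / (\<alpha> n + w n) * s n"
        using A by (simp add: v_def A_def field_simps)
      have aln: "\<alpha> n * (ln (1 + v n) - v n) = \<alpha> n * ln (1 + v n) - (s n - w n / (\<alpha> n + w n) * s n)"
        unfolding right_diff_distrib avs ..
      show ?case unfolding l1 ly lA aln stirling_rem_def by (simp add: algebra_simps)
    qed
    ultimately show "(\<lambda>n. ln (real n) + (\<alpha> n - 1) * ln (\<alpha> n + w n + s n) - (\<alpha> n + w n + s n) - ln (Gamma (\<alpha> n))
          - ln (1 - (\<alpha> n - 1) / (\<alpha> n + w n + s n))) \<longlonglongrightarrow> - x"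
      by (rule Lim_transform_eventually)
  qed
qed

text \<open>\<open>s x n\<close> collects both the part of the centering beyond
  \<open>\<alpha> n + w n\<close> and the scaled shift \<open>c n * x\<close>. As it is negligible
  against \<open>\<alpha> n + w n\<close>, concentration only needs checking at that point.\<close>

lemma conv_in_distr_gumbel_large_shape:
  fixes M :: "nat \<Rightarrow> 'a measure" and w c d :: "nat \<Rightarrow> real"
  assumes pos: "\<And>n. n \<ge> 1 \<Longrightarrow> \<alpha> n > 0" "\<And>n. n \<ge> 1 \<Longrightarrow> \<beta> n > 0"
    and prob: "\<And>n. n \<ge> 1 \<Longrightarrow> prob_space (M n)"
    and dir: "\<And>n. n \<ge> 1 \<Longrightarrow> has_dirichlet (M n) n (X n) (\<alpha> n) (\<beta> n)"
    and \<alpha>: "filterlim \<alpha> at_top sequentially"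
    and w: "\<forall>\<^sub>F n in sequentially. w n > 0"
    and c: "\<forall>\<^sub>F n in sequentially. c n > 0"
    and aw: "(\<lambda>n. \<alpha> n / (w n)\<^sup>2) \<longlonglongrightarrow> 0"
    and s: "\<And>x n. s x n = d n + c n * x - (\<alpha> n + w n)"
    and sw: "\<And>x. (\<lambda>n. s x n / w n) \<longlonglongrightarrow> 0"
    and sa: "\<And>x. (\<lambda>n. (s x n)\<^sup>2 / \<alpha> n) \<longlonglongrightarrow> 0"
    and H: "\<And>x. (\<lambda>n. ln (real n) + ln (\<alpha> n) / 2 + \<alpha> n * ln (1 + w n / \<alpha> n) - w n - ln (w n)
              - w n / (\<alpha> n + w n) * s x n) \<longlonglongrightarrow> ln (2 * pi) / 2 - x"
    and conc: "(\<lambda>n. (\<alpha> n + w n) / (c n * sqrt (real n * \<alpha> n))) \<longlonglongrightarrow> 0"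
  shows "conv_in_distr M (normalized_max \<alpha> \<beta> X d c) gumbel_cdf"
proof (rule conv_in_distr_gumbelI[OF pos prob dir c])
  fix x
  note * = gamma_tail_limit_large_shape[OF \<alpha> w aw sw sa H, of x]
  have y: "\<alpha> n + w n + s x n = d n + c n * x" for n by (simp add: s)
  show "(\<lambda>n. real n * gamma_tail (\<alpha> n) (d n + c n * x)) \<longlonglongrightarrow> exp (- x)"
    using *(1) unfolding y .
  show "\<forall>\<^sub>F n in sequentially. d n + c n * x > 0" using *(3) unfolding y .
  have "(\<lambda>n. (\<alpha> n + w n) / (c n * sqrt (real n * \<alpha> n)) * (1 + s x n / (\<alpha> n + w n))) \<longlonglongrightarrow> 0"
    using tendsto_mult[OF conc tendsto_add[OF tendsto_const[of 1] *(2)]] by simp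
  moreover have "\<forall>\<^sub>F n in sequentially. (\<alpha> n + w n) / (c n * sqrt (real n * \<alpha> n)) * (1 + s x n / (\<alpha> n + w n)) =
      (d n + c n * x) / (c n * sqrt (real n * \<alpha> n))"
    using w eventually_ge_at_top[of 1]
  proof eventually_elim
    case (elim n)
    hence "\<alpha> n + w n \<noteq> 0" using pos(1)[of n] by simp
    hence "(\<alpha> n + w n) * (1 + s x n / (\<alpha> n + w n)) = \<alpha> n + w n + s x n" by (simp add: field_simps)
    thus ?case unfolding y by (simp add: mult_ac)
  qed
  ultimately show "(\<lambda>n. (d n + c n * x) / (c n * sqrt (real n * \<alpha> n))) \<longlonglongrightarrow> 0"
    by (rule Lim_transform_eventually)
qed auto

section \<open>The centering sequences\<close>

text \<open>On \<open>z \<ge> 0\<close> the right side has slope \<open>k / (B + z) < 1/2\<close>,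
  so two solutions cannot coexist. A solution lies in \<open>[0, B]\<close>: at 0 the right side is
  positive because \<open>B > 1\<close>, and at \<open>B\<close> it is at most
  \<open>(2 * B - 1) / 2\<close>.\<close>

lemma xi_equation_ex1:
  fixes B k :: real
  assumes B: "B > 1" and k: "0 < k" "k \<le> 1/2"
  shows "\<exists>!z. z > 0 \<and> z = k * ln (B + z)"
proof (rule ex_ex1I)
  have "\<exists>z\<ge>0. z \<le> B \<and> z - k * ln (B + z) = 0"
  proof (rule IVT')
    show "0 - k * ln (B + 0) \<le> 0" using B k by simp
    have "k * ln (B + B) \<le> 1/2 * ln (B + B)" using B k by (intro mult_right_mono) auto
    also have "ln (B + B) \<le> B + B - 1" using B by (intro ln_le_minus_one) auto
    finally show "0 \<le> B - k * ln (B + B)" by simp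
    show "continuous_on {0..B} (\<lambda>z. z - k * ln (B + z))"
      using B by (intro continuous_intros) auto
  qed (use B in auto)
  then obtain z where z: "z \<ge> 0" "z - k * ln (B + z) = 0" by auto
  moreover have "z \<noteq> 0" using z B k by auto
  ultimately show "\<exists>z. z > 0 \<and> z = k * ln (B + z)" by (intro exI[of _ z]) auto
next
  have less: False if "0 < z" "z < z'" "z = k * ln (B + z)" "z' = k * ln (B + z')" for z z'
  proof -
    have "z' - z = k * ln ((B + z') / (B + z))"
      using that B by (simp add: ln_div algebra_simps)
    also have "\<dots> \<le> 1/2 * ((B + z') / (B + z) - 1)"
      using that B k by (intro mult_mono ln_le_minus_one) auto
    also have "(B + z') / (B + z) - 1 = (z' - z) / (B + z)"
      using that B by (simp add: field_simps)
    also have "\<dots> \<le> (z' - z) / 1"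
      using that B by (intro divide_left_mono) auto
    finally show False using that by simp
  qed
  fix z z' assume "z > 0 \<and> z = k * ln (B + z)" "z' > 0 \<and> z' = k * ln (B + z')"
  thus "z = z'" using less[of z z'] less[of z' z] by (meson linorder_neqE)
qed

lemma ln_le_half: "x > 0 \<Longrightarrow> ln x \<le> x / (2 :: real)"
  using ln_le_minus_one[of "x / 2"] ln_2_less_1 by (simp add: ln_div)

text \<open>The right side has slope \<open>k / z < 1\<close> beyond 1, which gives uniqueness. The
  right endpoint \<open>2 + 2 * \<rho>\<close> for the intermediate value theorem comes from
  \<open>ln z \<le> z / 2\<close>, and \<open>\<rho> > 0\<close> excludes the root
  \<open>z = 1\<close>.\<close>

lemma zeta_equation_ex1:
  fixes k \<rho> :: real
  assumes \<rho>: "\<rho> > 0" and k: "0 \<le> k" "k \<le> 1"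
  shows "\<exists>!z. z > 1 \<and> z = 1 + \<rho> + k * ln z"
proof (rule ex_ex1I)
  have "\<exists>z\<ge>1. z \<le> 2 + 2 * \<rho> \<and> z - k * ln z = 1 + \<rho>"
  proof (rule IVT')
    have "k * ln (2 + 2 * \<rho>) \<le> 1 * ((2 + 2 * \<rho>) / 2)"
      using \<rho> k by (intro mult_mono ln_le_half) auto
    thus "1 + \<rho> \<le> 2 + 2 * \<rho> - k * ln (2 + 2 * \<rho>)" by simp
    show "continuous_on {1..2 + 2 * \<rho>} (\<lambda>z. z - k * ln z)" by (intro continuous_intros) auto
  qed (use \<rho> in auto)
  then obtain z where z: "z \<ge> 1" "z - k * ln z = 1 + \<rho>" by auto
  moreover have "z \<noteq> 1" using z \<rho> by auto
  ultimately show "\<exists>z. z > 1 \<and> z = 1 + \<rho> + k * ln z" by (intro exI[of _ z]) auto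
next
  have less: False if "1 < z" "z < z'" "z = 1 + \<rho> + k * ln z" "z' = 1 + \<rho> + k * ln z'" for z z'
  proof -
    have "z' - z = k * ln (z' / z)" using that by (simp add: ln_div algebra_simps)
    also have "\<dots> \<le> 1 * (z' / z - 1)"
      using that k by (intro mult_mono ln_le_minus_one) auto
    also have "1 * (z' / z - 1) = (z' - z) / z" using that by (simp add: field_simps)
    also have "\<dots> < (z' - z) / 1" using that by (intro divide_strict_left_mono) auto
    finally show False by simp
  qed
  fix z z' assume "z > 1 \<and> z = 1 + \<rho> + k * ln z" "z' > 1 \<and> z' = 1 + \<rho> + k * ln z'"
  thus "z = z'" using less[of z z'] less[of z' z] by (meson linorder_neqE)
qed

text \<open>With \<open>w = b * sqrt a\<close>, this is minus the logarithm of the approximate tail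
  at \<open>a + w\<close>: Stirling's formula replaces Gamma, and \<open>w / (a + w)\<close>
  replaces \<open>1 - (a - 1) / y\<close>.\<close>

definition b_fun :: "real \<Rightarrow> real \<Rightarrow> real" where
  "b_fun a b = ln b + 1/2 * ln (2 * pi) + b * sqrt a - a * ln (1 + b / sqrt a)"

text \<open>In terms of \<open>u = b / sqrt a\<close> the last two summands are
  \<open>a * (u - ln (1 + u))\<close>, which does not decrease, and \<open>ln b\<close> increases
  strictly.\<close>

lemma b_fun_strict_mono:
  assumes "a > 0" "0 < b" "b < b'"
  shows "b_fun a b < b_fun a b'"
proof -
  define u u' where "u = b / sqrt a" and "u' = b' / sqrt a"
  have u: "0 < u" "u < u'" using assms by (auto simp: u_def u'_def divide_strict_right_mono)
  have "ln ((1 + u') / (1 + u)) \<le> (1 + u') / (1 + u) - 1" using u by (intro ln_le_minus_one) auto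
  also have "\<dots> = (u' - u) / (1 + u)" using u by (simp add: field_simps)
  also have "\<dots> \<le> (u' - u) / 1" using u by (intro divide_left_mono) auto
  finally have "a * (ln (1 + u') - ln (1 + u)) \<le> a * (u' - u)"
    using u assms by (intro mult_left_mono) (auto simp: ln_div)
  also have "a * u' = b' * sqrt a" "a * u = b * sqrt a"
    using assms real_sqrt_mult_self[of a] by (auto simp: u_def u'_def field_simps)
  hence "a * (u' - u) = b' * sqrt a - b * sqrt a" by (simp add: algebra_simps)
  finally have "a * ln (1 + u') - a * ln (1 + u) \<le> b' * sqrt a - b * sqrt a" by (simp add: algebra_simps)
  moreover have "ln b < ln b'" using assms by simp
  ultimately show ?thesis unfolding b_fun_def u_def u'_def by linarith
qed

text \<open>With \<open>u = b / sqrt a\<close>, which tends to 0 as \<open>ln n\<close> is small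
  against the shape, the main part \<open>a * (u - ln (1 + u))\<close> behaves like
  \<open>a * u^2 / 2 = b^2 / 2 = t^2 * ln n\<close>; the remaining terms are of smaller
  order.\<close>

lemma b_fun_asymp:
  fixes \<alpha> :: "nat \<Rightarrow> real"
  assumes pos: "\<And>n. n \<ge> 1 \<Longrightarrow> \<alpha> n > 0"
    and o: "(\<lambda>n. ln (real n) / \<alpha> n) \<longlonglongrightarrow> 0" and t: "t > 0"
  shows "(\<lambda>n. b_fun (\<alpha> n) (t * sqrt (2 * ln (real n))) / ln (real n)) \<longlonglongrightarrow> t\<^sup>2"
proof -
  define u where "u n = t * sqrt (2 * ln (real n)) / sqrt (\<alpha> n)" for n
  have u: "u \<longlonglongrightarrow> 0"
  proof -
    have "(\<lambda>n. t * sqrt (2 * (ln (real n) / \<alpha> n))) \<longlonglongrightarrow> 0"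
      using tendsto_mult[OF tendsto_const[of t] tendsto_real_sqrt[OF tendsto_mult[OF tendsto_const[of 2] o]]]
      by simp
    thus ?thesis by (simp add: u_def[abs_def] real_sqrt_divide)
  qed
  have "((\<lambda>x::real. (x - ln (1 + x)) / x\<^sup>2) \<longlongrightarrow> 1/2) (at_right 0)" by real_asymp
  moreover have "filterlim u (at_right 0) sequentially"
    unfolding filterlim_at
  proof (intro conjI u)
    show "\<forall>\<^sub>F n in sequentially. u n \<in> {0<..} \<and> u n \<noteq> 0"
      using eventually_gt_at_top[of 1]
    proof eventually_elim
      case (elim n)
      hence "u n > 0" unfolding u_def by (intro divide_pos_pos mult_pos_pos t) (auto simp: pos)
      thus ?case by simp
    qed
  qed
  ultimately have psi: "(\<lambda>n. (u n - ln (1 + u n)) / (u n)\<^sup>2) \<longlonglongrightarrow> 1/2"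
    by (rule filterlim_compose)
  have 1: "(\<lambda>n. (ln (t * sqrt (2 * ln (real n))) + 1/2 * ln (2 * pi)) / ln (real n)) \<longlonglongrightarrow> 0"
    using t by real_asymp
  have "(\<lambda>n. (ln (t * sqrt (2 * ln (real n))) + 1/2 * ln (2 * pi)) / ln (real n) +
      2 * t\<^sup>2 * ((u n - ln (1 + u n)) / (u n)\<^sup>2)) \<longlonglongrightarrow> 0 + 2 * t\<^sup>2 * (1/2)"
    by (intro tendsto_add tendsto_mult tendsto_const psi 1)
  hence "(\<lambda>n. (ln (t * sqrt (2 * ln (real n))) + 1/2 * ln (2 * pi)) / ln (real n) +
      2 * t\<^sup>2 * ((u n - ln (1 + u n)) / (u n)\<^sup>2)) \<longlonglongrightarrow> t\<^sup>2" by simp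
  moreover have "\<forall>\<^sub>F n in sequentially. (ln (t * sqrt (2 * ln (real n))) + 1/2 * ln (2 * pi)) / ln (real n) +
      2 * t\<^sup>2 * ((u n - ln (1 + u n)) / (u n)\<^sup>2) = b_fun (\<alpha> n) (t * sqrt (2 * ln (real n))) / ln (real n)"
    using eventually_gt_at_top[of 1]
  proof eventually_elim
    case (elim n)
    have a: "\<alpha> n > 0" "ln (real n) > 0" using pos elim by auto
    have u2: "(u n)\<^sup>2 = 2 * t\<^sup>2 * ln (real n) / \<alpha> n"
      using a by (simp add: u_def power_divide power_mult_distrib)
    have "2 * t\<^sup>2 * ((u n - ln (1 + u n)) / (u n)\<^sup>2) = (\<alpha> n * u n - \<alpha> n * ln (1 + u n)) / ln (real n)"
      unfolding u2 using a t by (simp add: field_simps)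
    also have "\<alpha> n * u n = t * sqrt (2 * ln (real n)) * sqrt (\<alpha> n)"
      using a real_sqrt_mult_self[of "\<alpha> n"] by (simp add: u_def field_simps)
    finally show ?case
      unfolding b_fun_def u_def[symmetric] by (simp add: add_divide_distrib diff_divide_distrib)
  qed
  ultimately show ?thesis by (rule Lim_transform_eventually)
qed

text \<open>By \<open>b_fun_asymp\<close>, \<open>b_fun\<close> at
  \<open>t * sqrt (2 * ln n)\<close> is eventually below \<open>ln n\<close> for
  \<open>t < 1\<close> and above it for \<open>t > 1\<close>. This yields a root between
  \<open>t = 1/2\<close> and \<open>t = 2\<close>, and monotonicity forces the roots to be
  asymptotic to \<open>sqrt (2 * ln n)\<close>. So an admissible sequence exists, and the choice
  operator hands its two properties to \<open>b_seq\<close>.\<close>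

lemma b_seq_properties:
  fixes \<alpha> :: "nat \<Rightarrow> real"
  assumes pos: "\<And>n. n \<ge> 1 \<Longrightarrow> \<alpha> n > 0"
    and o: "(\<lambda>n. ln (real n) / \<alpha> n) \<longlonglongrightarrow> 0"
  shows "\<forall>\<^sub>F n in sequentially. b_fun (\<alpha> n) (b_seq \<alpha> n) = ln (real n)"
    and "(\<lambda>n. b_seq \<alpha> n / sqrt (2 * ln (real n))) \<longlonglongrightarrow> 1"
proof -
  define r where "r n = sqrt (2 * ln (real n))" for n
  define b where "b n = (SOME b. b > 0 \<and> b_fun (\<alpha> n) b = ln (real n))" for n
  have lo: "\<forall>\<^sub>F n in sequentially. b_fun (\<alpha> n) (t * r n) < ln (real n)" if "0 < t" "t < 1" for t
  proof -
    have "t\<^sup>2 < 1" using that by (simp add: power_less_one_iff abs_square_less_1)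
    with b_fun_asymp[of \<alpha>, OF _ o that(1)] pos
    have "\<forall>\<^sub>F n in sequentially. b_fun (\<alpha> n) (t * sqrt (2 * ln (real n))) / ln (real n) < 1"
      by (intro order_tendstoD(2)) auto
    thus ?thesis using eventually_gt_at_top[of 1]
      by eventually_elim (simp add: divide_less_eq r_def)
  qed
  have hi: "\<forall>\<^sub>F n in sequentially. b_fun (\<alpha> n) (t * r n) > ln (real n)" if "1 < t" for t
  proof -
    have "t\<^sup>2 > 1" "0 < t" using that by (auto intro: one_less_power)
    with b_fun_asymp[of \<alpha>, OF _ o this(2)] pos
    have "\<forall>\<^sub>F n in sequentially. 1 < b_fun (\<alpha> n) (t * sqrt (2 * ln (real n))) / ln (real n)"
      by (intro order_tendstoD(1)) auto
    thus ?thesis using eventually_gt_at_top[of 1]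
      by eventually_elim (simp add: less_divide_eq r_def)
  qed
  have b: "\<forall>\<^sub>F n in sequentially. b n > 0 \<and> b_fun (\<alpha> n) (b n) = ln (real n)"
    using lo[of "1/2", simplified] hi[of 2, simplified] eventually_gt_at_top[of 1]
  proof eventually_elim
    case (elim n)
    have r: "r n > 0" and a: "\<alpha> n > 0" using elim pos by (auto simp: r_def)
    have "\<exists>b\<ge>r n / 2. b \<le> 2 * r n \<and> b_fun (\<alpha> n) b = ln (real n)"
    proof (rule IVT')
      have "1 + b / sqrt (\<alpha> n) \<noteq> 0" if "b \<ge> r n / 2" for b
        using that a r add_pos_nonneg[of 1 "b / sqrt (\<alpha> n)"] by simp
      thus "continuous_on {r n / 2..2 * r n} (b_fun (\<alpha> n))"
        unfolding b_fun_def[abs_def] using r a by (intro continuous_intros) force+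
    qed (use elim r in auto)
    then obtain b where "b \<ge> r n / 2" "b_fun (\<alpha> n) b = ln (real n)" by auto
    with r have "b > 0 \<and> b_fun (\<alpha> n) b = ln (real n)" by auto
    thus ?case unfolding b_def by (rule someI)
  qed
  have lim: "(\<lambda>n. b n / r n) \<longlonglongrightarrow> 1"
  proof (rule order_tendstoI)
    fix t :: real assume t: "t < 1"
    \<comment> \<open>The given \<open>t\<close> may be negative, while \<open>lo\<close> needs a
      positive factor.\<close>
    define t' where "t' = max t (1/2)"
    have t': "0 < t'" "t' < 1" using t by (auto simp: t'_def)
    show "\<forall>\<^sub>F n in sequentially. t < b n / r n"
      using lo[OF t'] b eventually_gt_at_top[of 1]
    proof eventually_elim
      case (elim n)
      have r: "r n > 0" and a: "\<alpha> n > 0" using elim pos by (auto simp: r_def)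
      have "t' * r n < b n"
      proof (rule ccontr)
        assume "\<not> t' * r n < b n"
        hence "b n < t' * r n \<or> b n = t' * r n" by auto
        thus False using b_fun_strict_mono[OF a, of "b n" "t' * r n"] elim by auto
      qed
      hence "t' < b n / r n" using r by (simp add: less_divide_eq)
      thus ?case by (simp add: t'_def)
    qed
  next
    fix t :: real assume t: "1 < t"
    show "\<forall>\<^sub>F n in sequentially. b n / r n < t"
      using hi[OF t] b eventually_gt_at_top[of 1]
    proof eventually_elim
      case (elim n)
      have r: "r n > 0" and a: "\<alpha> n > 0" using elim pos by (auto simp: r_def)
      have "b n < t * r n"
      proof (rule ccontr)
        assume "\<not> b n < t * r n"
        hence "t * r n < b n \<or> b n = t * r n" by auto
        thus False using b_fun_strict_mono[OF a, of "t * r n" "b n"] elim r t by auto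
      qed
      thus ?case using r by (simp add: divide_less_eq)
    qed
  qed
  have "\<exists>b. (\<forall>\<^sub>F n in sequentially. b_fun (\<alpha> n) (b n) = ln (real n)) \<and> (\<lambda>n. b n / sqrt (2 * ln (real n))) \<longlonglongrightarrow> 1"
    using lim b by (intro exI[of _ b]) (auto simp: r_def elim: eventually_mono)
  from someI_ex[OF this]
  show "\<forall>\<^sub>F n in sequentially. b_fun (\<alpha> n) (b_seq \<alpha> n) = ln (real n)"
    and "(\<lambda>n. b_seq \<alpha> n / sqrt (2 * ln (real n))) \<longlonglongrightarrow> 1"
    unfolding b_seq_def b_fun_def by auto
qed

section \<open>The limit laws\<close>

text \<open>The shape may approach the pole of Gamma at 0; adding 1 moves it into a compact interval
  on which \<open>ln (Gamma x)\<close> is continuous.\<close>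

lemma ln_Gamma_plus1_bounded:
  fixes \<alpha> :: "nat \<Rightarrow> real"
  assumes pos: "\<And>n. n \<ge> 1 \<Longrightarrow> \<alpha> n > 0" and bdd: "Bseq \<alpha>"
  shows "\<exists>K. \<forall>n\<ge>1. \<bar>ln (Gamma (\<alpha> n + 1))\<bar> \<le> K"
proof -
  obtain C where C: "\<And>n. \<bar>\<alpha> n\<bar> \<le> C" using bdd by (auto simp: Bseq_def)
  have "continuous_on {1..C + 1} (\<lambda>x::real. ln (Gamma x))"
    by (intro continuous_intros) (auto simp: not_nonpos_Ints_real_pos Gamma_eq_zero_iff)
  hence "bounded ((\<lambda>x::real. ln (Gamma x)) ` {1..C + 1})"
    by (intro compact_imp_bounded compact_continuous_image) auto
  then obtain K where K: "\<forall>x\<in>{1..C + 1}. \<bar>ln (Gamma x)\<bar> \<le> K"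
    unfolding bounded_iff by (auto simp del: atLeastAtMost_iff)
  show ?thesis
  proof (intro exI allI impI)
    fix n :: nat assume "n \<ge> 1"
    thus "\<bar>ln (Gamma (\<alpha> n + 1))\<bar> \<le> K" using pos[of n] C[of n] by (intro K[rule_format]) auto
  qed
qed

lemma filterlim_ln_nat: "filterlim (\<lambda>n. ln (real n)) at_top sequentially"
  by real_asymp

text \<open>With \<open>\<Lambda> n = ln n\<close> and \<open>e n = ln (Gamma (\<alpha> n))\<close>
  the fixed point condition is an identity. The correction is small because it equals
  \<open>ln (Gamma (\<alpha> n + 1)) - ln (\<alpha> n)\<close>, a bounded term minus one of order
  \<open>o(ln n)\<close>.\<close>

lemma gumbel_case_subpolynomial_shape:
  fixes M :: "nat \<Rightarrow> 'a measure"
  assumes pos: "\<And>n. n \<ge> 1 \<Longrightarrow> \<alpha> n > 0" "\<And>n. n \<ge> 1 \<Longrightarrow> \<beta> n > 0"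
    and prob: "\<And>n. n \<ge> 1 \<Longrightarrow> prob_space (M n)"
    and dir: "\<And>n. n \<ge> 1 \<Longrightarrow> has_dirichlet (M n) n (X n) (\<alpha> n) (\<beta> n)"
    and o: "(\<lambda>n. ln (\<alpha> n)) \<in> o(\<lambda>n. ln (real n))" and bdd: "Bseq \<alpha>"
  shows "conv_in_distr M (normalized_max \<alpha> \<beta> X
      (\<lambda>n. ln (real n) + (\<alpha> n - 1) * ln (ln (real n)) - ln (Gamma (\<alpha> n))) (\<lambda>n. 1)) gumbel_cdf"
proof (rule conv_in_distr_gumbel_bounded_shape[OF pos prob dir bdd filterlim_ln_nat, where e = "\<lambda>n. ln (Gamma (\<alpha> n))"])
  have o': "(\<lambda>n. ln (\<alpha> n) / ln (real n)) \<longlonglongrightarrow> 0" using o by (rule smalloD_tendsto)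
  obtain K where K: "\<forall>n\<ge>1. \<bar>ln (Gamma (\<alpha> n + 1))\<bar> \<le> K"
    using ln_Gamma_plus1_bounded[of \<alpha>] pos(1) bdd by blast
  have "(\<lambda>n. ln (Gamma (\<alpha> n + 1)) * (1 / ln (real n))) \<longlonglongrightarrow> 0"
  proof (rule lim_null_mult_left_bounded)
    show "\<forall>\<^sub>F n in sequentially. norm (ln (Gamma (\<alpha> n + 1))) \<le> K"
      using eventually_ge_at_top[of 1] by eventually_elim (use K in auto)
    show "(\<lambda>n. 1 / ln (real n)) \<longlonglongrightarrow> 0" by real_asymp
  qed
  from tendsto_diff[OF this o']
  have "(\<lambda>n. ln (Gamma (\<alpha> n + 1)) * (1 / ln (real n)) - ln (\<alpha> n) / ln (real n)) \<longlonglongrightarrow> 0" by simp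
  moreover have "\<forall>\<^sub>F n in sequentially. ln (Gamma (\<alpha> n + 1)) * (1 / ln (real n)) - ln (\<alpha> n) / ln (real n) =
      ln (Gamma (\<alpha> n)) / ln (real n)"
    using eventually_ge_at_top[of 1] by eventually_elim (simp add: ln_Gamma_plus1 pos add_divide_distrib)
  ultimately show "(\<lambda>n. ln (Gamma (\<alpha> n)) / ln (real n)) \<longlonglongrightarrow> 0" by (rule Lim_transform_eventually)
  show "(\<lambda>n. ln (real n) / sqrt (real n * \<alpha> n)) \<longlonglongrightarrow> 0"
  proof (rule Lim_null_comparison)
    \<comment> \<open>Eventually \<open>ln (\<alpha> n) \<ge> - ln n / 2\<close>, so
      \<open>n * \<alpha> n \<ge> n^(1/2)\<close> and its square root is at least
      \<open>n^(1/4)\<close>.\<close>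
    show "(\<lambda>n. ln (real n) / exp (ln (real n) / 4)) \<longlonglongrightarrow> 0" by real_asymp
    have "\<forall>\<^sub>F n in sequentially. -1/2 < ln (\<alpha> n) / ln (real n)"
      using o' by (rule order_tendstoD) simp
    thus "\<forall>\<^sub>F n in sequentially. norm (ln (real n) / sqrt (real n * \<alpha> n)) \<le> ln (real n) / exp (ln (real n) / 4)"
      using eventually_gt_at_top[of 1]
    proof eventually_elim
      case (elim n)
      have a: "\<alpha> n > 0" "ln (real n) > 0" using elim pos by auto
      have "ln (real n) / 2 \<le> ln (real n) + ln (\<alpha> n)" using elim a by (simp add: field_simps)
      also have "\<dots> = ln (real n * \<alpha> n)" using elim a by (simp add: ln_mult)
      finally have "exp (ln (real n) / 2) \<le> real n * \<alpha> n"
        using elim a by (subst (asm) ln_ge_iff) auto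
      hence "sqrt (exp (ln (real n) / 2)) \<le> sqrt (real n * \<alpha> n)" by simp
      also have "sqrt (exp (ln (real n) / 2)) = exp (ln (real n) / 4)"
        by (rule real_sqrt_unique) (auto simp: power2_eq_square simp flip: exp_add)
      finally have "ln (real n) / sqrt (real n * \<alpha> n) \<le> ln (real n) / exp (ln (real n) / 4)"
        using a elim by (intro divide_left_mono mult_pos_pos) auto
      thus ?case using a elim by simp
    qed
  qed
qed auto

text \<open>A bounded shape with \<open>\<bar>ln (\<alpha> n)\<bar> \<ge> c * ln n\<close> must be
  at most \<open>n^(-c)\<close>. Hence \<open>Gamma (\<alpha> n)\<close> behaves like
  \<open>1 / \<alpha> n\<close>, and \<open>ln n - ln (Gamma (\<alpha> n))\<close> is
  \<open>ln (n * \<alpha> n)\<close> up to o(1).\<close>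

lemma gumbel_case_polynomial_shape:
  fixes M :: "nat \<Rightarrow> 'a measure"
  assumes pos: "\<And>n. n \<ge> 1 \<Longrightarrow> \<alpha> n > 0" "\<And>n. n \<ge> 1 \<Longrightarrow> \<beta> n > 0"
    and prob: "\<And>n. n \<ge> 1 \<Longrightarrow> prob_space (M n)"
    and dir: "\<And>n. n \<ge> 1 \<Longrightarrow> has_dirichlet (M n) n (X n) (\<alpha> n) (\<beta> n)"
    and bdd: "Bseq \<alpha>" and na: "filterlim (\<lambda>n. real n * \<alpha> n) at_top sequentially"
    and c: "c > 0" "\<forall>\<^sub>F n in sequentially. c \<le> \<bar>ln (\<alpha> n) / ln (real n)\<bar>"
  shows "conv_in_distr M (normalized_max \<alpha> \<beta> X
      (\<lambda>n. ln (real n * \<alpha> n) + (\<alpha> n - 1) * ln (ln (real n * \<alpha> n))) (\<lambda>n. 1)) gumbel_cdf"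
proof (rule conv_in_distr_gumbel_bounded_shape[OF pos prob dir bdd, where e = "\<lambda>n. 0" and \<Lambda> = "\<lambda>n. ln (real n * \<alpha> n)"])
  show "filterlim (\<lambda>n. ln (real n * \<alpha> n)) at_top sequentially"
    by (rule filterlim_compose[OF ln_at_top na])
  show "(\<lambda>n. ln (real n * \<alpha> n) / sqrt (real n * \<alpha> n)) \<longlonglongrightarrow> 0"
  proof (rule filterlim_compose[OF _ na])
    show "((\<lambda>x::real. ln x / sqrt x) \<longlongrightarrow> 0) at_top" by real_asymp
  qed
  obtain C where C: "\<And>n. \<bar>\<alpha> n\<bar> \<le> C" using bdd by (auto simp: Bseq_def)
  \<comment> \<open>This rules out the positive branch of the absolute value: the bound
    \<open>C\<close> prevents \<open>ln (\<alpha> n)\<close> from reaching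
    \<open>c * ln n\<close>.\<close>
  have "\<forall>\<^sub>F n in sequentially. ln C / c < ln (real n)"
    using filterlim_ln_nat by (simp add: filterlim_at_top_dense)
  hence le: "\<forall>\<^sub>F n in sequentially. \<alpha> n \<le> exp (- (c * ln (real n)))"
    using c(2) eventually_gt_at_top[of 1]
  proof eventually_elim
    case (elim n)
    have a: "\<alpha> n > 0" "ln (real n) > 0" using elim pos by auto
    have "ln (\<alpha> n) \<le> ln C" using a C[of n] by simp
    also have "\<dots> < c * ln (real n)" using elim c by (simp add: field_simps)
    finally have "ln (\<alpha> n) < c * ln (real n)" .
    moreover have "c * ln (real n) \<le> \<bar>ln (\<alpha> n)\<bar>" using elim a by (simp add: abs_divide field_simps)
    ultimately have "ln (\<alpha> n) \<le> - (c * ln (real n))" by linarith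
    hence "exp (ln (\<alpha> n)) \<le> exp (- (c * ln (real n)))" by simp
    thus ?case using a by simp
  qed
  have a0: "\<alpha> \<longlonglongrightarrow> 0"
  proof (rule tendsto_sandwich[OF _ le tendsto_const])
    show "\<forall>\<^sub>F n in sequentially. 0 \<le> \<alpha> n"
      using eventually_ge_at_top[of 1] by eventually_elim (use pos in \<open>simp add: less_imp_le\<close>)
    show "(\<lambda>n. exp (- (c * ln (real n)))) \<longlonglongrightarrow> 0" using c(1) by real_asymp
  qed
  have "(\<lambda>n. - ln (Gamma (\<alpha> n + 1))) \<longlonglongrightarrow> - ln (Gamma (0 + 1))"
    by (intro tendsto_intros a0) auto
  hence "(\<lambda>n. - ln (Gamma (\<alpha> n + 1))) \<longlonglongrightarrow> 0" by simp
  moreover have "\<forall>\<^sub>F n in sequentially. - ln (Gamma (\<alpha> n + 1)) = ln (real n) - ln (real n * \<alpha> n) + 0 - ln (Gamma (\<alpha> n))"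
    using eventually_ge_at_top[of 1] by eventually_elim (use pos in \<open>simp add: ln_Gamma_plus1 ln_mult_pos\<close>)
  ultimately show "(\<lambda>n. ln (real n) - ln (real n * \<alpha> n) + 0 - ln (Gamma (\<alpha> n))) \<longlonglongrightarrow> 0"
    by (rule Lim_transform_eventually)
qed auto

section \<open>Unbounded shapes of smaller order than the logarithm\<close>

text \<open>\<open>L * xi_base a L\<close> is
  \<open>L + (a - 1) * ln L - ln (Gamma a) + stirling_rem a\<close>, that is, the centering without
  \<open>\<xi>\<close> and with the Stirling remainder restored.\<close>

definition xi_base :: "real \<Rightarrow> real \<Rightarrow> real" where
  "xi_base a L = 1 - a / L * ln (a / L) + (a - ln L) / L + 1/2 * (ln a / L)"

lemma xi_base_mult:
  assumes "a > 0" "L > 0"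
  shows "L * xi_base a L = L + (a - 1) * ln L - (a - 1/2) * ln a + a"
  unfolding xi_base_def using assms by (simp add: ln_div field_simps)

text \<open>The excess over 1, times \<open>L\<close>, is \<open>(a - 1) * ln (L / a)\<close> plus
  \<open>a - ln a / 2\<close>. The lower bound is the hypothesis of \<open>xi_equation_ex1\<close>;
  the upper one keeps the logarithm in the equation bounded.\<close>

lemma xi_base_bounds:
  assumes "1 < a" "2 * a \<le> L"
  shows "1 < xi_base a L" "xi_base a L \<le> 3"
proof -
  have L: "L > 0" "a \<le> L" using assms by auto
  have eq: "L * xi_base a L - L = (a - 1) * ln (L / a) + (a - 1/2 * ln a)"
    using assms L by (subst xi_base_mult) (auto simp: ln_div algebra_simps)
  have "0 \<le> ln (L / a)" using assms L by (intro ln_ge_zero) (auto simp: field_simps)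
  moreover have "ln a \<le> a - 1" using assms by (intro ln_le_minus_one) auto
  moreover have "0 \<le> ln a" using assms by simp
  ultimately have "0 < L * xi_base a L - L" unfolding eq using assms
    by (intro add_nonneg_pos mult_nonneg_nonneg) auto
  hence "L * 1 < L * xi_base a L" by simp
  thus "1 < xi_base a L" using L by (simp only: mult_less_cancel_left_pos)
  have "(a - 1) * ln (L / a) \<le> a * (L / a - 1)"
    using assms L \<open>0 \<le> ln (L / a)\<close> by (intro mult_mono ln_le_minus_one) auto
  also have "\<dots> = L - a" using assms by (simp add: field_simps)
  finally have "L * xi_base a L \<le> L * 3" using eq \<open>0 \<le> ln a\<close> L assms by linarith
  thus "xi_base a L \<le> 3" using L by (simp only: mult_le_cancel_left_pos)
qed

text \<open>The bound \<open>2 * \<alpha> n \<le> ln n\<close> makes the coefficient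
  \<open>k\<close> at most 1/2, so \<open>xi_equation_ex1\<close> applies. The same bound with
  \<open>ln t \<le> t - 1\<close> gives \<open>z \<le> xi_base - 1\<close>.\<close>

lemma xi_seq_properties:
  fixes \<alpha> :: "nat \<Rightarrow> real"
  assumes "1 < \<alpha> n" "2 * \<alpha> n \<le> ln (real n)"
  defines "L \<equiv> ln (real n)" and "z \<equiv> xi_seq \<alpha> n / ln (real n)"
  shows "0 < z" "z \<le> 2" "L * z = (\<alpha> n - 1) * ln (xi_base (\<alpha> n) L + z)"
proof -
  have L: "L > 0" "2 * \<alpha> n \<le> L" using assms by (auto simp: L_def)
  note B = xi_base_bounds[OF assms(1) L(2)]
  define k where "k = (\<alpha> n - 1) / L"
  have k: "0 < k" "k \<le> 1/2" using assms(1) L by (auto simp: k_def field_simps)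
  have "z = (THE z. z > 0 \<and> z = k * ln (xi_base (\<alpha> n) L + z))"
    using L unfolding z_def xi_seq_def xi_base_def k_def L_def by simp
  with theI'[OF xi_equation_ex1[OF B(1) k]]
  have z: "z > 0" "z = k * ln (xi_base (\<alpha> n) L + z)" by auto
  show "0 < z" by fact
  have "z \<le> 1/2 * (xi_base (\<alpha> n) L + z - 1)"
    using k z B by (subst z(2)) (intro mult_mono ln_le_minus_one, auto)
  thus "z \<le> 2" using B by simp
  show "L * z = (\<alpha> n - 1) * ln (xi_base (\<alpha> n) L + z)"
    using L by (subst z(2)) (simp add: k_def)
qed

text \<open>Since \<open>xi_seq \<alpha> n = (\<alpha> n - 1) * ln (Y n)\<close>, the centering
  equals \<open>ln n + (\<alpha> n - 1) * ln (L n * Y n) - ln (Gamma (\<alpha> n))\<close> exactly,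
  while also \<open>d n = L n * Y n - r n\<close> with the convergent Stirling remainder
  \<open>r\<close>. So the defect in the fixed point equation is
  \<open>(\<alpha> n - 1) * ln (1 + v n)\<close> with \<open>v n = (x - r n) / (L n * Y n)\<close>,
  which vanishes because \<open>\<alpha> n / L n\<close> does.\<close>

lemma gumbel_case_sublogarithmic_shape:
  fixes M :: "nat \<Rightarrow> 'a measure"
  assumes pos: "\<And>n. n \<ge> 1 \<Longrightarrow> \<alpha> n > 0" "\<And>n. n \<ge> 1 \<Longrightarrow> \<beta> n > 0"
    and prob: "\<And>n. n \<ge> 1 \<Longrightarrow> prob_space (M n)"
    and dir: "\<And>n. n \<ge> 1 \<Longrightarrow> has_dirichlet (M n) n (X n) (\<alpha> n) (\<beta> n)"
    and o: "(\<lambda>n. \<alpha> n / ln (real n)) \<longlonglongrightarrow> 0" and \<alpha>: "filterlim \<alpha> at_top sequentially"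
  shows "conv_in_distr M (normalized_max \<alpha> \<beta> X
      (\<lambda>n. ln (real n) + (\<alpha> n - 1) * ln (ln (real n)) - ln (Gamma (\<alpha> n)) + xi_seq \<alpha> n) (\<lambda>n. 1)) gumbel_cdf"
proof -
  define L where "L n = ln (real n)" for n :: nat
  define z where "z n = xi_seq \<alpha> n / L n" for n
  define Y where "Y n = xi_base (\<alpha> n) (L n) + z n" for n
  define r where "r n = stirling_rem (\<alpha> n)" for n
  define d where "d n = L n + (\<alpha> n - 1) * ln (L n) - ln (Gamma (\<alpha> n)) + xi_seq \<alpha> n" for n
  have Ltop: "filterlim L at_top sequentially" unfolding L_def by real_asymp
  have iL: "(\<lambda>n. 1 / L n) \<longlonglongrightarrow> 0" unfolding L_def by real_asymp
  have r: "r \<longlonglongrightarrow> ln (2 * pi) / 2" unfolding r_def by (rule filterlim_compose[OF stirling_rem_tendsto \<alpha>])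
  have rL: "(\<lambda>n. (x - r n) * (1 / L n)) \<longlonglongrightarrow> 0" for x
    using tendsto_mult[OF tendsto_diff[OF tendsto_const[of x] r] iL] by simp
  have ra: "(\<lambda>n. (x - r n) * (\<alpha> n / L n)) \<longlonglongrightarrow> 0" for x
    using tendsto_mult[OF tendsto_diff[OF tendsto_const[of x] r] o] by (simp add: L_def)
  have "\<forall>\<^sub>F n in sequentially. \<alpha> n / ln (real n) < 1/2" using o by (rule order_tendstoD) simp
  moreover have "\<forall>\<^sub>F n in sequentially. 1 < \<alpha> n" using \<alpha> by (simp add: filterlim_at_top_dense)
  ultimately have ev: "\<forall>\<^sub>F n in sequentially. 1 < \<alpha> n \<and> 2 * \<alpha> n \<le> L n \<and> 0 < L n"
    using eventually_gt_at_top[of 1] by eventually_elim (auto simp: field_simps L_def)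
  have evY: "\<forall>\<^sub>F n in sequentially. 1 < Y n \<and> Y n \<le> 5 \<and> L n * z n = (\<alpha> n - 1) * ln (Y n)"
    using ev
  proof eventually_elim
    case (elim n)
    hence "1 < \<alpha> n" "2 * \<alpha> n \<le> ln (real n)" by (auto simp: L_def)
    from xi_seq_properties[where \<alpha> = \<alpha>, OF this] xi_base_bounds[OF this]
    show ?case by (auto simp: Y_def z_def L_def)
  qed
  have d: "\<forall>\<^sub>F n in sequentially. d n = L n * Y n - r n"
    using ev
  proof eventually_elim
    case (elim n)
    have "L n * Y n = L n * xi_base (\<alpha> n) (L n) + xi_seq \<alpha> n"
      using elim by (simp add: Y_def z_def algebra_simps)
    also have "L n * xi_base (\<alpha> n) (L n) = L n + (\<alpha> n - 1) * ln (L n) - (\<alpha> n - 1/2) * ln (\<alpha> n) + \<alpha> n"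
      using elim by (intro xi_base_mult) auto
    finally show ?case by (simp add: d_def r_def stirling_rem_def)
  qed
  have "\<forall>\<^sub>F n in sequentially. \<bar>(0 - r n) * (1 / L n)\<bar> < 1/2"
    using tendsto_rabs_zero[OF rL[of 0]] by (rule order_tendstoD) simp
  hence dbd: "\<forall>\<^sub>F n in sequentially. L n / 2 \<le> d n \<and> d n \<le> 6 * L n"
    using d evY ev
  proof eventually_elim
    case (elim n)
    have rn: "\<bar>r n\<bar> < L n / 2" using elim by (simp add: abs_mult field_simps)
    have "L n * 1 \<le> L n * Y n" "L n * Y n \<le> L n * 5" using elim by (auto intro!: mult_left_mono)
    thus ?case using rn elim by linarith
  qed
  have "conv_in_distr M (normalized_max \<alpha> \<beta> X d (\<lambda>n. 1)) gumbel_cdf"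
  proof (rule conv_in_distr_gumbel_small_shape[OF pos prob dir])
    have "filterlim (\<lambda>n. L n / 2) at_top sequentially" unfolding L_def by real_asymp
    thus "filterlim d at_top sequentially"
      by (rule filterlim_at_top_mono) (use dbd in \<open>auto elim: eventually_mono\<close>)
    show "(\<lambda>n. \<alpha> n / d n) \<longlonglongrightarrow> 0"
    proof (rule Lim_null_comparison)
      show "(\<lambda>n. 2 * (\<alpha> n / L n)) \<longlonglongrightarrow> 0"
        using tendsto_mult[OF tendsto_const[of 2] o] by (simp add: L_def)
      show "\<forall>\<^sub>F n in sequentially. norm (\<alpha> n / d n) \<le> 2 * (\<alpha> n / L n)"
        using dbd ev
      proof eventually_elim
        case (elim n)
        have "\<alpha> n / d n \<le> \<alpha> n / (L n / 2)" using elim by (intro divide_left_mono mult_pos_pos) auto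
        thus ?case using elim by (simp add: mult.commute)
      qed
    qed
    show "(\<lambda>n. d n / sqrt (real n * \<alpha> n)) \<longlonglongrightarrow> 0"
    proof (rule Lim_null_comparison)
      show "(\<lambda>n. 6 * L n / sqrt (real n)) \<longlonglongrightarrow> 0" unfolding L_def by real_asymp
      show "\<forall>\<^sub>F n in sequentially. norm (d n / sqrt (real n * \<alpha> n)) \<le> 6 * L n / sqrt (real n)"
        using dbd ev eventually_gt_at_top[of 0]
      proof eventually_elim
        case (elim n)
        have "d n / sqrt (real n * \<alpha> n) \<le> 6 * L n / sqrt (real n)"
          using elim by (intro frac_le) auto
        thus ?case using elim by simp
      qed
    qed
    fix x
    define v where "v n = (x - r n) / (L n * Y n)" for n
    have v: "v \<longlonglongrightarrow> 0"
    proof (rule Lim_null_comparison[OF _ tendsto_rabs_zero[OF rL[of x]]])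
      show "\<forall>\<^sub>F n in sequentially. norm (v n) \<le> \<bar>(x - r n) * (1 / L n)\<bar>"
        using ev evY by eventually_elim (auto simp: v_def abs_mult intro!: divide_left_mono mult_pos_pos)
    qed
    have av: "(\<lambda>n. (\<alpha> n - 1) * v n) \<longlonglongrightarrow> 0"
    proof (rule Lim_null_comparison[OF _ tendsto_rabs_zero[OF ra[of x]]])
      show "\<forall>\<^sub>F n in sequentially. norm ((\<alpha> n - 1) * v n) \<le> \<bar>(x - r n) * (\<alpha> n / L n)\<bar>"
        using ev evY
      proof eventually_elim
        case (elim n)
        have "(\<alpha> n - 1) * (\<bar>x - r n\<bar> / (L n * Y n)) \<le> \<alpha> n * (\<bar>x - r n\<bar> / L n)"
          using elim by (intro mult_mono divide_left_mono mult_pos_pos) auto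
        thus ?case using elim by (simp add: v_def abs_mult mult.commute)
      qed
    qed
    have "\<forall>\<^sub>F n in sequentially. v n > -1" using v by (rule order_tendstoD) simp
    hence "\<forall>\<^sub>F n in sequentially. (\<alpha> n - 1) * ln (1 + v n) =
        ln (real n) + (\<alpha> n - 1) * ln (d n + x) - d n - ln (Gamma (\<alpha> n))"
      using ev evY d
    proof eventually_elim
      case (elim n)
      have "L n * Y n * (1 + v n) = L n * Y n + (x - r n)"
        unfolding distrib_left using elim by (simp add: v_def)
      hence "d n + x = L n * Y n * (1 + v n)" using elim by simp
      also have "ln \<dots> = ln (L n) + ln (Y n) + ln (1 + v n)"
        using elim by (simp add: ln_mult_pos)
      finally have ld: "ln (d n + x) = ln (L n) + ln (Y n) + ln (1 + v n)" .
      have "xi_seq \<alpha> n = (\<alpha> n - 1) * ln (Y n)" using elim by (simp add: z_def)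
      thus ?case unfolding ld by (simp add: d_def L_def[symmetric] algebra_simps)
    qed
    with mult_ln_one_plus_tendsto[OF v av]
    show "(\<lambda>n. ln (real n) + (\<alpha> n - 1) * ln (d n + x) - d n - ln (Gamma (\<alpha> n))) \<longlonglongrightarrow> 0"
      by (rule Lim_transform_eventually)
  qed auto
  thus ?thesis by (simp add: d_def[abs_def] L_def)
qed

section \<open>Shapes of larger order than the logarithm\<close>

text \<open>With \<open>w n = b n * sqrt (\<alpha> n)\<close>, the equation for \<open>b\<close>
  reduces every term of the exponent condition except the linear one to
  \<open>ln (2 * pi) / 2\<close>. The decay rate times \<open>c n\<close> is
  \<open>b n / sqrt (2 * L n)\<close> divided by \<open>1 + b n / sqrt (\<alpha> n)\<close>, hence
  tends to 1, and \<open>\<alpha> n / (w n)^2 = 1 / (b n)^2\<close> tends to 0.\<close>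

lemma gumbel_case_superlogarithmic_shape:
  fixes M :: "nat \<Rightarrow> 'a measure"
  assumes pos: "\<And>n. n \<ge> 1 \<Longrightarrow> \<alpha> n > 0" "\<And>n. n \<ge> 1 \<Longrightarrow> \<beta> n > 0"
    and prob: "\<And>n. n \<ge> 1 \<Longrightarrow> prob_space (M n)"
    and dir: "\<And>n. n \<ge> 1 \<Longrightarrow> has_dirichlet (M n) n (X n) (\<alpha> n) (\<beta> n)"
    and o: "(\<lambda>n. ln (real n)) \<in> o(\<alpha>)"
  shows "conv_in_distr M (normalized_max \<alpha> \<beta> X (\<lambda>n. \<alpha> n + b_seq \<alpha> n * sqrt (\<alpha> n))
           (\<lambda>n. sqrt (\<alpha> n / (2 * ln (real n))))) gumbel_cdf"
proof -
  define L where "L n = ln (real n)" for n :: nat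
  define b where "b = b_seq \<alpha>"
  define c where "c n = sqrt (\<alpha> n / (2 * L n))" for n
  have o': "(\<lambda>n. L n / \<alpha> n) \<longlonglongrightarrow> 0" using o unfolding L_def by (rule smalloD_tendsto)
  have b1: "\<forall>\<^sub>F n in sequentially. b_fun (\<alpha> n) (b n) = L n"
    and b2: "(\<lambda>n. b n / sqrt (2 * L n)) \<longlonglongrightarrow> 1"
    using b_seq_properties[of \<alpha>] pos(1) o' unfolding L_def b_def by auto
  have ev: "\<forall>\<^sub>F n in sequentially. \<alpha> n > 0 \<and> L n > 0"
    using eventually_gt_at_top[of 1] by eventually_elim (auto simp: L_def pos)
  have i2L: "(\<lambda>n. 1 / sqrt (2 * L n)) \<longlonglongrightarrow> 0" unfolding L_def by real_asymp
  have \<alpha>: "filterlim \<alpha> at_top sequentially"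
  proof (rule filterlim_at_top_mono)
    show "filterlim L at_top sequentially" unfolding L_def by real_asymp
    have "\<forall>\<^sub>F n in sequentially. L n / \<alpha> n < 1" using o' by (rule order_tendstoD) simp
    thus "\<forall>\<^sub>F n in sequentially. L n \<le> \<alpha> n" using ev by eventually_elim (simp add: divide_less_eq)
  qed
  have evb: "\<forall>\<^sub>F n in sequentially. b n > 0"
    using order_tendstoD(1)[OF b2 zero_less_one] ev
    by eventually_elim (auto simp: zero_less_divide_iff)
  have ib: "(\<lambda>n. 1 / b n) \<longlonglongrightarrow> 0"
  proof -
    have "(\<lambda>n. (1 / sqrt (2 * L n)) / (b n / sqrt (2 * L n))) \<longlonglongrightarrow> 0"
      using tendsto_divide[OF i2L b2] by simp
    moreover have "\<forall>\<^sub>F n in sequentially. (1 / sqrt (2 * L n)) / (b n / sqrt (2 * L n)) = 1 / b n"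
      using ev evb by eventually_elim simp
    ultimately show ?thesis by (rule Lim_transform_eventually)
  qed
  have u: "(\<lambda>n. b n / sqrt (\<alpha> n)) \<longlonglongrightarrow> 0"
  proof -
    have "(\<lambda>n. (b n / sqrt (2 * L n)) * sqrt (2 * (L n / \<alpha> n))) \<longlonglongrightarrow> 0"
      using tendsto_mult[OF b2 tendsto_real_sqrt[OF tendsto_mult[OF tendsto_const[of 2] o']]] by simp
    moreover have "\<forall>\<^sub>F n in sequentially. (b n / sqrt (2 * L n)) * sqrt (2 * (L n / \<alpha> n)) = b n / sqrt (\<alpha> n)"
      using ev by eventually_elim (simp add: real_sqrt_divide real_sqrt_mult)
    ultimately show ?thesis by (rule Lim_transform_eventually)
  qed
  have "conv_in_distr M (normalized_max \<alpha> \<beta> X (\<lambda>n. \<alpha> n + b n * sqrt (\<alpha> n)) c) gumbel_cdf"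
  proof (rule conv_in_distr_gumbel_large_shape[OF pos prob dir \<alpha>, where w = "\<lambda>n. b n * sqrt (\<alpha> n)" and s = "\<lambda>x n. c n * x"])
    show "\<forall>\<^sub>F n in sequentially. b n * sqrt (\<alpha> n) > 0"
      using ev evb by eventually_elim simp
    show "\<forall>\<^sub>F n in sequentially. c n > 0"
      using ev by eventually_elim (simp add: c_def)
    have "(\<lambda>n. (1 / b n)\<^sup>2) \<longlonglongrightarrow> 0" using tendsto_power[OF ib, of 2] by simp
    moreover have "\<forall>\<^sub>F n in sequentially. (1 / b n)\<^sup>2 = \<alpha> n / (b n * sqrt (\<alpha> n))\<^sup>2"
      using ev evb by eventually_elim (simp add: power_mult_distrib power_divide)
    ultimately show "(\<lambda>n. \<alpha> n / (b n * sqrt (\<alpha> n))\<^sup>2) \<longlonglongrightarrow> 0" by (rule Lim_transform_eventually)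
    fix x
    have "(\<lambda>n. x * (1 / sqrt (2 * L n)) * (1 / b n)) \<longlonglongrightarrow> 0"
      using tendsto_mult[OF tendsto_mult[OF tendsto_const[of x] i2L] ib] by simp
    moreover have "\<forall>\<^sub>F n in sequentially. x * (1 / sqrt (2 * L n)) * (1 / b n) = c n * x / (b n * sqrt (\<alpha> n))"
      using ev evb by eventually_elim (simp add: c_def real_sqrt_divide field_simps)
    ultimately show "(\<lambda>n. c n * x / (b n * sqrt (\<alpha> n))) \<longlonglongrightarrow> 0" by (rule Lim_transform_eventually)
    have "(\<lambda>n. (x * (1 / sqrt (2 * L n)))\<^sup>2) \<longlonglongrightarrow> 0"
      using tendsto_power[OF tendsto_mult[OF tendsto_const[of x] i2L], of 2] by simp
    moreover have "\<forall>\<^sub>F n in sequentially. (x * (1 / sqrt (2 * L n)))\<^sup>2 = (c n * x)\<^sup>2 / \<alpha> n"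
      using ev by eventually_elim (simp add: c_def power_mult_distrib power_divide)
    ultimately show "(\<lambda>n. (c n * x)\<^sup>2 / \<alpha> n) \<longlonglongrightarrow> 0" by (rule Lim_transform_eventually)
    have "(\<lambda>n. ln (2 * pi) / 2 - (b n / sqrt (2 * L n)) * x / (1 + b n / sqrt (\<alpha> n))) \<longlonglongrightarrow> ln (2 * pi) / 2 - x"
      using tendsto_diff[OF tendsto_const[of "ln (2 * pi) / 2"]
          tendsto_divide[OF tendsto_mult[OF b2 tendsto_const[of x]] tendsto_add[OF tendsto_const[of 1] u]]] by simp
    moreover have "\<forall>\<^sub>F n in sequentially. ln (2 * pi) / 2 - (b n / sqrt (2 * L n)) * x / (1 + b n / sqrt (\<alpha> n)) =
        ln (real n) + ln (\<alpha> n) / 2 + \<alpha> n * ln (1 + b n * sqrt (\<alpha> n) / \<alpha> n) - b n * sqrt (\<alpha> n) -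
           ln (b n * sqrt (\<alpha> n)) - b n * sqrt (\<alpha> n) / (\<alpha> n + b n * sqrt (\<alpha> n)) * (c n * x)"
      using ev evb b1
    proof eventually_elim
      case (elim n)
      have sq: "sqrt (\<alpha> n) * sqrt (\<alpha> n) = \<alpha> n" using elim by simp
      have w: "b n * sqrt (\<alpha> n) / \<alpha> n = b n / sqrt (\<alpha> n)"
        using elim sq by (simp add: field_simps)
      have l: "ln (b n * sqrt (\<alpha> n)) = ln (b n) + ln (\<alpha> n) / 2"
        using elim by (simp add: ln_mult_pos ln_sqrt)
      have "\<alpha> n + b n * sqrt (\<alpha> n) = \<alpha> n * (1 + b n / sqrt (\<alpha> n))"
        unfolding w[symmetric] using elim by (simp add: field_simps)
      hence "b n * sqrt (\<alpha> n) / (\<alpha> n + b n * sqrt (\<alpha> n)) = b n / sqrt (\<alpha> n) / (1 + b n / sqrt (\<alpha> n))"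
        by (simp add: w[symmetric])
      moreover have "b n / sqrt (\<alpha> n) * c n = b n / sqrt (2 * L n)"
        using elim by (simp add: c_def real_sqrt_divide)
      ultimately have k: "b n * sqrt (\<alpha> n) / (\<alpha> n + b n * sqrt (\<alpha> n)) * (c n * x) = (b n / sqrt (2 * L n)) * x / (1 + b n / sqrt (\<alpha> n))"
        by (metis (no_types, lifting) mult.assoc times_divide_eq_left)
      show ?case using elim(3) unfolding k l w b_fun_def L_def by simp
    qed
    ultimately show "(\<lambda>n. ln (real n) + ln (\<alpha> n) / 2 + \<alpha> n * ln (1 + b n * sqrt (\<alpha> n) / \<alpha> n) - b n * sqrt (\<alpha> n) -
           ln (b n * sqrt (\<alpha> n)) - b n * sqrt (\<alpha> n) / (\<alpha> n + b n * sqrt (\<alpha> n)) * (c n * x)) \<longlonglongrightarrow> ln (2 * pi) / 2 - x"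
      by (rule Lim_transform_eventually)
  next
    have "(\<lambda>n. sqrt (2 * L n) / sqrt (real n)) \<longlonglongrightarrow> 0" unfolding L_def by real_asymp
    from tendsto_mult[OF tendsto_add[OF tendsto_const[of 1] u] this]
    have "(\<lambda>n. (1 + b n / sqrt (\<alpha> n)) * (sqrt (2 * L n) / sqrt (real n))) \<longlonglongrightarrow> 0" by simp
    moreover have "\<forall>\<^sub>F n in sequentially. (1 + b n / sqrt (\<alpha> n)) * (sqrt (2 * L n) / sqrt (real n)) =
        (\<alpha> n + b n * sqrt (\<alpha> n)) / (c n * sqrt (real n * \<alpha> n))"
      using ev eventually_gt_at_top[of 0]
    proof eventually_elim
      case (elim n)
      have sq: "sqrt (\<alpha> n) * sqrt (\<alpha> n) = \<alpha> n" using elim by simp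
      have "c n * sqrt (real n * \<alpha> n) = \<alpha> n * sqrt (real n) / sqrt (2 * L n)"
        using sq by (simp add: c_def real_sqrt_divide real_sqrt_mult algebra_simps)
      moreover have "\<alpha> n + b n * sqrt (\<alpha> n) = \<alpha> n * (1 + b n / sqrt (\<alpha> n))"
        using elim sq by (simp add: field_simps)
      ultimately show ?case using elim by simp
    qed
    ultimately show "(\<lambda>n. (\<alpha> n + b n * sqrt (\<alpha> n)) / (c n * sqrt (real n * \<alpha> n))) \<longlonglongrightarrow> 0"
      by (rule Lim_transform_eventually)
  qed auto
  thus ?thesis by (simp add: c_def[abs_def] L_def b_def)
qed

section \<open>Shapes of the order of the logarithm\<close>

text \<open>The last equation, the defining one multiplied by the shape, says that n times the Gamma
  density at \<open>\<zeta>\<close>, with Gamma in Stirling's form, equals 1. The upper bound on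
  \<open>z\<close> follows from \<open>ln z \<le> z / 2\<close>.\<close>

lemma zeta_seq_properties:
  fixes \<alpha> :: "nat \<Rightarrow> real"
  defines "\<rho> \<equiv> \<lambda>n. ln (real n) / \<alpha> n - (ln (sqrt (2 * pi)) + 1/2 * ln (\<alpha> n)) / \<alpha> n"
  assumes "1 \<le> \<alpha> n" "0 < \<rho> n"
  defines "z \<equiv> zeta_seq \<alpha> n / \<alpha> n"
  shows "1 + \<rho> n \<le> z" "z \<le> 2 + 2 * \<rho> n"
    and "\<alpha> n * z = \<alpha> n + ln (real n) - ln (2 * pi) / 2 - ln (\<alpha> n) / 2 + (\<alpha> n - 1) * ln z"
proof -
  define k where "k = 1 - 1 / \<alpha> n"
  have k: "0 \<le> k" "k \<le> 1" using assms by (auto simp: k_def)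
  have "z = (THE z. z > 1 \<and> z = 1 + \<rho> n + k * ln z)"
    using assms(2) unfolding z_def zeta_seq_def \<rho>_def k_def by (simp add: add_diff_eq)
  with theI'[OF zeta_equation_ex1[OF assms(3) k]]
  have z: "z > 1" "z = 1 + \<rho> n + k * ln z" by auto
  have "0 \<le> k * ln z" using k z by auto
  thus "1 + \<rho> n \<le> z" using z(2) by linarith
  have "k * ln z \<le> 1 * (z / 2)" using k z by (intro mult_mono ln_le_half) auto
  thus "z \<le> 2 + 2 * \<rho> n" using z(2) by linarith
  have "\<alpha> n * z = \<alpha> n * (1 + \<rho> n + k * ln z)" using z(2) by simp
  also have "\<dots> = \<alpha> n + \<alpha> n * \<rho> n + (\<alpha> n * k) * ln z" by (simp add: algebra_simps)
  also have "\<alpha> n * k = \<alpha> n - 1" using assms(2) by (simp add: k_def field_simps)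
  also have "\<alpha> n * \<rho> n = ln (real n) - (ln (2 * pi) / 2 + ln (\<alpha> n) / 2)"
    using assms(2) by (simp add: \<rho>_def ln_sqrt field_simps)
  finally show "\<alpha> n * z = \<alpha> n + ln (real n) - ln (2 * pi) / 2 - ln (\<alpha> n) / 2 + (\<alpha> n - 1) * ln z"
    by simp
qed

text \<open>At \<open>\<zeta> + s\<close> the scaled tail is about
  \<open>exp (- \<kappa> * s) / \<kappa>\<close>, where
  \<open>\<kappa> = 1 - \<alpha> n / \<zeta>\<close>. The choice
  \<open>s = (x - ln \<kappa>) / \<kappa>\<close> turns this into \<open>exp (- x)\<close>, which
  explains both the logarithmic term of the centering and the scale. The two-sided bound on
  \<open>\<alpha> n / ln n\<close> keeps \<open>\<kappa>\<close> away from 0, so \<open>s\<close>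
  stays bounded while \<open>w\<close> grows.\<close>

lemma gumbel_case_logarithmic_shape:
  fixes M :: "nat \<Rightarrow> 'a measure"
  assumes pos: "\<And>n. n \<ge> 1 \<Longrightarrow> \<alpha> n > 0" "\<And>n. n \<ge> 1 \<Longrightarrow> \<beta> n > 0"
    and prob: "\<And>n. n \<ge> 1 \<Longrightarrow> prob_space (M n)"
    and dir: "\<And>n. n \<ge> 1 \<Longrightarrow> has_dirichlet (M n) n (X n) (\<alpha> n) (\<beta> n)"
    and c0: "c0 > 0" and C0: "\<forall>\<^sub>F n in sequentially. c0 \<le> \<alpha> n / ln (real n) \<and> \<alpha> n / ln (real n) \<le> C0"
  shows "conv_in_distr M (normalized_max \<alpha> \<beta> X
           (\<lambda>n. zeta_seq \<alpha> n - inverse (1 - \<alpha> n / zeta_seq \<alpha> n) * ln (1 - \<alpha> n / zeta_seq \<alpha> n))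
           (\<lambda>n. inverse (1 - \<alpha> n / zeta_seq \<alpha> n))) gumbel_cdf"
proof -
  define L where "L n = ln (real n)" for n :: nat
  define \<rho> where "\<rho> n = L n / \<alpha> n - (ln (sqrt (2 * pi)) + 1/2 * ln (\<alpha> n)) / \<alpha> n" for n
  define z where "z n = zeta_seq \<alpha> n / \<alpha> n" for n
  define w where "w n = zeta_seq \<alpha> n - \<alpha> n" for n
  define \<kappa> where "\<kappa> n = 1 - \<alpha> n / zeta_seq \<alpha> n" for n
  have Ltop: "filterlim L at_top sequentially" unfolding L_def by real_asymp
  have evL: "\<forall>\<^sub>F n in sequentially. L n > 0" using Ltop by (simp add: filterlim_at_top_dense)
  have bounds: "\<forall>\<^sub>F n in sequentially. c0 * L n \<le> \<alpha> n \<and> \<alpha> n \<le> C0 * L n"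
    using C0 evL by eventually_elim (auto simp: L_def field_simps)
  have \<alpha>: "filterlim \<alpha> at_top sequentially"
  proof (rule filterlim_at_top_mono)
    show "filterlim (\<lambda>n. c0 * L n) at_top sequentially"
      using c0 by (intro filterlim_tendsto_pos_mult_at_top[OF tendsto_const _ Ltop])
    show "\<forall>\<^sub>F n in sequentially. c0 * L n \<le> \<alpha> n" using bounds by eventually_elim simp
  qed
  have i\<alpha>: "(\<lambda>n. 1 / \<alpha> n) \<longlonglongrightarrow> 0"
    using tendsto_inverse_0_at_top[OF \<alpha>] by (simp add: divide_inverse)
  have ev1: "\<forall>\<^sub>F n in sequentially. \<alpha> n \<ge> 1" using \<alpha> by (simp add: filterlim_at_top)
  have C0pos: "C0 > 0"
  proof -
    have "\<forall>\<^sub>F n in sequentially. 0 < C0"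
      using C0 by eventually_elim (use c0 in linarith)
    thus ?thesis by simp
  qed
  \<comment> \<open>\<open>L n / \<alpha> n\<close> is at least \<open>1 / C0 = 2 * \<rho>0\<close>;
    half of it is given up to the Stirling correction, which tends to 0.\<close>
  define \<rho>0 where "\<rho>0 = 1 / (2 * C0)"
  define \<rho>1 where "\<rho>1 = 1 / c0"
  have \<rho>0: "\<rho>0 > 0" using C0pos by (simp add: \<rho>0_def)
  have "(\<lambda>n. (ln (sqrt (2 * pi)) + 1/2 * ln (\<alpha> n)) / \<alpha> n) \<longlonglongrightarrow> 0"
  proof (rule filterlim_compose[OF _ \<alpha>])
    show "((\<lambda>x::real. (ln (sqrt (2 * pi)) + 1/2 * ln x) / x) \<longlongrightarrow> 0) at_top" by real_asymp
  qed
  hence "\<forall>\<^sub>F n in sequentially. (ln (sqrt (2 * pi)) + 1/2 * ln (\<alpha> n)) / \<alpha> n < \<rho>0"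
    using \<rho>0 by (rule order_tendstoD)
  hence ev\<rho>: "\<forall>\<^sub>F n in sequentially. \<rho>0 \<le> \<rho> n \<and> \<rho> n \<le> \<rho>1"
    using bounds evL ev1
  proof eventually_elim
    case (elim n)
    have "1 / C0 \<le> L n / \<alpha> n" "L n / \<alpha> n \<le> 1 / c0"
      using elim c0 C0pos by (auto simp: field_simps)
    moreover have "1 / C0 = 2 * \<rho>0" by (simp add: \<rho>0_def)
    moreover have "0 \<le> (ln (sqrt (2 * pi)) + 1/2 * ln (\<alpha> n)) / \<alpha> n"
    proof -
      have "1 \<le> 2 * pi" using pi_gt3 by linarith
      thus ?thesis using elim by (intro divide_nonneg_nonneg add_nonneg_nonneg ln_ge_zero mult_nonneg_nonneg) auto
    qed
    ultimately show ?case using elim unfolding \<rho>_def \<rho>1_def by linarith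
  qed
  have evz: "\<forall>\<^sub>F n in sequentially. 1 + \<rho>0 \<le> z n \<and> z n \<le> 2 + 2 * \<rho>1 \<and>
      \<alpha> n * z n = \<alpha> n + L n - ln (2 * pi) / 2 - ln (\<alpha> n) / 2 + (\<alpha> n - 1) * ln (z n)"
    using ev\<rho> ev1
  proof eventually_elim
    case (elim n)
    have "0 < \<rho> n" using elim \<rho>0 by linarith
    note zeta_seq_properties[where \<alpha> = \<alpha> and n = n, OF elim(2) this[unfolded \<rho>_def L_def]]
    hence "1 + \<rho> n \<le> z n" "z n \<le> 2 + 2 * \<rho> n"
      "\<alpha> n * z n = \<alpha> n + L n - ln (2 * pi) / 2 - ln (\<alpha> n) / 2 + (\<alpha> n - 1) * ln (z n)"
      unfolding z_def \<rho>_def L_def by blast+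
    thus ?case using elim(1) by auto
  qed
  have wk: "\<forall>\<^sub>F n in sequentially. w n = \<alpha> n * (z n - 1) \<and> \<kappa> n = w n / (\<alpha> n + w n) \<and> \<kappa> n = 1 - 1 / z n \<and> \<alpha> n + w n = \<alpha> n * z n"
    using evz ev1
  proof eventually_elim
    case (elim n)
    have "zeta_seq \<alpha> n = \<alpha> n * z n" using elim by (simp add: z_def)
    moreover have "z n > 0" "\<alpha> n > 0" using elim \<rho>0 by linarith+
    ultimately show ?case by (simp add: w_def \<kappa>_def field_simps)
  qed
  define \<kappa>0 where "\<kappa>0 = 1 - 1 / (1 + \<rho>0)"
  have \<kappa>0: "\<kappa>0 > 0" using \<rho>0 by (simp add: \<kappa>0_def)
  have ev\<kappa>: "\<forall>\<^sub>F n in sequentially. \<kappa>0 \<le> \<kappa> n \<and> \<kappa> n \<le> 1 \<and> \<alpha> n * \<rho>0 \<le> w n"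
    using evz wk ev1
  proof eventually_elim
    case (elim n)
    have "1 / z n \<le> 1 / (1 + \<rho>0)" using elim \<rho>0 by (intro divide_left_mono mult_pos_pos) auto
    moreover have "0 \<le> 1 / z n" using elim \<rho>0 by simp
    moreover have "\<alpha> n * \<rho>0 \<le> \<alpha> n * (z n - 1)" using elim by (intro mult_left_mono) auto
    moreover have "\<kappa> n = 1 - 1 / z n" "w n = \<alpha> n * (z n - 1)" using elim by auto
    ultimately show ?case unfolding \<kappa>0_def by linarith
  qed
  have ev\<alpha>\<rho>: "\<forall>\<^sub>F n in sequentially. 0 < \<alpha> n * \<rho>0"
    using ev1 by eventually_elim (simp add: \<rho>0)
  define s where "s x n = (x - ln (\<kappa> n)) / \<kappa> n" for x n
  have sbd: "\<forall>\<^sub>F n in sequentially. \<bar>s x n\<bar> \<le> (\<bar>x\<bar> + \<bar>ln \<kappa>0\<bar>) / \<kappa>0" for x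
    using ev\<kappa>
  proof eventually_elim
    case (elim n)
    have "ln \<kappa>0 \<le> ln (\<kappa> n)" "ln (\<kappa> n) \<le> 0" using elim \<kappa>0 by auto
    hence "\<bar>x - ln (\<kappa> n)\<bar> \<le> \<bar>x\<bar> + \<bar>ln \<kappa>0\<bar>" by linarith
    hence "\<bar>x - ln (\<kappa> n)\<bar> / \<kappa> n \<le> (\<bar>x\<bar> + \<bar>ln \<kappa>0\<bar>) / \<kappa>0"
      using elim \<kappa>0 by (intro frac_le) auto
    thus ?case using elim \<kappa>0 by (simp add: s_def)
  qed
  have i\<alpha>\<rho>: "(\<lambda>n. 1 / (\<alpha> n * \<rho>0)) \<longlonglongrightarrow> 0"
    using tendsto_mult[OF i\<alpha> tendsto_const[of "1 / \<rho>0"]] by simp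
  have iw: "(\<lambda>n. 1 / w n) \<longlonglongrightarrow> 0"
  proof (rule Lim_null_comparison[OF _ i\<alpha>\<rho>])
    show "\<forall>\<^sub>F n in sequentially. norm (1 / w n) \<le> 1 / (\<alpha> n * \<rho>0)"
      using ev\<kappa> ev\<alpha>\<rho> by eventually_elim (auto intro!: divide_left_mono mult_pos_pos)
  qed
  have "conv_in_distr M (normalized_max \<alpha> \<beta> X
      (\<lambda>n. zeta_seq \<alpha> n - inverse (\<kappa> n) * ln (\<kappa> n)) (\<lambda>n. inverse (\<kappa> n))) gumbel_cdf"
  proof (rule conv_in_distr_gumbel_large_shape[OF pos prob dir \<alpha>, where w = w and s = s])
    show "\<forall>\<^sub>F n in sequentially. w n > 0"
      using ev\<kappa> ev\<alpha>\<rho> by eventually_elim linarith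
    show "\<forall>\<^sub>F n in sequentially. inverse (\<kappa> n) > 0"
      using ev\<kappa> by eventually_elim (use \<kappa>0 in auto)
    show "(\<lambda>n. \<alpha> n / (w n)\<^sup>2) \<longlonglongrightarrow> 0"
    proof (rule Lim_null_comparison)
      show "(\<lambda>n. 1 / \<alpha> n * (1 / \<rho>0\<^sup>2)) \<longlonglongrightarrow> 0"
        using tendsto_mult[OF i\<alpha> tendsto_const[of "1 / \<rho>0\<^sup>2"]] by simp
      show "\<forall>\<^sub>F n in sequentially. norm (\<alpha> n / (w n)\<^sup>2) \<le> 1 / \<alpha> n * (1 / \<rho>0\<^sup>2)"
        using ev\<kappa> ev\<alpha>\<rho> ev1
      proof eventually_elim
        case (elim n)
        have "\<alpha> n / (w n)\<^sup>2 \<le> \<alpha> n / (\<alpha> n * \<rho>0)\<^sup>2"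
          using elim \<rho>0 less_le_trans[OF elim(2), of "w n"]
          by (intro divide_left_mono power_mono mult_pos_pos zero_less_power) auto
        also have "\<dots> = 1 / \<alpha> n * (1 / \<rho>0\<^sup>2)" using elim by (simp add: power2_eq_square)
        finally show ?case using elim by simp
      qed
    qed
    fix x n
    show "s x n = zeta_seq \<alpha> n - inverse (\<kappa> n) * ln (\<kappa> n) + inverse (\<kappa> n) * x - (\<alpha> n + w n)"
      by (simp add: s_def w_def divide_inverse algebra_simps)
  next
    fix x
    show "(\<lambda>n. s x n / w n) \<longlonglongrightarrow> 0"
      using lim_null_mult_left_bounded[OF _ iw, of "s x"] sbd[of x] by simp
    have "(\<lambda>n. (s x n)\<^sup>2 * (1 / \<alpha> n)) \<longlonglongrightarrow> 0"
    proof (rule lim_null_mult_left_bounded[OF _ i\<alpha>])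
      show "\<forall>\<^sub>F n in sequentially. norm ((s x n)\<^sup>2) \<le> ((\<bar>x\<bar> + \<bar>ln \<kappa>0\<bar>) / \<kappa>0)\<^sup>2"
        using sbd[of x]
      proof eventually_elim
        case (elim n)
        from power_mono[OF elim abs_ge_zero, of 2] show ?case by simp
      qed
    qed
    thus "(\<lambda>n. (s x n)\<^sup>2 / \<alpha> n) \<longlonglongrightarrow> 0" by simp
    \<comment> \<open>The exponent condition holds here with equality for all large n.\<close>
    have "\<forall>\<^sub>F n in sequentially. ln (2 * pi) / 2 - x = ln (real n) + ln (\<alpha> n) / 2 + \<alpha> n * ln (1 + w n / \<alpha> n) - w n - ln (w n)
         - w n / (\<alpha> n + w n) * s x n"
      using ev\<kappa> ev\<alpha>\<rho> evz wk ev1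
    proof eventually_elim
      case (elim n)
      have z0: "z n > 0" using elim(3) \<rho>0 by linarith
      have w0: "w n > 0" using elim by linarith
      have k: "w n / (\<alpha> n + w n) = \<kappa> n" "\<alpha> n + w n = \<alpha> n * z n" using elim(4) by auto
      have "\<kappa> n \<noteq> 0" using elim \<kappa>0 by auto
      hence ks: "w n / (\<alpha> n + w n) * s x n = x - ln (\<kappa> n)" unfolding k(1) by (simp add: s_def)
      have "\<kappa> n = w n / (\<alpha> n * z n)" using k by (simp only:)
      also have "ln \<dots> = ln (w n) - (ln (\<alpha> n) + ln (z n))"
        using elim(5) z0 w0 by (simp add: ln_div ln_mult_pos)
      finally have lk: "ln (\<kappa> n) = ln (w n) - (ln (\<alpha> n) + ln (z n))" .
      have zz: "1 + w n / \<alpha> n = z n" using elim(4,5) by (simp add: field_simps)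
      have "w n = \<alpha> n * z n - \<alpha> n" using elim(4) by (simp add: algebra_simps)
      hence w: "w n = L n - ln (2 * pi) / 2 - ln (\<alpha> n) / 2 + (\<alpha> n - 1) * ln (z n)"
        using elim(3) by simp
      have "ln (real n) + ln (\<alpha> n) / 2 + \<alpha> n * ln (z n) - w n - ln (w n) - (x - ln (\<kappa> n)) = ln (2 * pi) / 2 - x"
        unfolding lk by (simp add: algebra_simps) (simp add: w L_def algebra_simps)
      thus ?case unfolding ks zz by simp
    qed
    thus "(\<lambda>n. ln (real n) + ln (\<alpha> n) / 2 + \<alpha> n * ln (1 + w n / \<alpha> n) - w n - ln (w n)
         - w n / (\<alpha> n + w n) * s x n) \<longlonglongrightarrow> ln (2 * pi) / 2 - x"
      by (rule Lim_transform_eventually[OF tendsto_const])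
  next
    show "(\<lambda>n. (\<alpha> n + w n) / (inverse (\<kappa> n) * sqrt (real n * \<alpha> n))) \<longlonglongrightarrow> 0"
    proof (rule Lim_null_comparison)
      show "(\<lambda>n. (2 + 2 * \<rho>1) * (sqrt (C0 * L n) / sqrt (real n))) \<longlonglongrightarrow> 0"
        using C0pos unfolding L_def by real_asymp
      show "\<forall>\<^sub>F n in sequentially. norm ((\<alpha> n + w n) / (inverse (\<kappa> n) * sqrt (real n * \<alpha> n))) \<le>
          (2 + 2 * \<rho>1) * (sqrt (C0 * L n) / sqrt (real n))"
        using ev\<kappa> evz wk ev1 bounds eventually_gt_at_top[of 0]
      proof eventually_elim
        case (elim n)
        have k: "\<kappa> n > 0" using elim \<kappa>0 by linarith
        have sq: "sqrt (\<alpha> n) * sqrt (\<alpha> n) = \<alpha> n" using elim by simp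
        have "(\<alpha> n + w n) / (inverse (\<kappa> n) * sqrt (real n * \<alpha> n)) = \<alpha> n * z n * \<kappa> n / (sqrt (real n) * sqrt (\<alpha> n))"
          using elim(3) by (simp add: real_sqrt_mult field_simps)
        also have "\<dots> = (z n * \<kappa> n) * (sqrt (\<alpha> n) / sqrt (real n))"
          using elim sq by (simp add: field_simps)
        finally have eq: "(\<alpha> n + w n) / (inverse (\<kappa> n) * sqrt (real n * \<alpha> n)) = (z n * \<kappa> n) * (sqrt (\<alpha> n) / sqrt (real n))" .
        have z0: "z n > 0" using elim \<rho>0 by linarith
        have "z n * \<kappa> n \<le> (2 + 2 * \<rho>1) * 1"
          using elim k z0 by (intro mult_mono) auto
        moreover have "sqrt (\<alpha> n) / sqrt (real n) \<le> sqrt (C0 * L n) / sqrt (real n)"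
          using elim by (intro divide_right_mono) auto
        ultimately have "(z n * \<kappa> n) * (sqrt (\<alpha> n) / sqrt (real n)) \<le> (2 + 2 * \<rho>1) * 1 * (sqrt (C0 * L n) / sqrt (real n))"
          using elim k z0 by (intro mult_mono) auto
        moreover have "0 \<le> (z n * \<kappa> n) * (sqrt (\<alpha> n) / sqrt (real n))"
          using k z0 elim(4) by (intro mult_nonneg_nonneg divide_nonneg_nonneg) auto
        ultimately show ?case unfolding eq by simp
      qed
    qed
  qed auto
  thus ?thesis by (simp add: \<kappa>_def)
qed

section \<open>The limit law for convergent total shape\<close>

text \<open>The event forces all coordinates to be nonpositive. There the density is 0 everywhere:
  outside the simplex when a coordinate is negative, and at the origin because of
  \<open>0 powr c = 0\<close>.\<close>

lemma cdf_normalized_max_nonpos: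
  fixes M :: "nat \<Rightarrow> 'a measure"
  assumes n: "n \<ge> 1" and dir: "has_dirichlet (M n) n (X n) (\<alpha> n) (\<beta> n)"
    and pos: "\<alpha> n > 0" "\<beta> n > 0" "c n > 0" and x: "x \<le> 0"
  shows "cdf (distr (M n) borel (normalized_max \<alpha> \<beta> X (\<lambda>n. 0) c n)) x = 0"
proof -
  let ?P = "PiM {1..n} (\<lambda>_. lborel :: real measure)"
  let ?A = "{x \<in> space ?P. \<forall>i\<in>{1..n}. x i \<le> 0}"
  have [measurable]: "Mtilde X n \<in> borel_measurable (M n)"
    by (rule measurable_Mtilde(1)[where X = X, OF n dir])
  have [measurable]: "normalized_max \<alpha> \<beta> X (\<lambda>n. 0) c n \<in> borel_measurable (M n)"
    unfolding normalized_max_def[abs_def] by measurable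
  have T: "real n * \<alpha> n + \<beta> n > 0" using n pos by (simp add: add_nonneg_pos)
  have A: "?A \<in> sets ?P" by measurable
  have X: "(\<lambda>\<omega>. \<lambda>i\<in>{1..n}. X n i \<omega>) \<in> measurable (M n) ?P"
    using dir by (simp add: has_dirichlet_def distributed_def)
  have "normalized_max \<alpha> \<beta> X (\<lambda>n. 0) c n -` {..x} \<inter> space (M n) \<subseteq>
      (\<lambda>\<omega>. \<lambda>i\<in>{1..n}. X n i \<omega>) -` ?A \<inter> space (M n)"
  proof
    fix \<omega> assume "\<omega> \<in> normalized_max \<alpha> \<beta> X (\<lambda>n. 0) c n -` {..x} \<inter> space (M n)"
    hence \<omega>: "\<omega> \<in> space (M n)" "normalized_max \<alpha> \<beta> X (\<lambda>n. 0) c n \<omega> \<le> x" by auto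
    hence "Mtilde X n \<omega> \<le> 0"
      using x pos T by (simp add: normalized_max_def divide_le_eq)
        (smt (verit) mult_nonneg_nonpos2 mult_pos_pos mult.commute)
    thus "\<omega> \<in> (\<lambda>\<omega>. \<lambda>i\<in>{1..n}. X n i \<omega>) -` ?A \<inter> space (M n)"
      using n \<omega>(1) by (auto simp: Mtilde_def space_PiM)
  qed
  hence "emeasure (M n) (normalized_max \<alpha> \<beta> X (\<lambda>n. 0) c n -` {..x} \<inter> space (M n)) \<le>
      emeasure (M n) ((\<lambda>\<omega>. \<lambda>i\<in>{1..n}. X n i \<omega>) -` ?A \<inter> space (M n))"
    using measurable_sets[OF X A] by (rule emeasure_mono)
  also have "\<dots> = (\<integral>\<^sup>+x. ennreal (dirichlet_density n (\<alpha> n) (\<beta> n) x) * indicator ?A x \<partial>?P)"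
    by (rule distributed_emeasure[OF dir[unfolded has_dirichlet_def] A])
  also have "\<dots> = (\<integral>\<^sup>+x. 0 \<partial>?P)"
  proof (intro nn_integral_cong)
    fix x
    show "ennreal (dirichlet_density n (\<alpha> n) (\<beta> n) x) * indicator ?A x = 0"
    proof (cases "(\<forall>i\<in>{1..n}. 0 \<le> x i) \<and> x \<in> ?A")
      case True
      hence "x 1 = 0" using n by force
      hence "(\<Prod>i=1..n. x i) = 0" using n by (intro prod_zero) auto
      hence "dirichlet_density n (\<alpha> n) (\<beta> n) x = 0" by (simp only: dirichlet_density_def) simp
      thus ?thesis by simp
    next
      case False
      thus ?thesis
      proof (cases "x \<in> ?A")
        case True
        with False have "\<not> (\<forall>i\<in>{1..n}. 0 \<le> x i)" by blast
        hence "dirichlet_density n (\<alpha> n) (\<beta> n) x = 0"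
          unfolding dirichlet_density_def by (simp only: simp_thms if_False)
        thus ?thesis by simp
      qed simp
    qed
  qed
  finally have "emeasure (M n) (normalized_max \<alpha> \<beta> X (\<lambda>n. 0) c n -` {..x} \<inter> space (M n)) = 0" by simp
  thus ?thesis by (simp add: cdf_def measure_def emeasure_distr)
qed

lemma gamma_tail_integral:
  assumes "a > 0" "y > 0"
  shows "Gamma a * gamma_tail a y = (LINT t|lborel. indicator {y..} t * (t powr (a - 1) * exp (- t)))"
proof -
  have "(LINT t|lborel. indicator {y..} t * (t powr (a - 1) * exp (- t))) =
      enn2real (\<integral>\<^sup>+t. ennreal (indicator {y..} t * (t powr (a - 1) * exp (- t))) \<partial>lborel)"
    by (rule integral_eq_nn_integral) (auto intro: AE_I2)
  also have "(\<integral>\<^sup>+t. ennreal (indicator {y..} t * (t powr (a - 1) * exp (- t))) \<partial>lborel) =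
      (\<integral>\<^sup>+t. ennreal (t powr (a - 1) * exp (- t)) * indicator {y..} t \<partial>lborel)"
    by (intro nn_integral_cong) (auto simp: indicator_def)
  also have "\<dots> = ennreal (Gamma a * gamma_tail a y)" by (rule nn_integral_gamma_tail[OF assms])
  finally show ?thesis using assms by (simp add: gamma_tail_nonneg)
qed

lemma integrable_exp_minus_atLeast:
  "integrable lborel (\<lambda>t::real. indicator {0..} t * exp (- t))"
proof (rule integrableI_nonneg)
  have "(\<integral>\<^sup>+t. ennreal (indicator {0..} t * exp (- t)) \<partial>lborel) =
      (\<integral>\<^sup>+t. ennreal (exp (- t)) * indicator {0..} t \<partial>lborel)"
    by (intro nn_integral_cong) (auto simp: indicator_def)
  also have "\<dots> = ennreal (0 - - exp (- 0))"
  proof (rule nn_integral_FTC_atLeast)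
    show "((\<lambda>t::real. - exp (- t)) \<longlongrightarrow> 0) at_top" by real_asymp
  qed (auto intro!: derivative_eq_intros)
  finally show "(\<integral>\<^sup>+t. ennreal (indicator {0..} t * exp (- t)) \<partial>lborel) < \<infinity>" by simp
qed auto

text \<open>Since \<open>Gamma (\<alpha> n) = Gamma (\<alpha> n + 1) / \<alpha> n\<close>, the
  scaled tail is \<open>n * \<alpha> n / Gamma (\<alpha> n + 1)\<close>, which tends to
  \<open>a\<close>, times an integral that no longer contains a normalising constant.\<close>

lemma gamma_tail_limit_vanishing_shape:
  fixes \<alpha> c :: "nat \<Rightarrow> real"
  assumes pos: "\<And>n. n \<ge> 1 \<Longrightarrow> \<alpha> n > 0"
    and na: "(\<lambda>n. real n * \<alpha> n) \<longlonglongrightarrow> a" and c: "c \<longlonglongrightarrow> 1" and x: "x > 0"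
  shows "(\<lambda>n. real n * gamma_tail (\<alpha> n) (c n * x)) \<longlonglongrightarrow> a * (LINT u:{x..}|lborel. exp (- u) / u)"
proof -
  have a0: "\<alpha> \<longlonglongrightarrow> 0"
  proof -
    have "(\<lambda>n. (real n * \<alpha> n) * (1 / real n)) \<longlonglongrightarrow> 0"
      using tendsto_mult[OF na lim_1_over_n] by simp
    moreover have "\<forall>\<^sub>F n in sequentially. (real n * \<alpha> n) * (1 / real n) = \<alpha> n"
      using eventually_gt_at_top[of 0] by eventually_elim simp
    ultimately show ?thesis by (rule Lim_transform_eventually)
  qed
  have cx: "(\<lambda>n. c n * x) \<longlonglongrightarrow> x" using tendsto_mult[OF c tendsto_const[of x]] by simp
  define f where "f n t = indicator {c n * x..} t * (t powr (\<alpha> n - 1) * exp (- t))" for n and t :: real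
  define f0 where "f0 t = indicator {x..} t * (exp (- t) / t)" for t :: real
  \<comment> \<open>Eventually the integrand lives on \<open>t > x / 2\<close> with shape below 1,
    where \<open>t powr (\<alpha> n - 1)\<close> is at most 1 for \<open>t \<ge> 1\<close> and at
    most \<open>1 / t < 2 / x\<close> otherwise.\<close>
  define g where "g t = (1 + 2 / x) * (indicator {0..} t * exp (- t))" for t :: real
  have [measurable]: "f n \<in> borel_measurable borel" "f0 \<in> borel_measurable borel" for n
    unfolding f_def f0_def by measurable
  have g: "integrable lborel g"
    unfolding g_def using integrable_exp_minus_atLeast by (intro integrable_mult_right) auto
  have "\<forall>\<^sub>F n in sequentially. x / 2 < c n * x" by (rule order_tendstoD(1)[OF cx]) (use x in simp)
  moreover have "\<forall>\<^sub>F n in sequentially. \<alpha> n < 1" using a0 by (rule order_tendstoD) simp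
  ultimately have "\<forall>\<^sub>F n in sequentially. x / 2 < c n * x \<and> \<alpha> n < 1 \<and> n \<ge> 1"
    using eventually_ge_at_top[of 1] by eventually_elim simp
  then obtain N where N: "\<And>n. n \<ge> N \<Longrightarrow> x / 2 < c n * x \<and> \<alpha> n < 1 \<and> n \<ge> 1"
    unfolding eventually_sequentially by blast
  \<comment> \<open>At \<open>t = x\<close> the indicator with moving endpoint
    \<open>c n * x\<close> may oscillate; this single point is discarded as a null set.\<close>
  have lim: "(\<lambda>n. f n t) \<longlonglongrightarrow> f0 t" if "t \<noteq> x" "t > 0" for t
  proof -
    have "(\<lambda>n. t powr (\<alpha> n - 1) * exp (- t)) \<longlonglongrightarrow> t powr (0 - 1) * exp (- t)"
      using that by (intro tendsto_intros a0) auto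
    also have "t powr (0 - 1) * exp (- t) = exp (- t) / t"
      using powr_neg_one[OF that(2)] by simp
    finally have l: "(\<lambda>n. t powr (\<alpha> n - 1) * exp (- t)) \<longlonglongrightarrow> exp (- t) / t" .
    have "(\<lambda>n. indicator {c n * x..} t :: real) \<longlonglongrightarrow> indicator {x..} t"
    proof (cases "x < t")
      case True
      have "\<forall>\<^sub>F n in sequentially. c n * x < t" by (rule order_tendstoD(2)[OF cx True])
      hence "\<forall>\<^sub>F n in sequentially. indicator {x..} t = (indicator {c n * x..} t :: real)"
        by eventually_elim (use True in auto)
      thus ?thesis by (rule Lim_transform_eventually[OF tendsto_const])
    next
      case False
      hence "t < x" using that by simp
      hence "\<forall>\<^sub>F n in sequentially. t < c n * x" by (rule order_tendstoD(1)[OF cx])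
      hence "\<forall>\<^sub>F n in sequentially. indicator {x..} t = (indicator {c n * x..} t :: real)"
        by eventually_elim (use \<open>t < x\<close> in auto)
      thus ?thesis by (rule Lim_transform_eventually[OF tendsto_const])
    qed
    from tendsto_mult[OF this l] show ?thesis by (simp add: f_def f0_def)
  qed
  have bnd: "\<bar>f n t\<bar> \<le> g t" if "n \<ge> N" for n t
  proof (cases "t \<ge> c n * x")
    case True
    with N[OF that] x have t: "t > x / 2" "t > 0" by linarith+
    have "t powr (\<alpha> n - 1) \<le> 1 + 2 / x"
    proof (cases "t \<ge> 1")
      case True
      have "t powr (\<alpha> n - 1) \<le> t powr 0" using True N[OF that] by (intro powr_mono) auto
      also have "\<dots> \<le> 1 + 2 / x" using t x by simp
      finally show ?thesis .
    next
      case False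
      have "t powr (\<alpha> n - 1) \<le> t powr (- 1)"
        using False t N[OF that] pos[of n] by (intro powr_mono') auto
      also have "\<dots> = 1 / t" using t(2) by (rule powr_neg_one)
      also have "\<dots> \<le> 1 / (x / 2)" using t x by (intro divide_left_mono) auto
      also have "\<dots> \<le> 1 + 2 / x" by simp
      finally show ?thesis .
    qed
    hence "t powr (\<alpha> n - 1) * exp (- t) \<le> (1 + 2 / x) * exp (- t)" by (intro mult_right_mono) auto
    thus ?thesis using True t by (simp add: f_def g_def)
  next
    case False
    thus ?thesis using x by (simp add: f_def g_def)
  qed
  have int: "(\<lambda>n. LINT t|lborel. f (n + N) t) \<longlonglongrightarrow> (LINT t|lborel. f0 t)"
  proof (rule integral_dominated_convergence[OF _ _ g])
    have "AE t in lborel. t \<noteq> x" by (rule AE_lborel_singleton)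
    thus "AE t in lborel. (\<lambda>n. f (n + N) t) \<longlonglongrightarrow> f0 t"
    proof eventually_elim
      case (elim t)
      show ?case
      proof (cases "t > 0")
        case True
        thus ?thesis using LIMSEQ_ignore_initial_segment[OF lim[OF elim True], of N] by simp
      next
        case False
        have "f (n + N) t = 0" for n
        proof -
          have "t < c (n + N) * x" using False N[of "n + N"] x by linarith
          thus ?thesis by (simp add: f_def)
        qed
        moreover have "f0 t = 0" using False x by (auto simp: f0_def indicator_def)
        ultimately show ?thesis by simp
      qed
    qed
    show "AE t in lborel. norm (f (i + N) t) \<le> g t" for i by (intro AE_I2) (use bnd[of "i + N"] in simp)
  qed measurable
  hence int': "(\<lambda>n. LINT t|lborel. f n t) \<longlonglongrightarrow> (LINT t|lborel. f0 t)" by (rule LIMSEQ_offset)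
  have "(\<lambda>n. Gamma (\<alpha> n + 1)) \<longlonglongrightarrow> Gamma (0 + 1)" by (intro tendsto_intros a0) auto
  hence "(\<lambda>n. Gamma (\<alpha> n + 1)) \<longlonglongrightarrow> 1" by simp
  from tendsto_mult[OF tendsto_divide[OF na this] int']
  have "(\<lambda>n. real n * \<alpha> n / Gamma (\<alpha> n + 1) * (LINT t|lborel. f n t)) \<longlonglongrightarrow> a * (LINT t|lborel. f0 t)" by simp
  moreover have "\<forall>\<^sub>F n in sequentially. real n * \<alpha> n / Gamma (\<alpha> n + 1) * (LINT t|lborel. f n t) =
      real n * gamma_tail (\<alpha> n) (c n * x)"
    using eventually_ge_at_top[of N]
  proof eventually_elim
    case (elim n)
    hence p: "\<alpha> n > 0" "c n * x > 0" using N[of n] pos[of n] x by auto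
    have "Gamma (\<alpha> n) > 0" using p by simp
    hence "Gamma (\<alpha> n) \<noteq> 0" by linarith
    thus ?case using p by (simp add: Gamma_real_plus1 f_def gamma_tail_integral[OF p, symmetric])
  qed
  ultimately have "(\<lambda>n. real n * gamma_tail (\<alpha> n) (c n * x)) \<longlonglongrightarrow> a * (LINT t|lborel. f0 t)"
    by (rule Lim_transform_eventually)
  thus ?thesis by (simp add: f0_def[abs_def] set_lebesgue_integral_def)
qed

text \<open>The scaling is left as any sequence tending to 1, so that both normalisations of the
  maximum become instances.\<close>

lemma F_cdf_case:
  fixes M :: "nat \<Rightarrow> 'a measure"
  assumes pos: "\<And>n. n \<ge> 1 \<Longrightarrow> \<alpha> n > 0" "\<And>n. n \<ge> 1 \<Longrightarrow> \<beta> n > 0"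
    and prob: "\<And>n. n \<ge> 1 \<Longrightarrow> prob_space (M n)"
    and dir: "\<And>n. n \<ge> 1 \<Longrightarrow> has_dirichlet (M n) n (X n) (\<alpha> n) (\<beta> n)"
    and T: "filterlim (\<lambda>n. real n * \<alpha> n + \<beta> n) at_top sequentially"
    and na: "(\<lambda>n. real n * \<alpha> n) \<longlonglongrightarrow> a" and c: "c \<longlonglongrightarrow> 1"
  shows "conv_in_distr M (normalized_max \<alpha> \<beta> X (\<lambda>n. 0) c) (F_cdf a)"
  unfolding conv_in_distr_def weak_conv_def
proof (intro allI impI)
  \<comment> \<open>Weak convergence concerns continuity points only, so continuity of
    \<open>F_cdf\<close> at \<open>x\<close> is available as an assumption.\<close>
  fix x assume cont: "isCont (F_cdf a) x"
  have c0: "\<forall>\<^sub>F n in sequentially. c n > 0" using c by (rule order_tendstoD) simp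
  show "(\<lambda>n. cdf (distr (M n) borel (normalized_max \<alpha> \<beta> X (\<lambda>n. 0) c n)) x) \<longlonglongrightarrow> F_cdf a x"
  proof (cases "x > 0")
    case False
    have "\<forall>\<^sub>F n in sequentially. F_cdf a x = cdf (distr (M n) borel (normalized_max \<alpha> \<beta> X (\<lambda>n. 0) c n)) x"
      using c0 eventually_ge_at_top[of 1]
    proof eventually_elim
      case (elim n)
      have "cdf (distr (M n) borel (normalized_max \<alpha> \<beta> X (\<lambda>n. 0) c n)) x = 0"
        using elim False by (intro cdf_normalized_max_nonpos dir pos) auto
      thus ?case using False by (simp add: F_cdf_def)
    qed
    thus ?thesis by (rule Lim_transform_eventually[OF tendsto_const])
  next
    case True
    show ?thesis
    proof (rule cdf_normalized_max_tendsto[OF pos prob dir, where S = "{0<..}" and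
          lam = "\<lambda>x. a * (LINT u:{x..}|lborel. exp (- u) / u)"])
      show "F_cdf a u = exp (- (a * (LINT u:{u..}|lborel. exp (- u) / u)))" if "u \<in> {0<..}" for u
        using that by (simp add: F_cdf_def)
      show "\<forall>\<^sub>F n in sequentially. 0 + c n * u > 0" if "u \<in> {0<..}" for u
        using c0 by eventually_elim (use that in simp)
      show "(\<lambda>n. real n * gamma_tail (\<alpha> n) (0 + c n * u)) \<longlonglongrightarrow> a * (LINT u:{u..}|lborel. exp (- u) / u)"
        if "u \<in> {0<..}" for u
        using gamma_tail_limit_vanishing_shape[of \<alpha> a c u] pos(1) na c that by simp
      have "(\<lambda>n. x * inverse (sqrt (real n * \<alpha> n + \<beta> n))) \<longlonglongrightarrow> 0"
        using tendsto_mult[OF tendsto_const[of x]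
            tendsto_inverse_0_at_top[OF filterlim_compose[OF sqrt_at_top T]]] by simp
      moreover have "\<forall>\<^sub>F n in sequentially. x * inverse (sqrt (real n * \<alpha> n + \<beta> n)) =
          (0 + c n * x) / (c n * sqrt (real n * \<alpha> n + \<beta> n))"
        using c0 by eventually_elim (simp add: divide_inverse)
      ultimately show "(\<lambda>n. (0 + c n * x) / (c n * sqrt (real n * \<alpha> n + \<beta> n))) \<longlonglongrightarrow> 0"
        by (rule Lim_transform_eventually)
    qed (use True cont c0 in auto)
  qed
qed

lemma conv_in_distr_cong:
  assumes "\<forall>\<^sub>F n in sequentially. Y n = Y' n" "conv_in_distr M Y F"
  shows "conv_in_distr M Y' F"
  unfolding conv_in_distr_def weak_conv_def
proof (intro allI impI)
  fix x assume "isCont F x"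
  hence "(\<lambda>n. cdf (distr (M n) borel (Y n)) x) \<longlonglongrightarrow> F x"
    using assms(2) by (simp add: conv_in_distr_def weak_conv_def)
  thus "(\<lambda>n. cdf (distr (M n) borel (Y' n)) x) \<longlonglongrightarrow> F x"
    by (rule Lim_transform_eventually) (use assms(1) in eventually_elim, simp)
qed

theorem corollary3p1:
  fixes M :: "nat \<Rightarrow> 'a measure"
    and X :: "nat \<Rightarrow> nat \<Rightarrow> 'a \<Rightarrow> real"
    and \<alpha> \<beta> :: "nat \<Rightarrow> real"
    and A :: ereal
  assumes "\<And>n. n \<ge> 1 \<Longrightarrow> \<alpha> n > 0"
    and "\<And>n. n \<ge> 1 \<Longrightarrow> \<beta> n > 0"
    and "\<And>n. n \<ge> 1 \<Longrightarrow> prob_space (M n)"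
    and "\<And>n. n \<ge> 1 \<Longrightarrow> has_dirichlet (M n) n (X n) (\<alpha> n) (\<beta> n)"
    and "A > 0"
    and "(\<lambda>n. ereal (real n * \<alpha> n)) \<longlonglongrightarrow> A"
    and "filterlim (\<lambda>n. real n * \<alpha> n + \<beta> n) at_top sequentially"
  shows
    "((\<lambda>n. ln (real n)) \<in> o(\<alpha>) \<longrightarrow>
       conv_in_distr M
         (normalized_max \<alpha> \<beta> X
           (\<lambda>n. \<alpha> n + b_seq \<alpha> n * sqrt (\<alpha> n))
           (\<lambda>n. sqrt (\<alpha> n / (2 * ln (real n))))) gumbel_cdf)
     \<and>
     ((\<exists>c>0. \<exists>C. \<forall>\<^sub>F n in sequentially. c \<le> \<alpha> n / ln (real n) \<and> \<alpha> n / ln (real n) \<le> C) \<longrightarrow>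
       conv_in_distr M
         (normalized_max \<alpha> \<beta> X
           (\<lambda>n. zeta_seq \<alpha> n
                - inverse (1 - \<alpha> n / zeta_seq \<alpha> n) * ln (1 - \<alpha> n / zeta_seq \<alpha> n))
           (\<lambda>n. inverse (1 - \<alpha> n / zeta_seq \<alpha> n))) gumbel_cdf)
     \<and>
     ((\<lambda>n. \<alpha> n / ln (real n)) \<longlonglongrightarrow> 0 \<and> filterlim \<alpha> at_top sequentially \<longrightarrow>
       conv_in_distr M
         (normalized_max \<alpha> \<beta> X
           (\<lambda>n. ln (real n) + (\<alpha> n - 1) * ln (ln (real n)) - ln (Gamma (\<alpha> n)) + xi_seq \<alpha> n)
           (\<lambda>n. 1)) gumbel_cdf)
     \<and>
     ((\<lambda>n. ln (\<alpha> n)) \<in> o(\<lambda>n. ln (real n)) \<and> Bseq \<alpha> \<longrightarrow>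
       conv_in_distr M
         (normalized_max \<alpha> \<beta> X
           (\<lambda>n. ln (real n) + (\<alpha> n - 1) * ln (ln (real n)) - ln (Gamma (\<alpha> n)))
           (\<lambda>n. 1)) gumbel_cdf)
     \<and>
     (Bseq \<alpha> \<and> filterlim (\<lambda>n. real n * \<alpha> n) at_top sequentially \<and>
      (\<exists>c>0. \<forall>\<^sub>F n in sequentially. c \<le> \<bar>ln (\<alpha> n) / ln (real n)\<bar>) \<longrightarrow>
       conv_in_distr M
         (normalized_max \<alpha> \<beta> X
           (\<lambda>n. ln (real n * \<alpha> n) + (\<alpha> n - 1) * ln (ln (real n * \<alpha> n)))
           (\<lambda>n. 1)) gumbel_cdf)
     \<and>
     (\<forall>a. A = ereal a \<and> filterlim \<beta> at_top sequentially \<longrightarrow>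
       conv_in_distr M
         (normalized_max \<alpha> \<beta> X
           (\<lambda>n. 0)
           (\<lambda>n. \<beta> n / (real n * \<alpha> n + \<beta> n))) (F_cdf a)
       \<and> conv_in_distr M (\<lambda>n \<omega>. \<beta> n * Mtilde X n \<omega>) (F_cdf a))"
proof (intro conjI impI allI)
  note basic = assms(1-4)
  show "conv_in_distr M (normalized_max \<alpha> \<beta> X (\<lambda>n. \<alpha> n + b_seq \<alpha> n * sqrt (\<alpha> n))
      (\<lambda>n. sqrt (\<alpha> n / (2 * ln (real n))))) gumbel_cdf"
    if "(\<lambda>n. ln (real n)) \<in> o(\<alpha>)"
    by (rule gumbel_case_superlogarithmic_shape) (rule basic that | assumption)+
  show "conv_in_distr M (normalized_max \<alpha> \<beta> X
      (\<lambda>n. zeta_seq \<alpha> n - inverse (1 - \<alpha> n / zeta_seq \<alpha> n) * ln (1 - \<alpha> n / zeta_seq \<alpha> n))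
      (\<lambda>n. inverse (1 - \<alpha> n / zeta_seq \<alpha> n))) gumbel_cdf"
    if "\<exists>c>0. \<exists>C. \<forall>\<^sub>F n in sequentially. c \<le> \<alpha> n / ln (real n) \<and> \<alpha> n / ln (real n) \<le> C"
  proof -
    from that obtain c C where "c > 0"
      "\<forall>\<^sub>F n in sequentially. c \<le> \<alpha> n / ln (real n) \<and> \<alpha> n / ln (real n) \<le> C" by blast
    note cC = this
    show ?thesis by (rule gumbel_case_logarithmic_shape) (rule basic cC | assumption)+
  qed
  show "conv_in_distr M (normalized_max \<alpha> \<beta> X
      (\<lambda>n. ln (real n) + (\<alpha> n - 1) * ln (ln (real n)) - ln (Gamma (\<alpha> n)) + xi_seq \<alpha> n)
      (\<lambda>n. 1)) gumbel_cdf"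
    if "(\<lambda>n. \<alpha> n / ln (real n)) \<longlonglongrightarrow> 0 \<and> filterlim \<alpha> at_top sequentially"
    by (rule gumbel_case_sublogarithmic_shape) (rule basic that[THEN conjunct1] that[THEN conjunct2] | assumption)+
  show "conv_in_distr M (normalized_max \<alpha> \<beta> X
      (\<lambda>n. ln (real n) + (\<alpha> n - 1) * ln (ln (real n)) - ln (Gamma (\<alpha> n))) (\<lambda>n. 1)) gumbel_cdf"
    if "(\<lambda>n. ln (\<alpha> n)) \<in> o(\<lambda>n. ln (real n)) \<and> Bseq \<alpha>"
    by (rule gumbel_case_subpolynomial_shape) (rule basic that[THEN conjunct1] that[THEN conjunct2] | assumption)+
  show "conv_in_distr M (normalized_max \<alpha> \<beta> X
      (\<lambda>n. ln (real n * \<alpha> n) + (\<alpha> n - 1) * ln (ln (real n * \<alpha> n))) (\<lambda>n. 1)) gumbel_cdf"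
    if "Bseq \<alpha> \<and> filterlim (\<lambda>n. real n * \<alpha> n) at_top sequentially \<and>
      (\<exists>c>0. \<forall>\<^sub>F n in sequentially. c \<le> \<bar>ln (\<alpha> n) / ln (real n)\<bar>)"
  proof -
    from that obtain c where c: "Bseq \<alpha>" "filterlim (\<lambda>n. real n * \<alpha> n) at_top sequentially"
      "c > 0" "\<forall>\<^sub>F n in sequentially. c \<le> \<bar>ln (\<alpha> n) / ln (real n)\<bar>" by blast
    show ?thesis by (rule gumbel_case_polynomial_shape) (rule basic c | assumption)+
  qed
  fix a assume a: "A = ereal a \<and> filterlim \<beta> at_top sequentially"
  hence na: "(\<lambda>n. real n * \<alpha> n) \<longlonglongrightarrow> a" using assms(6) by simp
  have ib: "(\<lambda>n. inverse (\<beta> n)) \<longlonglongrightarrow> 0" using a by (intro tendsto_inverse_0_at_top) simp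
  have "(\<lambda>n. real n * \<alpha> n * inverse (\<beta> n) + 1) \<longlonglongrightarrow> 1"
    using tendsto_add[OF tendsto_mult[OF na ib] tendsto_const[of 1]] by simp
  moreover have "\<forall>\<^sub>F n in sequentially. real n * \<alpha> n * inverse (\<beta> n) + 1 = (real n * \<alpha> n + \<beta> n) / \<beta> n"
    using eventually_ge_at_top[of 1]
  proof eventually_elim
    case (elim n)
    thus ?case using assms(2)[OF elim] by (simp add: field_simps)
  qed
  ultimately have c1: "(\<lambda>n. (real n * \<alpha> n + \<beta> n) / \<beta> n) \<longlonglongrightarrow> 1" by (rule Lim_transform_eventually)
  have c2: "(\<lambda>n. \<beta> n / (real n * \<alpha> n + \<beta> n)) \<longlonglongrightarrow> 1" using tendsto_inverse[OF c1] by simp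
  show "conv_in_distr M (normalized_max \<alpha> \<beta> X (\<lambda>n. 0) (\<lambda>n. \<beta> n / (real n * \<alpha> n + \<beta> n))) (F_cdf a)"
    by (rule F_cdf_case) (rule basic assms(7) na c2 | assumption)+
  \<comment> \<open>Dividing \<open>T * Mtilde\<close> by \<open>T / \<beta> n\<close>, with
    \<open>T = n * \<alpha> n + \<beta> n\<close>, gives \<open>\<beta> n * Mtilde\<close>; this
    scaling also tends to 1.\<close>
  have "conv_in_distr M (normalized_max \<alpha> \<beta> X (\<lambda>n. 0) (\<lambda>n. (real n * \<alpha> n + \<beta> n) / \<beta> n)) (F_cdf a)"
    by (rule F_cdf_case) (rule basic assms(7) na c1 | assumption)+
  moreover have "\<forall>\<^sub>F n in sequentially. normalized_max \<alpha> \<beta> X (\<lambda>n. 0) (\<lambda>n. (real n * \<alpha> n + \<beta> n) / \<beta> n) n =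
      (\<lambda>\<omega>. \<beta> n * Mtilde X n \<omega>)"
    using eventually_ge_at_top[of 1]
  proof eventually_elim
    case (elim n)
    have "real n * \<alpha> n + \<beta> n > 0" "\<beta> n > 0"
      using assms(1,2)[OF elim] by (auto intro: add_nonneg_pos)
    hence "real n * \<alpha> n + \<beta> n \<noteq> 0" "\<beta> n \<noteq> 0" by auto
    thus ?case by (simp add: normalized_max_def fun_eq_iff)
  qed
  ultimately show "conv_in_distr M (\<lambda>n \<omega>. \<beta> n * Mtilde X n \<omega>) (F_cdf a)"
    by (rule conv_in_distr_cong[rotated])
qed


end
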